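(* Let $\mathbf{BICAT}_\ell$ be the 2-category of large bicategories, lax functors and icons, and let $\mathrm{Enr}\colon\mathbf{BICAT}_\ell\to2\text{-}\mathbf{CAT}$ be the 2-functor sending a bicategory $\mathscr B$ to the 2-category $\mathscr B\text{-}\mathbf{Cat}$ of small $\mathscr B$-enriched categories, $\mathscr B$-functors and $\mathscr B$-natural transformations. Then $\mathrm{Enr}$ is not a parametric right 2-adjoint; that is, the 2-functor $\mathrm{Enr}_1\colon\mathbf{BICAT}_\ell\to2\text{-}\mathbf{CAT}/\mathrm{Enr}(1)=2\text{-}\mathbf{CAT}/\mathbf{Set}_{\mathrm{lc}}$, $\mathscr B\mapsto(\mathrm{Enr}(!_{\mathscr B})\colon\mathscr B\text{-}\mathbf{Cat}\to\mathbf{Set}_{\mathrm{lc}})$, does not have a left 2-adjoint.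
   Context: Size: fix Grothendieck universes $\mathcal U_1\in\mathcal U_2$; small means in $\mathcal U_1$, large means in $\mathcal U_2$. $2\text{-}\mathbf{CAT}$ is the 2-category of large 2-categories, 2-functors and 2-natural transformations; slices are strict slice 2-categories. $\mathbf{Set}_{\mathrm{lc}}$ is the 2-category whose underlying category is the category of small sets and which has exactly one 2-cell between any two parallel functions. For a 2-category $\mathscr K$ with a terminal object $1$, a 2-functor $R\colon\mathscr K\to\mathscr L$ is a parametric right 2-adjoint if $R_1\colon\mathscr K\to\mathscr L/R1$, $K\mapsto(R!_K\colon RK\to R1)$, has a left 2-adjoint. Enrichment over a bicategory $\mathscr B$ (writing $\Delta\cdot\Gamma$ for the composite of $\Gamma\colon A\to A'$ followed by $\Delta\colon A'\to A''$; coherence isomorphisms suppressed). A $\mathscr B$-category $\mathsf C$ has a set $\mathrm{ob}(\mathsf C)$ (small, for a small $\mathscr B$-category), an object $|c|\in\mathscr B$ (the extent) for each $c$, 1-cells $\mathsf C(c,c')\colon|c|\to|c'|$, and 2-cells $\eta_c\colon 1_{|c|}\to\mathsf C(c,c)$ and $\mu_{c_0,c_1,c_2}\colon\mathsf C(c_1,c_2)\cdot\mathsf C(c_0,c_1)\to\mathsf C(c_0,c_2)$ satisfying the unit and associativity laws. A $\mathscr B$-functor $f\colon\mathsf C\to\mathsf D$ is a function $c\mapsto fc$ on objects with $|fc|=|c|$ together with 2-cells $\omega^f_{c,c'}\colon\mathsf C(c,c')\to\mathsf D(fc,fc')$ compatible with $\eta$ and $\mu$. A $\mathscr B$-natural transformation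 $\alpha\colon f\to f'$ is a family of 2-cells $\alpha_c\colon1_{|c|}\to\mathsf D(fc,f'c)$ such that the two composites $\mathsf C(c,c')\to\mathsf D(fc,f'c')$, one obtained from $\alpha_c$ and $\omega^{f'}_{c,c'}$ and the other from $\omega^f_{c,c'}$ and $\alpha_{c'}$ using $\mu$, are equal. Lax functors and icons act on all the data in the evident way, making $\mathrm{Enr}$ a 2-functor. $1$ is the terminal bicategory, and $\mathrm{Enr}(1)=\mathbf{Set}_{\mathrm{lc}}$. *)

theory Defs
  imports "HOL-Library.FuncSet"
begin

section \<open>Universes\<close>

text \<open>
  The elements of a type of this class are the elements of the larger universe
  \<open>\<U>\<^sub>2\<close>, and \<open>elts x\<close> is the set of members of \<open>x\<close>; the axioms say that \<open>\<U>\<^sub>2\<close> is a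
  Grothendieck universe relative to the HOL metatheory (in particular every HOL subset of a
  member, and every HOL family indexed by a member, counts). The smaller universe
  \<open>\<U>\<^sub>1 \<in> \<U>\<^sub>2\<close> is the distinguished element \<open>small_universe\<close>. Universes are required to be
  nonempty, but \<open>\<omega> \<in> \<U>\<^sub>1\<close> is not required.
\<close>

class universe_pair =
  fixes elts :: "'a \<Rightarrow> 'a set"
    and small_universe :: "'a"
  assumes elts_inject: "elts x = elts y \<Longrightarrow> x = y"
    and elts_wf: "wf {(x, y). x \<in> elts y}"
    and large_subset: "S \<subseteq> elts x \<Longrightarrow> S \<in> range elts"
    and large_pair: "{x, y} \<in> range elts"
    and large_power: "{s. elts s \<subseteq> elts x} \<in> range elts"
    and large_UN: "(\<Union>i\<in>elts x. elts (u i)) \<in> range elts"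
    and small_nonempty: "elts small_universe \<noteq> {}"
    and small_transitive: "x \<in> elts small_universe \<Longrightarrow> elts x \<subseteq> elts small_universe"
    and small_pair: "x \<in> elts small_universe \<Longrightarrow> y \<in> elts small_universe \<Longrightarrow>
      {x, y} \<in> elts ` elts small_universe"
    and small_power: "x \<in> elts small_universe \<Longrightarrow>
      {s. elts s \<subseteq> elts x} \<in> elts ` elts small_universe"
    and small_UN: "x \<in> elts small_universe \<Longrightarrow> u ` elts x \<subseteq> elts small_universe \<Longrightarrow>
      (\<Union>i\<in>elts x. elts (u i)) \<in> elts ` elts small_universe"

definition large :: "'v::universe_pair set \<Rightarrow> bool"
  where "large S \<longleftrightarrow> S \<in> range elts"

definition small :: "'v::universe_pair set \<Rightarrow> bool"
  where "small S \<longleftrightarrow> S \<in> elts ` elts small_universe"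

definition vset :: "'v::universe_pair set \<Rightarrow> 'v"
  where "vset S = (THE x. elts x = S)"

definition vpair :: "'v::universe_pair \<Rightarrow> 'v \<Rightarrow> 'v"
  where "vpair x y = vset {vset {x}, vset {x, y}}"

definition graph :: "'v::universe_pair set \<Rightarrow> ('v \<Rightarrow> 'v) \<Rightarrow> 'v"
  where "graph A f = vset {vpair x (f x) | x. x \<in> A}"

definition graph2 :: "'v::universe_pair set \<Rightarrow> ('v \<Rightarrow> 'v \<Rightarrow> 'v) \<Rightarrow> 'v"
  where "graph2 A f = vset {vpair (vpair x y) (f x y) | x y. x \<in> A \<and> y \<in> A}"

definition graph3 :: "'v::universe_pair set \<Rightarrow> ('v \<Rightarrow> 'v \<Rightarrow> 'v \<Rightarrow> 'v) \<Rightarrow> 'v"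
  where "graph3 A f =
    vset {vpair (vpair x (vpair y z)) (f x y z) | x y z. x \<in> A \<and> y \<in> A \<and> z \<in> A}"


section \<open>2-categories and bicategories\<close>

text \<open>
  \<open>Src\<close>, \<open>Tgt\<close> are the boundaries of 1-cells and \<open>Dom\<close>, \<open>Cod\<close> those of 2-cells; all
  composites are in applicative order. Operations take the value \<^const>\<open>undefined\<close> outside
  their domain, so that equality of the HOL records and functions below is equality of the
  mathematical structures.
\<close>

record ('o, 'a, 'c) twocat =
  Ob :: "'o set"
  Mor :: "'a set"
  Cel :: "'c set"
  Src :: "'a \<Rightarrow> 'o"
  Tgt :: "'a \<Rightarrow> 'o"
  Dom :: "'c \<Rightarrow> 'a"
  Cod :: "'c \<Rightarrow> 'a"
  Id1 :: "'o \<Rightarrow> 'a"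
  Id2 :: "'a \<Rightarrow> 'c"
  Cmp :: "'a \<Rightarrow> 'a \<Rightarrow> 'a"  (infixl \<open>\<odot>\<index>\<close> 75)
  Vcmp :: "'c \<Rightarrow> 'c \<Rightarrow> 'c"  (infixl \<open>\<cdot>\<index>\<close> 65)
  Hcmp :: "'c \<Rightarrow> 'c \<Rightarrow> 'c"  (infixl \<open>\<star>\<index>\<close> 70)

record ('o, 'a, 'c) bicat = "('o, 'a, 'c) twocat" +
  Asc :: "'a \<Rightarrow> 'a \<Rightarrow> 'a \<Rightarrow> 'c"
  Lun :: "'a \<Rightarrow> 'c"
  Run :: "'a \<Rightarrow> 'c"

definition in_hom :: "('o, 'a, 'c, 'z) twocat_scheme \<Rightarrow> 'a \<Rightarrow> 'o \<Rightarrow> 'o \<Rightarrow> bool"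
  where "in_hom K f a b \<longleftrightarrow> f \<in> Mor K \<and> Src K f = a \<and> Tgt K f = b"

definition in_cell :: "('o, 'a, 'c, 'z) twocat_scheme \<Rightarrow> 'c \<Rightarrow> 'a \<Rightarrow> 'a \<Rightarrow> bool"
  where "in_cell K \<alpha> f g \<longleftrightarrow> \<alpha> \<in> Cel K \<and> Dom K \<alpha> = f \<and> Cod K \<alpha> = g"

definition composable :: "('o, 'a, 'c, 'z) twocat_scheme \<Rightarrow> 'a \<Rightarrow> 'a \<Rightarrow> bool"
  where "composable K g f \<longleftrightarrow> g \<in> Mor K \<and> f \<in> Mor K \<and> Src K g = Tgt K f"

definition vcomposable :: "('o, 'a, 'c, 'z) twocat_scheme \<Rightarrow> 'c \<Rightarrow> 'c \<Rightarrow> bool"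
  where "vcomposable K \<beta> \<alpha> \<longleftrightarrow> \<beta> \<in> Cel K \<and> \<alpha> \<in> Cel K \<and> Dom K \<beta> = Cod K \<alpha>"

definition hcomposable :: "('o, 'a, 'c, 'z) twocat_scheme \<Rightarrow> 'c \<Rightarrow> 'c \<Rightarrow> bool"
  where "hcomposable K \<beta> \<alpha> \<longleftrightarrow>
    \<beta> \<in> Cel K \<and> \<alpha> \<in> Cel K \<and> Src K (Dom K \<beta>) = Tgt K (Dom K \<alpha>)"

definition inverse_cell :: "('o, 'a, 'c, 'z) twocat_scheme \<Rightarrow> 'c \<Rightarrow> 'c \<Rightarrow> bool"
  where "inverse_cell K \<alpha> \<beta> \<longleftrightarrow> in_cell K \<beta> (Cod K \<alpha>) (Dom K \<alpha>) \<and>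
    \<beta> \<cdot>\<^bsub>K\<^esub> \<alpha> = Id2 K (Dom K \<alpha>) \<and> \<alpha> \<cdot>\<^bsub>K\<^esub> \<beta> = Id2 K (Cod K \<alpha>)"

definition inv_cell :: "('o, 'a, 'c, 'z) twocat_scheme \<Rightarrow> 'c \<Rightarrow> 'c"
  where "inv_cell K \<alpha> = (THE \<beta>. inverse_cell K \<alpha> \<beta>)"

locale cell_structure =
  fixes K :: "('o, 'a, 'c, 'z) twocat_scheme" (structure)
  assumes src_tgt: "f \<in> Mor K \<Longrightarrow> Src K f \<in> Ob K \<and> Tgt K f \<in> Ob K"
    and dom_cod: "\<alpha> \<in> Cel K \<Longrightarrow> Dom K \<alpha> \<in> Mor K \<and> Cod K \<alpha> \<in> Mor K \<and>
      Src K (Dom K \<alpha>) = Src K (Cod K \<alpha>) \<and> Tgt K (Dom K \<alpha>) = Tgt K (Cod K \<alpha>)"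
    and Id1_type: "a \<in> Ob K \<Longrightarrow> in_hom K (Id1 K a) a a"
    and Id2_type: "f \<in> Mor K \<Longrightarrow> in_cell K (Id2 K f) f f"
    and Cmp_type: "composable K g f \<Longrightarrow> in_hom K (g \<odot> f) (Src K f) (Tgt K g)"
    and Vcmp_type: "vcomposable K \<beta> \<alpha> \<Longrightarrow> in_cell K (\<beta> \<cdot> \<alpha>) (Dom K \<alpha>) (Cod K \<beta>)"
    and Hcmp_type: "hcomposable K \<beta> \<alpha> \<Longrightarrow>
      in_cell K (\<beta> \<star> \<alpha>) (Dom K \<beta> \<odot> Dom K \<alpha>) (Cod K \<beta> \<odot> Cod K \<alpha>)"
    and Vcmp_assoc: "vcomposable K \<gamma> \<beta> \<Longrightarrow> vcomposable K \<beta> \<alpha> \<Longrightarrow> \<gamma> \<cdot> \<beta> \<cdot> \<alpha> = \<gamma> \<cdot> (\<beta> \<cdot> \<alpha>)"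
    and Vcmp_Id2: "\<alpha> \<in> Cel K \<Longrightarrow> Id2 K (Cod K \<alpha>) \<cdot> \<alpha> = \<alpha> \<and> \<alpha> \<cdot> Id2 K (Dom K \<alpha>) = \<alpha>"
    and Hcmp_Id2: "composable K g f \<Longrightarrow> Id2 K g \<star> Id2 K f = Id2 K (g \<odot> f)"
    and interchange: "vcomposable K \<beta>' \<beta> \<Longrightarrow> vcomposable K \<alpha>' \<alpha> \<Longrightarrow> hcomposable K \<beta> \<alpha> \<Longrightarrow>
      (\<beta>' \<cdot> \<beta>) \<star> (\<alpha>' \<cdot> \<alpha>) = (\<beta>' \<star> \<alpha>') \<cdot> (\<beta> \<star> \<alpha>)"
    and Src_Tgt_extensional: "Src K \<in> extensional (Mor K)" "Tgt K \<in> extensional (Mor K)"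
    and Dom_Cod_extensional: "Dom K \<in> extensional (Cel K)" "Cod K \<in> extensional (Cel K)"
    and Id_extensional: "Id1 K \<in> extensional (Ob K)" "Id2 K \<in> extensional (Mor K)"
    and Cmp_extensional: "\<not> composable K g f \<Longrightarrow> g \<odot> f = undefined"
    and Vcmp_extensional: "\<not> vcomposable K \<beta> \<alpha> \<Longrightarrow> \<beta> \<cdot> \<alpha> = undefined"
    and Hcmp_extensional: "\<not> hcomposable K \<beta> \<alpha> \<Longrightarrow> \<beta> \<star> \<alpha> = undefined"

locale two_category = cell_structure K
  for K :: "('o, 'a, 'c) twocat" (structure) +
  assumes Cmp_assoc: "composable K h g \<Longrightarrow> composable K g f \<Longrightarrow> h \<odot> g \<odot> f = h \<odot> (g \<odot> f)"
    and Cmp_Id1: "f \<in> Mor K \<Longrightarrow> Id1 K (Tgt K f) \<odot> f = f \<and> f \<odot> Id1 K (Src K f) = f"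
    and Hcmp_assoc: "hcomposable K \<gamma> \<beta> \<Longrightarrow> hcomposable K \<beta> \<alpha> \<Longrightarrow> \<gamma> \<star> \<beta> \<star> \<alpha> = \<gamma> \<star> (\<beta> \<star> \<alpha>)"
    and Hcmp_Id1: "\<alpha> \<in> Cel K \<Longrightarrow> Id2 K (Id1 K (Tgt K (Dom K \<alpha>))) \<star> \<alpha> = \<alpha> \<and>
      \<alpha> \<star> Id2 K (Id1 K (Src K (Dom K \<alpha>))) = \<alpha>"

locale bicategory = cell_structure B
  for B :: "('o, 'a, 'c) bicat" (structure) +
  assumes Asc_type: "composable B h g \<Longrightarrow> composable B g f \<Longrightarrow>
      in_cell B (Asc B h g f) (h \<odot> g \<odot> f) (h \<odot> (g \<odot> f))"
    and Asc_invertible: "composable B h g \<Longrightarrow> composable B g f \<Longrightarrow>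
      \<exists>\<beta>. inverse_cell B (Asc B h g f) \<beta>"
    and Asc_natural: "hcomposable B \<gamma> \<beta> \<Longrightarrow> hcomposable B \<beta> \<alpha> \<Longrightarrow>
      Asc B (Cod B \<gamma>) (Cod B \<beta>) (Cod B \<alpha>) \<cdot> (\<gamma> \<star> \<beta> \<star> \<alpha>) =
      (\<gamma> \<star> (\<beta> \<star> \<alpha>)) \<cdot> Asc B (Dom B \<gamma>) (Dom B \<beta>) (Dom B \<alpha>)"
    and Lun_type: "f \<in> Mor B \<Longrightarrow> in_cell B (Lun B f) (Id1 B (Tgt B f) \<odot> f) f"
    and Lun_invertible: "f \<in> Mor B \<Longrightarrow> \<exists>\<beta>. inverse_cell B (Lun B f) \<beta>"
    and Lun_natural: "\<alpha> \<in> Cel B \<Longrightarrow>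
      Lun B (Cod B \<alpha>) \<cdot> (Id2 B (Id1 B (Tgt B (Dom B \<alpha>))) \<star> \<alpha>) = \<alpha> \<cdot> Lun B (Dom B \<alpha>)"
    and Run_type: "f \<in> Mor B \<Longrightarrow> in_cell B (Run B f) (f \<odot> Id1 B (Src B f)) f"
    and Run_invertible: "f \<in> Mor B \<Longrightarrow> \<exists>\<beta>. inverse_cell B (Run B f) \<beta>"
    and Run_natural: "\<alpha> \<in> Cel B \<Longrightarrow>
      Run B (Cod B \<alpha>) \<cdot> (\<alpha> \<star> Id2 B (Id1 B (Src B (Dom B \<alpha>)))) = \<alpha> \<cdot> Run B (Dom B \<alpha>)"
    and pentagon: "composable B k h \<Longrightarrow> composable B h g \<Longrightarrow> composable B g f \<Longrightarrow>
      Asc B k h (g \<odot> f) \<cdot> Asc B (k \<odot> h) g f =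
      (Id2 B k \<star> Asc B h g f) \<cdot> Asc B k (h \<odot> g) f \<cdot> (Asc B k h g \<star> Id2 B f)"
    and triangle: "composable B g f \<Longrightarrow>
      (Id2 B g \<star> Lun B f) \<cdot> Asc B g (Id1 B (Src B g)) f = Run B g \<star> Id2 B f"
    and Asc_extensional: "\<not> (composable B h g \<and> composable B g f) \<Longrightarrow> Asc B h g f = undefined"
    and Lun_extensional: "Lun B \<in> extensional (Mor B)"
    and Run_extensional: "Run B \<in> extensional (Mor B)"

text \<open>Resets all operations to \<^const>\<open>undefined\<close> outside their domain.\<close>

definition tidy :: "('o, 'a, 'c) twocat \<Rightarrow> ('o, 'a, 'c) twocat"
  where "tidy K = \<lparr>
    Ob = Ob K, Mor = Mor K, Cel = Cel K,
    Src = restrict (Src K) (Mor K), Tgt = restrict (Tgt K) (Mor K),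
    Dom = restrict (Dom K) (Cel K), Cod = restrict (Cod K) (Cel K),
    Id1 = restrict (Id1 K) (Ob K), Id2 = restrict (Id2 K) (Mor K),
    Cmp = (\<lambda>g f. if composable K g f then g \<odot>\<^bsub>K\<^esub> f else undefined),
    Vcmp = (\<lambda>\<beta> \<alpha>. if vcomposable K \<beta> \<alpha> then \<beta> \<cdot>\<^bsub>K\<^esub> \<alpha> else undefined),
    Hcmp = (\<lambda>\<beta> \<alpha>. if hcomposable K \<beta> \<alpha> then \<beta> \<star>\<^bsub>K\<^esub> \<alpha> else undefined)\<rparr>"

text \<open>Transport of structure along maps injective on objects, 1-cells and 2-cells.\<close>

definition transport ::
  "('o \<Rightarrow> 'p) \<Rightarrow> ('a \<Rightarrow> 'b) \<Rightarrow> ('c \<Rightarrow> 'd) \<Rightarrow> ('o, 'a, 'c) twocat \<Rightarrow> ('p, 'b, 'd) twocat"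
  where "transport eo ea ec K =
    (let da = inv_into (Mor K) ea; dc = inv_into (Cel K) ec in
     tidy \<lparr>
       Ob = eo ` Ob K, Mor = ea ` Mor K, Cel = ec ` Cel K,
       Src = (\<lambda>f. eo (Src K (da f))), Tgt = (\<lambda>f. eo (Tgt K (da f))),
       Dom = (\<lambda>\<alpha>. ea (Dom K (dc \<alpha>))), Cod = (\<lambda>\<alpha>. ea (Cod K (dc \<alpha>))),
       Id1 = (\<lambda>a. ea (Id1 K (inv_into (Ob K) eo a))), Id2 = (\<lambda>f. ec (Id2 K (da f))),
       Cmp = (\<lambda>g f. ea (da g \<odot>\<^bsub>K\<^esub> da f)),
       Vcmp = (\<lambda>\<beta> \<alpha>. ec (dc \<beta> \<cdot>\<^bsub>K\<^esub> dc \<alpha>)),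
       Hcmp = (\<lambda>\<beta> \<alpha>. ec (dc \<beta> \<star>\<^bsub>K\<^esub> dc \<alpha>))\<rparr>)"


section \<open>2-functors, 2-natural transformations and 2-adjunctions\<close>

record ('o, 'a, 'c, 'p, 'b, 'd) twofun =
  F0 :: "'o \<Rightarrow> 'p"
  F1 :: "'a \<Rightarrow> 'b"
  F2 :: "'c \<Rightarrow> 'd"

locale two_functor =
  fixes K :: "('o, 'a, 'c) twocat"
    and L :: "('p, 'b, 'd) twocat"
    and F :: "('o, 'a, 'c, 'p, 'b, 'd) twofun"
  assumes F0_type: "F0 F \<in> Ob K \<rightarrow>\<^sub>E Ob L"
    and F1_extensional: "F1 F \<in> extensional (Mor K)"
    and F1_type: "f \<in> Mor K \<Longrightarrow> in_hom L (F1 F f) (F0 F (Src K f)) (F0 F (Tgt K f))"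
    and F2_extensional: "F2 F \<in> extensional (Cel K)"
    and F2_type: "\<alpha> \<in> Cel K \<Longrightarrow> in_cell L (F2 F \<alpha>) (F1 F (Dom K \<alpha>)) (F1 F (Cod K \<alpha>))"
    and F1_Id1: "a \<in> Ob K \<Longrightarrow> F1 F (Id1 K a) = Id1 L (F0 F a)"
    and F1_Cmp: "composable K g f \<Longrightarrow> F1 F (g \<odot>\<^bsub>K\<^esub> f) = F1 F g \<odot>\<^bsub>L\<^esub> F1 F f"
    and F2_Id2: "f \<in> Mor K \<Longrightarrow> F2 F (Id2 K f) = Id2 L (F1 F f)"
    and F2_Vcmp: "vcomposable K \<beta> \<alpha> \<Longrightarrow> F2 F (\<beta> \<cdot>\<^bsub>K\<^esub> \<alpha>) = F2 F \<beta> \<cdot>\<^bsub>L\<^esub> F2 F \<alpha>"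
    and F2_Hcmp: "hcomposable K \<beta> \<alpha> \<Longrightarrow> F2 F (\<beta> \<star>\<^bsub>K\<^esub> \<alpha>) = F2 F \<beta> \<star>\<^bsub>L\<^esub> F2 F \<alpha>"

definition id_twofun :: "('o, 'a, 'c) twocat \<Rightarrow> ('o, 'a, 'c, 'o, 'a, 'c) twofun"
  where "id_twofun K = \<lparr>F0 = restrict id (Ob K), F1 = restrict id (Mor K), F2 = restrict id (Cel K)\<rparr>"

definition comp_twofun ::
  "('o, 'a, 'c) twocat \<Rightarrow> ('p, 'b, 'd, 'q, 'e, 'f) twofun \<Rightarrow> ('o, 'a, 'c, 'p, 'b, 'd) twofun \<Rightarrow>
    ('o, 'a, 'c, 'q, 'e, 'f) twofun"
  where "comp_twofun K G F =
    \<lparr>F0 = compose (Ob K) (F0 G) (F0 F), F1 = compose (Mor K) (F1 G) (F1 F),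
     F2 = compose (Cel K) (F2 G) (F2 F)\<rparr>"

locale two_natural =
  fixes K :: "('o, 'a, 'c) twocat"
    and L :: "('p, 'b, 'd) twocat"
    and F G :: "('o, 'a, 'c, 'p, 'b, 'd) twofun"
    and \<theta> :: "'o \<Rightarrow> 'b"
  assumes component_extensional: "\<theta> \<in> extensional (Ob K)"
    and component_type: "a \<in> Ob K \<Longrightarrow> in_hom L (\<theta> a) (F0 F a) (F0 G a)"
    and natural1: "f \<in> Mor K \<Longrightarrow> \<theta> (Tgt K f) \<odot>\<^bsub>L\<^esub> F1 F f = F1 G f \<odot>\<^bsub>L\<^esub> \<theta> (Src K f)"
    and natural2: "\<alpha> \<in> Cel K \<Longrightarrow>
      Id2 L (\<theta> (Tgt K (Dom K \<alpha>))) \<star>\<^bsub>L\<^esub> F2 F \<alpha> = F2 G \<alpha> \<star>\<^bsub>L\<^esub> Id2 L (\<theta> (Src K (Dom K \<alpha>)))"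

text \<open>\<open>R : K \<rightarrow> L\<close> has a left 2-adjoint \<open>G : L \<rightarrow> K\<close>, with unit \<open>\<eta>\<close> and counit \<open>\<epsilon>\<close>.\<close>

definition has_left_two_adjoint ::
  "('o, 'a, 'c) twocat \<Rightarrow> ('p, 'b, 'd) twocat \<Rightarrow> ('o, 'a, 'c, 'p, 'b, 'd) twofun \<Rightarrow> bool"
  where "has_left_two_adjoint K L R \<longleftrightarrow> (\<exists>G \<eta> \<epsilon>.
    two_functor L K G \<and>
    two_natural L L (id_twofun L) (comp_twofun L R G) \<eta> \<and>
    two_natural K K (comp_twofun K G R) (id_twofun K) \<epsilon> \<and>
    (\<forall>x\<in>Ob L. \<epsilon> (F0 G x) \<odot>\<^bsub>K\<^esub> F1 G (\<eta> x) = Id1 K (F0 G x)) \<and>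
    (\<forall>k\<in>Ob K. F1 R (\<epsilon> k) \<odot>\<^bsub>L\<^esub> \<eta> (F0 R k) = Id1 L (F0 R k)))"


section \<open>Strict slices and parametric right 2-adjoints\<close>

text \<open>A piece of data \<open>via\<close> together with its source and target.\<close>

datatype ('x, 'm) arrow = Arrow (source: 'x) (via: 'm) (target: 'x)

type_synonym ('x, 'm, 'n) arrow2 = "(('x, 'm) arrow, 'n) arrow"

definition slice_Mor :: "('o, 'a, 'c) twocat \<Rightarrow> 'o \<Rightarrow> ('a, 'a) arrow set"
  where "slice_Mor L Z = {Arrow p h q | p h q.
    p \<in> Mor L \<and> q \<in> Mor L \<and> Tgt L p = Z \<and> Tgt L q = Z \<and>
    in_hom L h (Src L p) (Src L q) \<and> q \<odot>\<^bsub>L\<^esub> h = p}"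

definition slice ::
  "('o, 'a, 'c) twocat \<Rightarrow> 'o \<Rightarrow> ('a, ('a, 'a) arrow, ('a, 'a, 'c) arrow2) twocat"
  where "slice L Z = tidy \<lparr>
    Ob = {p \<in> Mor L. Tgt L p = Z},
    Mor = slice_Mor L Z,
    Cel = {Arrow u \<alpha> v | u \<alpha> v. u \<in> slice_Mor L Z \<and> v \<in> slice_Mor L Z \<and>
      source u = source v \<and> target u = target v \<and> in_cell L \<alpha> (via u) (via v) \<and>
      Id2 L (target u) \<star>\<^bsub>L\<^esub> \<alpha> = Id2 L (source u)},
    Src = source, Tgt = target, Dom = source, Cod = target,
    Id1 = (\<lambda>p. Arrow p (Id1 L (Src L p)) p),
    Id2 = (\<lambda>u. Arrow u (Id2 L (via u)) u),
    Cmp = (\<lambda>v u. Arrow (source u) (via v \<odot>\<^bsub>L\<^esub> via u) (target v)),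
    Vcmp = (\<lambda>\<beta> \<alpha>. Arrow (source \<alpha>) (via \<beta> \<cdot>\<^bsub>L\<^esub> via \<alpha>) (target \<beta>)),
    Hcmp = (\<lambda>\<beta> \<alpha>. Arrow
      (Arrow (source (source \<alpha>)) (via (source \<beta>) \<odot>\<^bsub>L\<^esub> via (source \<alpha>)) (target (source \<beta>)))
      (via \<beta> \<star>\<^bsub>L\<^esub> via \<alpha>)
      (Arrow (source (target \<alpha>)) (via (target \<beta>) \<odot>\<^bsub>L\<^esub> via (target \<alpha>)) (target (target \<beta>))))\<rparr>"

text \<open>\<open>!\<^sub>k : k \<rightarrow> t\<close> for a terminal object \<open>t\<close>, and the 2-functor \<open>R\<^sub>1 : K \<rightarrow> L/Rt\<close>.\<close>

definition bang :: "('o, 'a, 'c) twocat \<Rightarrow> 'o \<Rightarrow> 'o \<Rightarrow> 'a"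
  where "bang K t k = (THE f. in_hom K f k t)"

definition slice_lift ::
  "('o, 'a, 'c) twocat \<Rightarrow> 'o \<Rightarrow> ('o, 'a, 'c, 'p, 'b, 'd) twofun \<Rightarrow>
    ('o, 'a, 'c, 'b, ('b, 'b) arrow, ('b, 'b, 'd) arrow2) twofun"
  where "slice_lift K t R =
    (let r0 = (\<lambda>k. F1 R (bang K t k));
         r1 = (\<lambda>f. Arrow (r0 (Src K f)) (F1 R f) (r0 (Tgt K f)));
         r2 = (\<lambda>\<alpha>. Arrow (r1 (Dom K \<alpha>)) (F2 R \<alpha>) (r1 (Cod K \<alpha>)))
     in \<lparr>F0 = restrict r0 (Ob K), F1 = restrict r1 (Mor K), F2 = restrict r2 (Cel K)\<rparr>)"

definition parametric_right_two_adjoint ::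
  "('o, 'a, 'c) twocat \<Rightarrow> 'o \<Rightarrow> ('p, 'b, 'd) twocat \<Rightarrow> ('o, 'a, 'c, 'p, 'b, 'd) twofun \<Rightarrow> bool"
  where "parametric_right_two_adjoint K t L R \<longleftrightarrow>
    has_left_two_adjoint K (slice L (F0 R t)) (slice_lift K t R)"

text \<open>Postcomposition \<open>L/Src p \<rightarrow> L/Tgt p\<close> with a 1-cell \<open>p\<close>.\<close>

definition slice_push ::
  "('o, 'a, 'c) twocat \<Rightarrow> 'a \<Rightarrow>
    ('a, ('a, 'a) arrow, ('a, 'a, 'c) arrow2, 'a, ('a, 'a) arrow, ('a, 'a, 'c) arrow2) twofun"
  where "slice_push L p =
    (let S = slice L (Src L p);
         s0 = (\<lambda>q. p \<odot>\<^bsub>L\<^esub> q);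
         s1 = (\<lambda>u. Arrow (s0 (source u)) (via u) (s0 (target u)));
         s2 = (\<lambda>\<alpha>. Arrow (s1 (source \<alpha>)) (via \<alpha>) (s1 (target \<alpha>)))
     in \<lparr>F0 = restrict s0 (Ob S), F1 = restrict s1 (Mor S), F2 = restrict s2 (Cel S)\<rparr>)"


section \<open>The 2-category of large 2-categories\<close>

type_synonym 'v tcat = "('v, 'v, 'v) twocat"
type_synonym 'v tfun = "('v, 'v, 'v, 'v, 'v, 'v) twofun"
type_synonym 'v CAT2_mor = "('v tcat, 'v tfun) arrow"
type_synonym 'v CAT2_cel = "('v tcat, 'v tfun, 'v \<Rightarrow> 'v) arrow2"

definition CAT2_Mor :: "'v::universe_pair CAT2_mor set"
  where "CAT2_Mor = {Arrow K F L | K F L.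
    two_category K \<and> large (Ob K) \<and> large (Mor K) \<and> large (Cel K) \<and>
    two_category L \<and> large (Ob L) \<and> large (Mor L) \<and> large (Cel L) \<and>
    two_functor K L F}"

definition CAT2_Cmp :: "'v CAT2_mor \<Rightarrow> 'v CAT2_mor \<Rightarrow> 'v CAT2_mor"
  where "CAT2_Cmp G F = Arrow (source F) (comp_twofun (source F) (via G) (via F)) (target G)"

definition CAT2 :: "('v::universe_pair tcat, 'v CAT2_mor, 'v CAT2_cel) twocat"
  where "CAT2 = tidy \<lparr>
    Ob = {K. two_category K \<and> large (Ob K) \<and> large (Mor K) \<and> large (Cel K)},
    Mor = CAT2_Mor,
    Cel = {Arrow F \<theta> G | F \<theta> G. F \<in> CAT2_Mor \<and> G \<in> CAT2_Mor \<and>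
      source F = source G \<and> target F = target G \<and>
      two_natural (source F) (target F) (via F) (via G) \<theta>},
    Src = source, Tgt = target, Dom = source, Cod = target,
    Id1 = (\<lambda>K. Arrow K (id_twofun K) K),
    Id2 = (\<lambda>F. Arrow F (\<lambda>x\<in>Ob (source F). Id1 (target F) (F0 (via F) x)) F),
    Cmp = CAT2_Cmp,
    Vcmp = (\<lambda>\<kappa> \<theta>. let F = source \<theta>; L = target F in
      Arrow F (\<lambda>x\<in>Ob (source F). via \<kappa> x \<odot>\<^bsub>L\<^esub> via \<theta> x) (target \<kappa>)),
    Hcmp = (\<lambda>\<kappa> \<theta>. let F = source \<theta>; G = target \<theta>; H = source \<kappa>; M = target H in
      Arrow (CAT2_Cmp H F)
        (\<lambda>x\<in>Ob (source F). via \<kappa> (F0 (via G) x) \<odot>\<^bsub>M\<^esub> F1 (via H) (via \<theta> x))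
        (CAT2_Cmp (target \<kappa>) G))\<rparr>"


section \<open>The 2-category of large bicategories, lax functors and icons\<close>

type_synonym 'v bcy = "('v, 'v, 'v) bicat"

text \<open>\<open>FCmp F g f : Fg \<odot> Ff \<Rightarrow> F(g \<odot> f)\<close> and \<open>FId F a : 1\<^bsub>Fa\<^esub> \<Rightarrow> F 1\<^sub>a\<close>.\<close>

record ('o, 'a, 'c, 'p, 'b, 'd) laxfun = "('o, 'a, 'c, 'p, 'b, 'd) twofun" +
  FCmp :: "'a \<Rightarrow> 'a \<Rightarrow> 'd"
  FId :: "'o \<Rightarrow> 'd"

locale lax_functor =
  fixes B :: "('o, 'a, 'c) bicat"
    and D :: "('p, 'b, 'd) bicat"
    and F :: "('o, 'a, 'c, 'p, 'b, 'd) laxfun"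
  assumes F0_type: "F0 F \<in> Ob B \<rightarrow>\<^sub>E Ob D"
    and F1_extensional: "F1 F \<in> extensional (Mor B)"
    and F1_type: "f \<in> Mor B \<Longrightarrow> in_hom D (F1 F f) (F0 F (Src B f)) (F0 F (Tgt B f))"
    and F2_extensional: "F2 F \<in> extensional (Cel B)"
    and F2_type: "\<alpha> \<in> Cel B \<Longrightarrow> in_cell D (F2 F \<alpha>) (F1 F (Dom B \<alpha>)) (F1 F (Cod B \<alpha>))"
    and F2_Id2: "f \<in> Mor B \<Longrightarrow> F2 F (Id2 B f) = Id2 D (F1 F f)"
    and F2_Vcmp: "vcomposable B \<beta> \<alpha> \<Longrightarrow> F2 F (\<beta> \<cdot>\<^bsub>B\<^esub> \<alpha>) = F2 F \<beta> \<cdot>\<^bsub>D\<^esub> F2 F \<alpha>"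
    and FCmp_extensional: "\<not> composable B g f \<Longrightarrow> FCmp F g f = undefined"
    and FCmp_type: "composable B g f \<Longrightarrow>
      in_cell D (FCmp F g f) (F1 F g \<odot>\<^bsub>D\<^esub> F1 F f) (F1 F (g \<odot>\<^bsub>B\<^esub> f))"
    and FId_extensional: "FId F \<in> extensional (Ob B)"
    and FId_type: "a \<in> Ob B \<Longrightarrow> in_cell D (FId F a) (Id1 D (F0 F a)) (F1 F (Id1 B a))"
    and FCmp_natural: "hcomposable B \<beta> \<alpha> \<Longrightarrow>
      FCmp F (Cod B \<beta>) (Cod B \<alpha>) \<cdot>\<^bsub>D\<^esub> (F2 F \<beta> \<star>\<^bsub>D\<^esub> F2 F \<alpha>) =
      F2 F (\<beta> \<star>\<^bsub>B\<^esub> \<alpha>) \<cdot>\<^bsub>D\<^esub> FCmp F (Dom B \<beta>) (Dom B \<alpha>)"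
    and lax_assoc: "composable B h g \<Longrightarrow> composable B g f \<Longrightarrow>
      F2 F (Asc B h g f) \<cdot>\<^bsub>D\<^esub> (FCmp F (h \<odot>\<^bsub>B\<^esub> g) f \<cdot>\<^bsub>D\<^esub> (FCmp F h g \<star>\<^bsub>D\<^esub> Id2 D (F1 F f))) =
      FCmp F h (g \<odot>\<^bsub>B\<^esub> f) \<cdot>\<^bsub>D\<^esub> ((Id2 D (F1 F h) \<star>\<^bsub>D\<^esub> FCmp F g f) \<cdot>\<^bsub>D\<^esub>
        Asc D (F1 F h) (F1 F g) (F1 F f))"
    and lax_left_unit: "f \<in> Mor B \<Longrightarrow>
      F2 F (Lun B f) \<cdot>\<^bsub>D\<^esub> (FCmp F (Id1 B (Tgt B f)) f \<cdot>\<^bsub>D\<^esub> (FId F (Tgt B f) \<star>\<^bsub>D\<^esub> Id2 D (F1 F f))) =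
      Lun D (F1 F f)"
    and lax_right_unit: "f \<in> Mor B \<Longrightarrow>
      F2 F (Run B f) \<cdot>\<^bsub>D\<^esub> (FCmp F f (Id1 B (Src B f)) \<cdot>\<^bsub>D\<^esub> (Id2 D (F1 F f) \<star>\<^bsub>D\<^esub> FId F (Src B f))) =
      Run D (F1 F f)"

definition id_lax :: "('o, 'a, 'c) bicat \<Rightarrow> ('o, 'a, 'c, 'o, 'a, 'c) laxfun"
  where "id_lax B = \<lparr>
    F0 = restrict id (Ob B), F1 = restrict id (Mor B), F2 = restrict id (Cel B),
    FCmp = (\<lambda>g f. if composable B g f then Id2 B (g \<odot>\<^bsub>B\<^esub> f) else undefined),
    FId = (\<lambda>a\<in>Ob B. Id2 B (Id1 B a))\<rparr>"

definition comp_lax ::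
  "('o, 'a, 'c) bicat \<Rightarrow> ('q, 'e, 'f) bicat \<Rightarrow> ('p, 'b, 'd, 'q, 'e, 'f) laxfun \<Rightarrow>
    ('o, 'a, 'c, 'p, 'b, 'd) laxfun \<Rightarrow> ('o, 'a, 'c, 'q, 'e, 'f) laxfun"
  where "comp_lax B E G F = \<lparr>
    F0 = compose (Ob B) (F0 G) (F0 F), F1 = compose (Mor B) (F1 G) (F1 F),
    F2 = compose (Cel B) (F2 G) (F2 F),
    FCmp = (\<lambda>g f. if composable B g f
      then F2 G (FCmp F g f) \<cdot>\<^bsub>E\<^esub> FCmp G (F1 F g) (F1 F f) else undefined),
    FId = (\<lambda>a\<in>Ob B. F2 G (FId F a) \<cdot>\<^bsub>E\<^esub> FId G (F0 F a))\<rparr>"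

locale icon =
  fixes B :: "('o, 'a, 'c) bicat"
    and D :: "('p, 'b, 'd) bicat"
    and F G :: "('o, 'a, 'c, 'p, 'b, 'd) laxfun"
    and \<theta> :: "'a \<Rightarrow> 'd"
  assumes same_objects: "F0 F = F0 G"
    and component_extensional: "\<theta> \<in> extensional (Mor B)"
    and component_type: "f \<in> Mor B \<Longrightarrow> in_cell D (\<theta> f) (F1 F f) (F1 G f)"
    and natural: "\<alpha> \<in> Cel B \<Longrightarrow>
      \<theta> (Cod B \<alpha>) \<cdot>\<^bsub>D\<^esub> F2 F \<alpha> = F2 G \<alpha> \<cdot>\<^bsub>D\<^esub> \<theta> (Dom B \<alpha>)"
    and icon_Cmp: "composable B g f \<Longrightarrow>
      \<theta> (g \<odot>\<^bsub>B\<^esub> f) \<cdot>\<^bsub>D\<^esub> FCmp F g f = FCmp G g f \<cdot>\<^bsub>D\<^esub> (\<theta> g \<star>\<^bsub>D\<^esub> \<theta> f)"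
    and icon_Id: "a \<in> Ob B \<Longrightarrow> \<theta> (Id1 B a) \<cdot>\<^bsub>D\<^esub> FId F a = FId G a"

type_synonym 'v lfun = "('v, 'v, 'v, 'v, 'v, 'v) laxfun"
type_synonym 'v BICAT_mor = "('v bcy, 'v lfun) arrow"
type_synonym 'v BICAT_cel = "('v bcy, 'v lfun, 'v \<Rightarrow> 'v) arrow2"

definition BICAT_Mor :: "'v::universe_pair BICAT_mor set"
  where "BICAT_Mor = {Arrow B F D | B F D.
    bicategory B \<and> large (Ob B) \<and> large (Mor B) \<and> large (Cel B) \<and>
    bicategory D \<and> large (Ob D) \<and> large (Mor D) \<and> large (Cel D) \<and>
    lax_functor B D F}"

definition BICAT_Cmp :: "'v BICAT_mor \<Rightarrow> 'v BICAT_mor \<Rightarrow> 'v BICAT_mor"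
  where "BICAT_Cmp G F =
    Arrow (source F) (comp_lax (source F) (target G) (via G) (via F)) (target G)"

definition BICAT :: "('v::universe_pair bcy, 'v BICAT_mor, 'v BICAT_cel) twocat"
  where "BICAT = tidy \<lparr>
    Ob = {B. bicategory B \<and> large (Ob B) \<and> large (Mor B) \<and> large (Cel B)},
    Mor = BICAT_Mor,
    Cel = {Arrow F \<theta> G | F \<theta> G. F \<in> BICAT_Mor \<and> G \<in> BICAT_Mor \<and>
      source F = source G \<and> target F = target G \<and>
      icon (source F) (target F) (via F) (via G) \<theta>},
    Src = source, Tgt = target, Dom = source, Cod = target,
    Id1 = (\<lambda>B. Arrow B (id_lax B) B),
    Id2 = (\<lambda>F. Arrow F (\<lambda>f\<in>Mor (source F). Id2 (target F) (F1 (via F) f)) F),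
    Cmp = BICAT_Cmp,
    Vcmp = (\<lambda>\<kappa> \<theta>. let F = source \<theta>; D = target F in
      Arrow F (\<lambda>f\<in>Mor (source F). via \<kappa> f \<cdot>\<^bsub>D\<^esub> via \<theta> f) (target \<kappa>)),
    Hcmp = (\<lambda>\<kappa> \<theta>. let F = source \<theta>; G = target \<theta>; H = source \<kappa>; E = target H in
      Arrow (BICAT_Cmp H F)
        (\<lambda>f\<in>Mor (source F). via \<kappa> (F1 (via G) f) \<cdot>\<^bsub>E\<^esub> F2 (via H) (via \<theta> f))
        (BICAT_Cmp (target \<kappa>) G))\<rparr>"

text \<open>The terminal bicategory, with \<open>\<emptyset>\<close> as its only object, 1-cell and 2-cell.\<close>

definition one_bicat :: "'v::universe_pair bcy"
  where "one_bicat = (let p = vset {}; c1 = (\<lambda>x\<in>{p}. p);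
      c2 = (\<lambda>x y. if x = p \<and> y = p then p else undefined) in
    \<lparr>Ob = {p}, Mor = {p}, Cel = {p}, Src = c1, Tgt = c1, Dom = c1, Cod = c1,
     Id1 = c1, Id2 = c1, Cmp = c2, Vcmp = c2, Hcmp = c2,
     Asc = (\<lambda>x y z. if x = p \<and> y = p \<and> z = p then p else undefined), Lun = c1, Run = c1\<rparr>)"


section \<open>Enriched categories\<close>

text \<open>\<open>mul C c\<^sub>0 c\<^sub>1 c\<^sub>2 : hom C c\<^sub>1 c\<^sub>2 \<odot> hom C c\<^sub>0 c\<^sub>1 \<Rightarrow> hom C c\<^sub>0 c\<^sub>2\<close>.\<close>

record 'v enrcat =
  ob :: "'v set"
  ext :: "'v \<Rightarrow> 'v"
  hom :: "'v \<Rightarrow> 'v \<Rightarrow> 'v"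
  unt :: "'v \<Rightarrow> 'v"
  mul :: "'v \<Rightarrow> 'v \<Rightarrow> 'v \<Rightarrow> 'v"

record 'v enrfun =
  fob :: "'v \<Rightarrow> 'v"
  fhom :: "'v \<Rightarrow> 'v \<Rightarrow> 'v"

type_synonym 'v enr_mor = "('v enrcat, 'v enrfun) arrow"
type_synonym 'v enr_cel = "('v enrcat, 'v enrfun, 'v \<Rightarrow> 'v) arrow2"

locale enriched_category =
  fixes B :: "'v::universe_pair bcy" (structure)
    and C :: "'v enrcat"
  assumes small_ob: "small (ob C)"
    and ext_type: "ext C \<in> ob C \<rightarrow>\<^sub>E Ob B"
    and hom_type: "c \<in> ob C \<Longrightarrow> c' \<in> ob C \<Longrightarrow> in_hom B (hom C c c') (ext C c) (ext C c')"
    and unt_type: "c \<in> ob C \<Longrightarrow> in_cell B (unt C c) (Id1 B (ext C c)) (hom C c c)"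
    and mul_type: "c0 \<in> ob C \<Longrightarrow> c1 \<in> ob C \<Longrightarrow> c2 \<in> ob C \<Longrightarrow>
      in_cell B (mul C c0 c1 c2) (hom C c1 c2 \<odot> hom C c0 c1) (hom C c0 c2)"
    and left_unit: "c \<in> ob C \<Longrightarrow> c' \<in> ob C \<Longrightarrow>
      mul C c c' c' \<cdot> (unt C c' \<star> Id2 B (hom C c c')) = Lun B (hom C c c')"
    and right_unit: "c \<in> ob C \<Longrightarrow> c' \<in> ob C \<Longrightarrow>
      mul C c c c' \<cdot> (Id2 B (hom C c c') \<star> unt C c) = Run B (hom C c c')"
    and assoc: "c0 \<in> ob C \<Longrightarrow> c1 \<in> ob C \<Longrightarrow> c2 \<in> ob C \<Longrightarrow> c3 \<in> ob C \<Longrightarrow>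
      mul C c0 c1 c3 \<cdot> (mul C c1 c2 c3 \<star> Id2 B (hom C c0 c1)) =
      mul C c0 c2 c3 \<cdot> ((Id2 B (hom C c2 c3) \<star> mul C c0 c1 c2) \<cdot>
        Asc B (hom C c2 c3) (hom C c1 c2) (hom C c0 c1))"
    and hom_extensional: "\<not> (c \<in> ob C \<and> c' \<in> ob C) \<Longrightarrow> hom C c c' = undefined"
    and unt_extensional: "unt C \<in> extensional (ob C)"
    and mul_extensional: "\<not> (c0 \<in> ob C \<and> c1 \<in> ob C \<and> c2 \<in> ob C) \<Longrightarrow>
      mul C c0 c1 c2 = undefined"

locale enriched_functor =
  fixes B :: "'v::universe_pair bcy" (structure)
    and C D :: "'v enrcat"
    and f :: "'v enrfun"
  assumes fob_type: "fob f \<in> ob C \<rightarrow>\<^sub>E ob D"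
    and fob_ext: "c \<in> ob C \<Longrightarrow> ext D (fob f c) = ext C c"
    and fhom_type: "c \<in> ob C \<Longrightarrow> c' \<in> ob C \<Longrightarrow>
      in_cell B (fhom f c c') (hom C c c') (hom D (fob f c) (fob f c'))"
    and fhom_unt: "c \<in> ob C \<Longrightarrow> fhom f c c \<cdot> unt C c = unt D (fob f c)"
    and fhom_mul: "c0 \<in> ob C \<Longrightarrow> c1 \<in> ob C \<Longrightarrow> c2 \<in> ob C \<Longrightarrow>
      fhom f c0 c2 \<cdot> mul C c0 c1 c2 =
      mul D (fob f c0) (fob f c1) (fob f c2) \<cdot> (fhom f c1 c2 \<star> fhom f c0 c1)"
    and fhom_extensional: "\<not> (c \<in> ob C \<and> c' \<in> ob C) \<Longrightarrow> fhom f c c' = undefined"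

locale enriched_natural =
  fixes B :: "'v::universe_pair bcy" (structure)
    and C D :: "'v enrcat"
    and f f' :: "'v enrfun"
    and \<alpha> :: "'v \<Rightarrow> 'v"
  assumes component_extensional: "\<alpha> \<in> extensional (ob C)"
    and component_type: "c \<in> ob C \<Longrightarrow>
      in_cell B (\<alpha> c) (Id1 B (ext C c)) (hom D (fob f c) (fob f' c))"
    and natural: "c \<in> ob C \<Longrightarrow> c' \<in> ob C \<Longrightarrow>
      mul D (fob f c) (fob f' c) (fob f' c') \<cdot> (fhom f' c c' \<star> \<alpha> c) \<cdot>
        inv_cell B (Run B (hom C c c')) =
      mul D (fob f c) (fob f c') (fob f' c') \<cdot> (\<alpha> c' \<star> fhom f c c') \<cdot>
        inv_cell B (Lun B (hom C c c'))"

definition Enrcat_Mor :: "'v::universe_pair bcy \<Rightarrow> 'v enr_mor set"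
  where "Enrcat_Mor B = {Arrow C f D | C f D.
    enriched_category B C \<and> enriched_category B D \<and> enriched_functor B C D f}"

definition Enrcat_Cmp :: "'v bcy \<Rightarrow> 'v enr_mor \<Rightarrow> 'v enr_mor \<Rightarrow> 'v enr_mor"
  where "Enrcat_Cmp B g f = (let C = source f in
    Arrow C
      \<lparr>fob = compose (ob C) (fob (via g)) (fob (via f)),
       fhom = (\<lambda>c c'. if c \<in> ob C \<and> c' \<in> ob C
         then fhom (via g) (fob (via f) c) (fob (via f) c') \<cdot>\<^bsub>B\<^esub> fhom (via f) c c'
         else undefined)\<rparr>
      (target g))"

text \<open>
  \<open>\<B>\<close>-\<open>Cat\<close>, before encoding in the universe. For \<open>\<alpha> : f \<Rightarrow> f'\<close>, \<open>\<beta> : f' \<Rightarrow> f''\<close> the vertical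
  composite at \<open>c\<close> is \<open>\<mu> \<cdot> (\<beta>\<^sub>c \<star> \<alpha>\<^sub>c)\<close>, and for \<open>\<alpha> : f \<Rightarrow> f'\<close>, \<open>\<beta> : g \<Rightarrow> g'\<close> the horizontal
  composite at \<open>c\<close> is \<open>\<mu> \<cdot> (\<beta>\<^bsub>f'c\<^esub> \<star> \<omega>\<^sup>g \<alpha>\<^sub>c)\<close>, both preceded by \<open>1 \<cong> 1 \<odot> 1\<close>.
\<close>

definition Enrcat :: "'v::universe_pair bcy \<Rightarrow> ('v enrcat, 'v enr_mor, 'v enr_cel) twocat"
  where "Enrcat B = tidy \<lparr>
    Ob = {C. enriched_category B C},
    Mor = Enrcat_Mor B,
    Cel = {Arrow f \<alpha> f' | f \<alpha> f'. f \<in> Enrcat_Mor B \<and> f' \<in> Enrcat_Mor B \<and>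
      source f = source f' \<and> target f = target f' \<and>
      enriched_natural B (source f) (target f) (via f) (via f') \<alpha>},
    Src = source, Tgt = target, Dom = source, Cod = target,
    Id1 = (\<lambda>C. Arrow C
      \<lparr>fob = restrict id (ob C),
       fhom = (\<lambda>c c'. if c \<in> ob C \<and> c' \<in> ob C then Id2 B (hom C c c') else undefined)\<rparr> C),
    Id2 = (\<lambda>f. Arrow f (\<lambda>c\<in>ob (source f). unt (target f) (fob (via f) c)) f),
    Cmp = Enrcat_Cmp B,
    Vcmp = (\<lambda>\<beta> \<alpha>.
      let C = source (source \<alpha>); D = target (source \<alpha>);
          f = via (source \<alpha>); f' = via (target \<alpha>); f'' = via (target \<beta>)
      in Arrow (source \<alpha>)
        (\<lambda>c\<in>ob C. mul D (fob f c) (fob f' c) (fob f'' c) \<cdot>\<^bsub>B\<^esub> (via \<beta> c \<star>\<^bsub>B\<^esub> via \<alpha> c) \<cdot>\<^bsub>B\<^esub>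
          inv_cell B (Lun B (Id1 B (ext C c))))
        (target \<beta>)),
    Hcmp = (\<lambda>\<beta> \<alpha>.
      let C = source (source \<alpha>); E = target (source \<beta>);
          f = via (source \<alpha>); f' = via (target \<alpha>);
          g = via (source \<beta>); g' = via (target \<beta>)
      in Arrow (Enrcat_Cmp B (source \<beta>) (source \<alpha>))
        (\<lambda>c\<in>ob C. mul E (fob g (fob f c)) (fob g (fob f' c)) (fob g' (fob f' c)) \<cdot>\<^bsub>B\<^esub>
          (via \<beta> (fob f' c) \<star>\<^bsub>B\<^esub> (fhom g (fob f c) (fob f' c) \<cdot>\<^bsub>B\<^esub> via \<alpha> c)) \<cdot>\<^bsub>B\<^esub>
          inv_cell B (Lun B (Id1 B (ext C c))))
        (Enrcat_Cmp B (target \<beta>) (target \<alpha>)))\<rparr>"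


section \<open>Encoding in the universe, and the 2-functor Enr\<close>

definition code_cat :: "'v::universe_pair enrcat \<Rightarrow> 'v"
  where "code_cat C = vpair (vset (ob C)) (vpair (graph (ob C) (ext C))
    (vpair (graph2 (ob C) (hom C)) (vpair (graph (ob C) (unt C)) (graph3 (ob C) (mul C)))))"

definition code_fun :: "'v::universe_pair enr_mor \<Rightarrow> 'v"
  where "code_fun f = vpair (code_cat (source f))
    (vpair (vpair (graph (ob (source f)) (fob (via f))) (graph2 (ob (source f)) (fhom (via f))))
      (code_cat (target f)))"

definition code_nat :: "'v::universe_pair enr_cel \<Rightarrow> 'v"
  where "code_nat \<alpha> = vpair (code_fun (source \<alpha>))
    (vpair (graph (ob (source (source \<alpha>))) (via \<alpha>)) (code_fun (target \<alpha>)))"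

definition decode_cat :: "'v::universe_pair bcy \<Rightarrow> 'v \<Rightarrow> 'v enrcat"
  where "decode_cat B = inv_into (Ob (Enrcat B)) code_cat"

definition decode_fun :: "'v::universe_pair bcy \<Rightarrow> 'v \<Rightarrow> 'v enr_mor"
  where "decode_fun B = inv_into (Mor (Enrcat B)) code_fun"

definition decode_nat :: "'v::universe_pair bcy \<Rightarrow> 'v \<Rightarrow> 'v enr_cel"
  where "decode_nat B = inv_into (Cel (Enrcat B)) code_nat"

definition Enr_ob :: "'v::universe_pair bcy \<Rightarrow> 'v tcat"
  where "Enr_ob B = transport code_cat code_fun code_nat (Enrcat B)"

definition push_cat :: "'v bcy \<Rightarrow> 'v lfun \<Rightarrow> 'v enrcat \<Rightarrow> 'v enrcat"
  where "push_cat D F C = \<lparr>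
    ob = ob C,
    ext = compose (ob C) (F0 F) (ext C),
    hom = (\<lambda>c c'. if c \<in> ob C \<and> c' \<in> ob C then F1 F (hom C c c') else undefined),
    unt = (\<lambda>c\<in>ob C. F2 F (unt C c) \<cdot>\<^bsub>D\<^esub> FId F (ext C c)),
    mul = (\<lambda>c0 c1 c2. if c0 \<in> ob C \<and> c1 \<in> ob C \<and> c2 \<in> ob C
      then F2 F (mul C c0 c1 c2) \<cdot>\<^bsub>D\<^esub> FCmp F (hom C c1 c2) (hom C c0 c1) else undefined)\<rparr>"

definition push_fun :: "'v bcy \<Rightarrow> 'v lfun \<Rightarrow> 'v enr_mor \<Rightarrow> 'v enr_mor"
  where "push_fun D F f = (let C = source f in
    Arrow (push_cat D F C)
      \<lparr>fob = fob (via f),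
       fhom = (\<lambda>c c'. if c \<in> ob C \<and> c' \<in> ob C then F2 F (fhom (via f) c c') else undefined)\<rparr>
      (push_cat D F (target f)))"

definition push_nat :: "'v bcy \<Rightarrow> 'v lfun \<Rightarrow> 'v enr_cel \<Rightarrow> 'v enr_cel"
  where "push_nat D F \<alpha> = (let C = source (source \<alpha>) in
    Arrow (push_fun D F (source \<alpha>))
      (\<lambda>c\<in>ob C. F2 F (via \<alpha> c) \<cdot>\<^bsub>D\<^esub> FId F (ext C c))
      (push_fun D F (target \<alpha>)))"

definition Enr_mor :: "'v::universe_pair BICAT_mor \<Rightarrow> 'v CAT2_mor"
  where "Enr_mor F = (let B = source F; D = target F in
    Arrow (Enr_ob B)
      \<lparr>F0 = (\<lambda>x\<in>Ob (Enr_ob B). code_cat (push_cat D (via F) (decode_cat B x))),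
       F1 = (\<lambda>x\<in>Mor (Enr_ob B). code_fun (push_fun D (via F) (decode_fun B x))),
       F2 = (\<lambda>x\<in>Cel (Enr_ob B). code_nat (push_nat D (via F) (decode_nat B x)))\<rparr>
      (Enr_ob D))"

text \<open>The component of \<open>Enr \<theta>\<close> at \<open>C\<close>: the identity on objects, and \<open>\<theta>\<close> on homs.\<close>

definition icon_fun :: "'v::universe_pair BICAT_cel \<Rightarrow> 'v enrcat \<Rightarrow> 'v enr_mor"
  where "icon_fun \<theta> C = (let D = target (source \<theta>) in
    Arrow (push_cat D (via (source \<theta>)) C)
      \<lparr>fob = restrict id (ob C),
       fhom = (\<lambda>c c'. if c \<in> ob C \<and> c' \<in> ob C then via \<theta> (hom C c c') else undefined)\<rparr>
      (push_cat D (via (target \<theta>)) C))"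

definition Enr_cel :: "'v::universe_pair BICAT_cel \<Rightarrow> 'v CAT2_cel"
  where "Enr_cel \<theta> = (let B = source (source \<theta>) in
    Arrow (Enr_mor (source \<theta>))
      (\<lambda>x\<in>Ob (Enr_ob B). code_fun (icon_fun \<theta> (decode_cat B x)))
      (Enr_mor (target \<theta>)))"

definition Enr ::
  "('v::universe_pair bcy, 'v BICAT_mor, 'v BICAT_cel, 'v tcat, 'v CAT2_mor, 'v CAT2_cel) twofun"
  where "Enr = \<lparr>F0 = restrict Enr_ob (Ob BICAT), F1 = restrict Enr_mor (Mor BICAT),
    F2 = restrict Enr_cel (Cel BICAT)\<rparr>"


section \<open>The locally chaotic 2-category of small sets\<close>

type_synonym 'v set_mor = "('v, 'v \<Rightarrow> 'v) arrow"
type_synonym 'v set_cel = "('v, 'v \<Rightarrow> 'v, unit) arrow2"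

definition Set_Mor :: "'v::universe_pair set_mor set"
  where "Set_Mor = {Arrow X f Y | X f Y.
    X \<in> elts small_universe \<and> Y \<in> elts small_universe \<and> f \<in> elts X \<rightarrow>\<^sub>E elts Y}"

definition Set_Cmp :: "'v::universe_pair set_mor \<Rightarrow> 'v set_mor \<Rightarrow> 'v set_mor"
  where "Set_Cmp g f = Arrow (source f) (compose (elts (source f)) (via g) (via f)) (target g)"

definition code_map :: "'v::universe_pair set_mor \<Rightarrow> 'v"
  where "code_map f =
    vpair (source f) (vpair (graph (elts (source f)) (via f)) (target f))"

definition code_parallel :: "'v::universe_pair set_cel \<Rightarrow> 'v"
  where "code_parallel \<alpha> = vpair (code_map (source \<alpha>)) (code_map (target \<alpha>))"

definition Set_lc :: "'v::universe_pair tcat"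
  where "Set_lc = transport id code_map code_parallel (tidy \<lparr>
    Ob = elts small_universe,
    Mor = Set_Mor,
    Cel = {Arrow f () g | f g. f \<in> Set_Mor \<and> g \<in> Set_Mor \<and>
      source f = source g \<and> target f = target g},
    Src = source, Tgt = target, Dom = source, Cod = target,
    Id1 = (\<lambda>X. Arrow X (restrict id (elts X)) X),
    Id2 = (\<lambda>f. Arrow f () f),
    Cmp = Set_Cmp,
    Vcmp = (\<lambda>\<beta> \<alpha>. Arrow (source \<alpha>) () (target \<beta>)),
    Hcmp = (\<lambda>\<beta> \<alpha>. Arrow (Set_Cmp (source \<beta>) (source \<alpha>)) () (Set_Cmp (target \<beta>) (target \<alpha>)))\<rparr>)"

text \<open>
  The identification \<open>Enr(1) = Set\<^bsub>lc\<^esub>\<close>: a category enriched over the terminal bicategory is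
  sent to its set of objects.
\<close>

definition underlying_map :: "'v::universe_pair enr_mor \<Rightarrow> 'v set_mor"
  where "underlying_map f =
    Arrow (vset (ob (source f))) (fob (via f)) (vset (ob (target f)))"

definition Enr_one_to_Set :: "'v::universe_pair CAT2_mor"
  where "Enr_one_to_Set = Arrow (Enr_ob one_bicat)
    \<lparr>F0 = (\<lambda>x\<in>Ob (Enr_ob one_bicat). vset (ob (decode_cat one_bicat x))),
     F1 = (\<lambda>x\<in>Mor (Enr_ob one_bicat). code_map (underlying_map (decode_fun one_bicat x))),
     F2 = (\<lambda>x\<in>Cel (Enr_ob one_bicat). let \<alpha> = decode_nat one_bicat x in
       code_parallel (Arrow (underlying_map (source \<alpha>)) () (underlying_map (target \<alpha>))))\<rparr>
    Set_lc"

text \<open>\<open>Enr\<^sub>1 : \<B> \<mapsto> (Enr(!\<^sub>\<B>) : \<B>-Cat \<rightarrow> Set\<^bsub>lc\<^esub>)\<close>.\<close>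

definition Enr_over_Set ::
  "('v::universe_pair bcy, 'v BICAT_mor, 'v BICAT_cel, 'v CAT2_mor,
    ('v CAT2_mor, 'v CAT2_mor) arrow, ('v CAT2_mor, 'v CAT2_mor, 'v CAT2_cel) arrow2) twofun"
  where "Enr_over_Set =
    comp_twofun BICAT (slice_push CAT2 Enr_one_to_Set) (slice_lift BICAT one_bicat Enr)"

end

theory Submission
  imports Defs "HOL-Library.Countable"
begin

text \<open>
  Let \<open>R\<close> be the 2-functor in question, and suppose that it has a left 2-adjoint \<open>G\<close> with unit \<open>\<eta>\<close> and
  counit \<open>\<epsilon>\<close>. The contradiction comes from a bicategory in which a 1-cell can be a composite of
  homs of enriched categories although it is not itself such a hom, so that \<open>R\<close> does not see it.

  Let \<open>W\<close> be the bicategory with one object whose 1-cells are the words in two letters, composed by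
  concatenation. The letters act on the natural numbers, one by rounding up to an even and the
  other by rounding up to an odd number, and there is exactly one 2-cell \<open>u \<rightarrow> v\<close> if
  \<open>u n \<le> v n\<close> for all \<open>n\<close>, and none otherwise. Rounding is idempotent, so either letter is a monad, that is, a
  \<open>W\<close>-category with one object. The composite of the two monads is an expanding word: it moves
  every number. Words above an expanding word are expanding, and an expanding word \<open>u\<close> is never a
  hom of a \<open>W\<close>-category (lemma \<open>hom_not_expanding\<close>): if \<open>w\<close> is the hom in the opposite
  direction, then composition gives \<open>u w u \<le> u\<close>. Hence two lax functors on \<open>W\<close> that
  differ only at expanding words have the same image under \<open>R\<close> (lemma \<open>Enr_mor_eqI\<close>). Such lax
  functors exist: into the bicategory of words with exactly one 2-cell between any two words, every
  map of words is a lax functor.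

  By naturality of \<open>\<epsilon>\<close>, two lax functors on \<open>W\<close> with the same image under \<open>R\<close> agree after composition with
  \<open>\<epsilon> : G R W \<rightarrow> W\<close>, so no 1-cell of \<open>G R W\<close> is sent to an expanding word. But by the triangle
  identity \<open>\<eta>\<close> provides a section of \<open>Enr(\<epsilon>)\<close>, and this yields 1-cells \<open>a\<close>, \<open>b\<close> of \<open>G R W\<close> lying over
  the two letters. Both monads receive a map from the trivial one; the section preserves these maps,
  and enriched functors preserve extents, so \<open>a\<close> and \<open>b\<close> are endomorphisms of the
  same object. The lax comparison \<open>\<epsilon> a \<cdot> \<epsilon> b \<rightarrow> \<epsilon> (a \<cdot> b)\<close> makes \<open>\<epsilon> (a \<cdot> b)\<close> expanding
  (lemma \<open>section_expanding\<close>), a contradiction.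

  For the argument \<open>R W\<close> must be an object of the slice, which means that enrichment over \<open>W\<close> and over
  the terminal bicategory yields large 2-categories and 2-functors between them. These
  2-categories have at most one 2-cell between two parallel 1-cells, and therefore only the
  boundaries of 2-cells have to be checked. About the bicategory \<open>G R W\<close> nothing is known, and whether
  enrichment over it is well behaved is left open; instead the object of \<open>W\<close> is kept as a
  parameter, and the triangle identity is shown to be meaningful for all but at most one of its values
  (lemma \<open>no_left_adjoint\<close>).
\<close>

section \<open>Sets in the universe\<close>

lemma elts_vset:
  assumes "large S" shows "elts (vset S) = S"
proof -
  obtain x where x: "elts x = S" using assms by (auto simp: large_def)
  show ?thesis unfolding vset_def
    by (rule theI[where P = "\<lambda>x. elts x = S", OF x]) (rule elts_inject, simp add: x)
qed

lemma large_elts [simp]: "large (elts x)"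
  by (simp add: large_def)

lemma vset_elts [simp]: "vset (elts x) = x"
  by (rule elts_inject) (rule elts_vset, simp)

lemma large_mono: "large T \<Longrightarrow> S \<subseteq> T \<Longrightarrow> large S"
  unfolding large_def using large_subset by blast

lemma large_doubleton: "large {x, y}"
  unfolding large_def by (rule large_pair)

lemma large_singleton: "large {x}"
  using large_doubleton[of x x] by simp

lemma large_image:
  fixes f :: "'v::universe_pair \<Rightarrow> 'v"
  assumes "large S" shows "large (f ` S)"
proof -
  obtain x where S: "S = elts x" using assms by (auto simp: large_def)
  have "(\<Union>i\<in>elts x. elts (vset {f i})) = f ` S"
    by (auto simp: S elts_vset[OF large_singleton])
  then show ?thesis using large_UN[where x = x and u = "\<lambda>i. vset {f i}"] by (simp add: large_def)
qed

lemma vset_eq_iff: "large S \<Longrightarrow> large T \<Longrightarrow> vset S = vset T \<longleftrightarrow> S = T"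
  by (metis elts_vset)

lemma vpair_eq_iff [simp]: "vpair x y = vpair x' y' \<longleftrightarrow> x = x' \<and> y = y'"
proof
  assume "vpair x y = vpair x' y'"
  then have "{vset {x}, vset {x, y}} = {vset {x'}, vset {x', y'}}"
    by (simp add: vpair_def vset_eq_iff large_doubleton)
  then have "vset {x} = vset {x'} \<and> vset {x, y} = vset {x', y'} \<or>
      vset {x} = vset {x', y'} \<and> vset {x, y} = vset {x'}"
    by (simp only: doubleton_eq_iff)
  then show "x = x' \<and> y = y'"
    by (auto simp: vset_eq_iff large_doubleton large_singleton doubleton_eq_iff)
qed simp

text \<open>
  The codes of enriched categories are tuples of graphs; iterating products and power sets, which
  preserve largeness, gives large sets that contain all of them.
\<close>

definition Times :: "'v::universe_pair set \<Rightarrow> 'v set \<Rightarrow> 'v set"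
  where "Times A B = {vpair x y | x y. x \<in> A \<and> y \<in> B}"

definition Powerset :: "'v::universe_pair set \<Rightarrow> 'v set"
  where "Powerset A = {s. elts s \<subseteq> A}"

lemma vpair_in_Times [simp]: "vpair x y \<in> Times A B \<longleftrightarrow> x \<in> A \<and> y \<in> B"
  by (auto simp: Times_def)

lemma large_Union:
  fixes F :: "'v::universe_pair \<Rightarrow> 'v set"
  assumes "large S" "\<And>i. i \<in> S \<Longrightarrow> large (F i)" shows "large (\<Union>i\<in>S. F i)"
proof -
  obtain x where S: "S = elts x" using assms by (auto simp: large_def)
  have "(\<Union>i\<in>elts x. elts (vset (F i))) = (\<Union>i\<in>S. F i)"
    using assms by (auto simp: S elts_vset)
  then show ?thesis using large_UN[where x = x and u = "\<lambda>i. vset (F i)"] by (simp add: large_def)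
qed

lemma large_Times: 
  assumes "large A" "large B" shows "large (Times A B)"
proof -
  have "Times A B = (\<Union>x\<in>A. vpair x ` B)" by (auto simp: Times_def)
  then show ?thesis using assms by (simp add: large_Union large_image)
qed

lemma large_Powerset:
  assumes "large A" shows "large (Powerset A)"
proof -
  obtain x where "A = elts x" using assms by (auto simp: large_def)
  then show ?thesis using large_power[of x] by (simp add: Powerset_def large_def)
qed

lemma vset_in_Powerset: "S \<subseteq> A \<Longrightarrow> large A \<Longrightarrow> vset S \<in> Powerset A"
  by (simp add: Powerset_def elts_vset large_mono)

lemma graph_in_Powerset:
  "A \<subseteq> U \<Longrightarrow> large U \<Longrightarrow> large V \<Longrightarrow> (\<And>x. x \<in> A \<Longrightarrow> f x \<in> V) \<Longrightarrow>
    graph A f \<in> Powerset (Times U V)"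
  unfolding graph_def by (rule vset_in_Powerset) (auto simp: large_Times)

lemma graph2_in_Powerset:
  "A \<subseteq> U \<Longrightarrow> large U \<Longrightarrow> large V \<Longrightarrow> (\<And>x y. x \<in> A \<Longrightarrow> y \<in> A \<Longrightarrow> f x y \<in> V) \<Longrightarrow>
    graph2 A f \<in> Powerset (Times (Times U U) V)"
  unfolding graph2_def by (rule vset_in_Powerset) (auto simp: large_Times)

lemma graph3_in_Powerset:
  "A \<subseteq> U \<Longrightarrow> large U \<Longrightarrow> large V \<Longrightarrow>
    (\<And>x y z. x \<in> A \<Longrightarrow> y \<in> A \<Longrightarrow> z \<in> A \<Longrightarrow> f x y z \<in> V) \<Longrightarrow>
    graph3 A f \<in> Powerset (Times (Times U (Times U U)) V)"
  unfolding graph3_def by (rule vset_in_Powerset) (auto simp: large_Times)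

lemma elts_graph: "large A \<Longrightarrow> elts (graph A f) = {vpair x (f x) | x. x \<in> A}"
  unfolding graph_def
  by (rule elts_vset) (auto simp: setcompr_eq_image intro: large_image)

lemma elts_graph2:
  assumes "large A"
  shows "elts (graph2 A f) = {vpair (vpair x y) (f x y) | x y. x \<in> A \<and> y \<in> A}"
  unfolding graph2_def
proof (rule elts_vset)
  have "{vpair (vpair x y) (f x y) | x y. x \<in> A \<and> y \<in> A} =
      (\<Union>x\<in>A. (\<lambda>y. vpair (vpair x y) (f x y)) ` A)" by auto
  then show "large {vpair (vpair x y) (f x y) | x y. x \<in> A \<and> y \<in> A}"
    using assms by (simp add: large_Union large_image)
qed

lemma elts_graph3:
  assumes "large A"
  shows "elts (graph3 A f) =
    {vpair (vpair x (vpair y z)) (f x y z) | x y z. x \<in> A \<and> y \<in> A \<and> z \<in> A}"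
  unfolding graph3_def
proof (rule elts_vset)
  have "{vpair (vpair x (vpair y z)) (f x y z) | x y z. x \<in> A \<and> y \<in> A \<and> z \<in> A} =
      (\<Union>x\<in>A. \<Union>y\<in>A. (\<lambda>z. vpair (vpair x (vpair y z)) (f x y z)) ` A)" by auto
  then show "large {vpair (vpair x (vpair y z)) (f x y z) | x y z. x \<in> A \<and> y \<in> A \<and> z \<in> A}"
    using assms by (simp add: large_Union large_image)
qed

lemma graph_eqD:
  assumes "graph A f = graph A g" "large A" "x \<in> A" shows "f x = g x"
proof -
  have "{vpair x (f x) | x. x \<in> A} = {vpair x (g x) | x. x \<in> A}"
    using assms(1) elts_graph[OF assms(2)] by metis
  with assms(3) have "vpair x (f x) \<in> {vpair x (g x) | x. x \<in> A}" by blast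
  then show ?thesis by auto
qed

lemma graph2_eqD:
  assumes "graph2 A f = graph2 A g" "large A" "x \<in> A" "y \<in> A" shows "f x y = g x y"
proof -
  have "vpair (vpair x y) (f x y) \<in> elts (graph2 A g)"
    unfolding assms(1)[symmetric] elts_graph2[OF assms(2)] using assms by blast
  then show ?thesis by (auto simp: elts_graph2[OF assms(2)])
qed

lemma graph3_eqD:
  assumes "graph3 A f = graph3 A g" "large A" "x \<in> A" "y \<in> A" "z \<in> A" shows "f x y z = g x y z"
proof -
  have "vpair (vpair x (vpair y z)) (f x y z) \<in> elts (graph3 A g)"
    unfolding assms(1)[symmetric] elts_graph3[OF assms(2)] using assms by blast
  then show ?thesis by (auto simp: elts_graph3[OF assms(2)])
qed

abbreviation U1 :: "'v::universe_pair set"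
  where "U1 \<equiv> elts small_universe"

lemma small_subset_U1: "small S \<Longrightarrow> S \<subseteq> U1"
  unfolding small_def using small_transitive by blast

lemma small_large: "small S \<Longrightarrow> large S"
  unfolding small_def large_def by blast

lemma vset_small: "small S \<Longrightarrow> vset S \<in> U1"
  unfolding small_def by auto

lemma small_singleton: "x \<in> U1 \<Longrightarrow> small {x}"
  unfolding small_def using small_pair[of x x] by simp

text \<open>
  Membership is wellfounded, while every member \<open>x\<close> of the smaller universe belongs to the
  member \<open>{x}\<close>; on a finite set the converse of membership would be wellfounded too.
\<close>

lemma infinite_U1: "infinite (U1 :: 'v::universe_pair set)"
proof
  assume fin: "finite (U1 :: 'v set)"
  define R where "R = {(x, y). x \<in> elts y} \<inter> ((U1 :: 'v set) \<times> U1)"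
  have "acyclic R"
    by (rule acyclic_subset[OF wf_acyclic[OF elts_wf]]) (auto simp: R_def)
  moreover have "finite R" using fin by (simp add: R_def)
  ultimately have "wf (R\<inverse>)" using finite_acyclic_wf_converse by blast
  moreover obtain z where "z \<in> (U1 :: 'v set)" using small_nonempty by blast
  ultimately obtain m where m: "m \<in> (U1 :: 'v set)" "\<And>y. (y, m) \<in> R\<inverse> \<Longrightarrow> y \<notin> U1"
    by (erule_tac wfE_min) blast+
  have "vset {m} \<in> U1" using vset_small[OF small_singleton[OF m(1)]] .
  moreover have "m \<in> elts (vset {m})" by (simp add: elts_vset[OF large_singleton])
  ultimately have "(vset {m}, m) \<in> R\<inverse>" "vset {m} \<in> U1" using m(1) by (simp_all add: R_def)
  then show False using m(2) by blast
qed

text \<open>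
  Concrete bicategories are built on countable types, so that largeness of their carriers reduces
  to the existence of an injection into the smaller universe.
\<close>

definition enc :: "'a::countable \<Rightarrow> 'v::universe_pair"
  where "enc = (SOME e. inj e \<and> range e \<subseteq> U1)"

lemma enc_spec: "inj (enc :: 'a::countable \<Rightarrow> 'v::universe_pair) \<and> range (enc :: 'a \<Rightarrow> 'v) \<subseteq> U1"
proof -
  obtain f :: "nat \<Rightarrow> 'v" where f: "inj f" "range f \<subseteq> U1"
    using infinite_countable_subset[OF infinite_U1] by blast
  have "inj (f \<circ> (to_nat :: 'a \<Rightarrow> nat)) \<and> range (f \<circ> (to_nat :: 'a \<Rightarrow> nat)) \<subseteq> U1"
    using f inj_compose[OF f(1) inj_to_nat] by auto
  then show ?thesis 
    unfolding enc_def by (rule someI[where P = "\<lambda>e. inj e \<and> range e \<subseteq> U1"])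
qed

lemma enc_eq_iff [simp]: "enc x = enc y \<longleftrightarrow> x = y"
  using enc_spec by (meson injD)

lemma enc_in_U1 [simp]: "enc x \<in> U1"
  using enc_spec by blast

definition dec :: "'v::universe_pair \<Rightarrow> 'a::countable"
  where "dec = inv enc"

lemma dec_enc [simp]: "dec (enc x) = x"
  unfolding dec_def by (rule inv_f_f[OF conjunct1[OF enc_spec]])


section \<open>Locally thin 2-categories\<close>

definition locally_thin :: "('o, 'a, 'c, 'z) twocat_scheme \<Rightarrow> bool"
  where "locally_thin K \<longleftrightarrow> (\<forall>\<alpha>\<in>Cel K. \<forall>\<beta>\<in>Cel K.
    Dom K \<alpha> = Dom K \<beta> \<longrightarrow> Cod K \<alpha> = Cod K \<beta> \<longrightarrow> \<alpha> = \<beta>)"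

lemma thin_eqI: "locally_thin K \<Longrightarrow> in_cell K \<alpha> f g \<Longrightarrow> in_cell K \<beta> f g \<Longrightarrow> \<alpha> = \<beta>"
  unfolding locally_thin_def in_cell_def by simp

lemma in_homD:
  assumes "in_hom K f a b" shows "f \<in> Mor K" "Src K f = a" "Tgt K f = b"
  using assms by (auto simp: in_hom_def)

lemma in_cellD:
  assumes "in_cell K \<alpha> f g" shows "\<alpha> \<in> Cel K" "Dom K \<alpha> = f" "Cod K \<alpha> = g"
  using assms by (auto simp: in_cell_def)

context cell_structure
begin

lemma in_cell_Vcmp: "in_cell K \<beta> g h \<Longrightarrow> in_cell K \<alpha> f g \<Longrightarrow> in_cell K (\<beta> \<cdot> \<alpha>) f h"
  using Vcmp_type[of \<beta> \<alpha>] by (simp add: in_cell_def vcomposable_def)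

lemma in_cell_Hcmp:
  "in_cell K \<beta> g g' \<Longrightarrow> in_cell K \<alpha> f f' \<Longrightarrow> Src K g = Tgt K f \<Longrightarrow>
    in_cell K (\<beta> \<star> \<alpha>) (g \<odot> f) (g' \<odot> f')"
  using Hcmp_type[of \<beta> \<alpha>] by (simp add: in_cell_def hcomposable_def)

lemma in_hom_Cmp: "in_hom K g b c \<Longrightarrow> in_hom K f a b \<Longrightarrow> in_hom K (g \<odot> f) a c"
  using Cmp_type[of g f] by (simp add: in_hom_def composable_def)

end

text \<open>
  Equations between 2-cells hold automatically in a locally thin structure, since the two sides
  have the same boundary.
\<close>

lemma thin_cell_structure:
  fixes K :: "('o, 'a, 'c, 'z) twocat_scheme" (structure)
  assumes thin: "locally_thin K"
    and src_tgt: "\<And>f. f \<in> Mor K \<Longrightarrow> Src K f \<in> Ob K \<and> Tgt K f \<in> Ob K"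
    and dom_cod: "\<And>\<alpha>. \<alpha> \<in> Cel K \<Longrightarrow> Dom K \<alpha> \<in> Mor K \<and> Cod K \<alpha> \<in> Mor K \<and>
      Src K (Dom K \<alpha>) = Src K (Cod K \<alpha>) \<and> Tgt K (Dom K \<alpha>) = Tgt K (Cod K \<alpha>)"
    and Id1_type: "\<And>a. a \<in> Ob K \<Longrightarrow> in_hom K (Id1 K a) a a"
    and Id2_type: "\<And>f. f \<in> Mor K \<Longrightarrow> in_cell K (Id2 K f) f f"
    and Cmp_type: "\<And>g f. composable K g f \<Longrightarrow> in_hom K (g \<odot> f) (Src K f) (Tgt K g)"
    and Vcmp_type: "\<And>\<beta> \<alpha>. vcomposable K \<beta> \<alpha> \<Longrightarrow> in_cell K (\<beta> \<cdot> \<alpha>) (Dom K \<alpha>) (Cod K \<beta>)"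
    and Hcmp_type: "\<And>\<beta> \<alpha>. hcomposable K \<beta> \<alpha> \<Longrightarrow>
      in_cell K (\<beta> \<star> \<alpha>) (Dom K \<beta> \<odot> Dom K \<alpha>) (Cod K \<beta> \<odot> Cod K \<alpha>)"
    and ext: "Src K \<in> extensional (Mor K)" "Tgt K \<in> extensional (Mor K)"
      "Dom K \<in> extensional (Cel K)" "Cod K \<in> extensional (Cel K)"
      "Id1 K \<in> extensional (Ob K)" "Id2 K \<in> extensional (Mor K)"
      "\<And>g f. \<not> composable K g f \<Longrightarrow> g \<odot> f = undefined"
      "\<And>\<beta> \<alpha>. \<not> vcomposable K \<beta> \<alpha> \<Longrightarrow> \<beta> \<cdot> \<alpha> = undefined"
      "\<And>\<beta> \<alpha>. \<not> hcomposable K \<beta> \<alpha> \<Longrightarrow> \<beta> \<star> \<alpha> = undefined"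
  shows "cell_structure K"
proof -
  have V: "in_cell K (\<beta> \<cdot> \<alpha>) f h" if "in_cell K \<beta> g h" "in_cell K \<alpha> f g" for \<alpha> \<beta> f g h
    using Vcmp_type[of \<beta> \<alpha>] that by (simp add: in_cell_def vcomposable_def)
  have H: "in_cell K (\<beta> \<star> \<alpha>) (g \<odot> f) (g' \<odot> f')"
    if "in_cell K \<beta> g g'" "in_cell K \<alpha> f f'" "Src K g = Tgt K f" for \<alpha> \<beta> f g f' g'
    using Hcmp_type[of \<beta> \<alpha>] that by (simp add: in_cell_def hcomposable_def)
  have C: "in_cell K \<alpha> (Dom K \<alpha>) (Cod K \<alpha>)" if "\<alpha> \<in> Cel K" for \<alpha>
    using that by (simp add: in_cell_def)
  note eq = thin_eqI[OF thin]
  show ?thesis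
  proof (unfold_locales, goal_cases)
    case (8 \<gamma> \<beta> \<alpha>)
    then have "in_cell K \<gamma> (Cod K \<beta>) (Cod K \<gamma>)" "in_cell K \<beta> (Cod K \<alpha>) (Cod K \<beta>)"
        "in_cell K \<alpha> (Dom K \<alpha>) (Cod K \<alpha>)" by (auto simp: vcomposable_def in_cell_def)
    then show ?case by (intro eq[of _ "Dom K \<alpha>" "Cod K \<gamma>"] V)
  next
    case (9 \<alpha>)
    then show ?case using eq[OF V[OF Id2_type C] C, of \<alpha>] eq[OF V[OF C Id2_type] C, of \<alpha>] dom_cod
      by blast
  next
    case (10 g f)
    then have "g \<odot> f \<in> Mor K" using Cmp_type[of g f] by (simp add: in_hom_def)
    then show ?case using 10
      by (intro eq[of _ "g \<odot> f" "g \<odot> f"] H Id2_type) (auto simp: composable_def)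
  next
    case (11 \<beta>' \<beta> \<alpha>' \<alpha>)
    then have t: "in_cell K \<beta>' (Cod K \<beta>) (Cod K \<beta>')" "in_cell K \<beta> (Dom K \<beta>) (Cod K \<beta>)"
      "in_cell K \<alpha>' (Cod K \<alpha>) (Cod K \<alpha>')" "in_cell K \<alpha> (Dom K \<alpha>) (Cod K \<alpha>)"
      by (auto simp: vcomposable_def in_cell_def)
    moreover have s: "Src K (Dom K \<beta>) = Tgt K (Dom K \<alpha>)" "Src K (Cod K \<beta>) = Tgt K (Cod K \<alpha>)"
      using 11(3) dom_cod[of \<alpha>] dom_cod[of \<beta>] by (auto simp: hcomposable_def)
    ultimately show ?case
      by (intro eq[OF H[OF V[OF t(1,2)] V[OF t(3,4)]] V[OF H[OF t(1,3)] H[OF t(2,4)]]])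
  qed (use assms in auto)
qed

lemma tidy_sel [simp]:
  "Ob (tidy K) = Ob K" "Mor (tidy K) = Mor K" "Cel (tidy K) = Cel K"
  "f \<in> Mor K \<Longrightarrow> Src (tidy K) f = Src K f" "f \<in> Mor K \<Longrightarrow> Tgt (tidy K) f = Tgt K f"
  "\<alpha> \<in> Cel K \<Longrightarrow> Dom (tidy K) \<alpha> = Dom K \<alpha>" "\<alpha> \<in> Cel K \<Longrightarrow> Cod (tidy K) \<alpha> = Cod K \<alpha>"
  "a \<in> Ob K \<Longrightarrow> Id1 (tidy K) a = Id1 K a" "f \<in> Mor K \<Longrightarrow> Id2 (tidy K) f = Id2 K f"
  "composable K g f \<Longrightarrow> g \<odot>\<^bsub>tidy K\<^esub> f = g \<odot>\<^bsub>K\<^esub> f"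
  "vcomposable K \<beta> \<alpha> \<Longrightarrow> \<beta> \<cdot>\<^bsub>tidy K\<^esub> \<alpha> = \<beta> \<cdot>\<^bsub>K\<^esub> \<alpha>"
  "hcomposable K \<beta> \<alpha> \<Longrightarrow> \<beta> \<star>\<^bsub>tidy K\<^esub> \<alpha> = \<beta> \<star>\<^bsub>K\<^esub> \<alpha>"
  by (simp_all add: tidy_def)

lemma tidy_ext:
  "Src (tidy K) \<in> extensional (Mor K)" "Tgt (tidy K) \<in> extensional (Mor K)"
  "Dom (tidy K) \<in> extensional (Cel K)" "Cod (tidy K) \<in> extensional (Cel K)"
  "Id1 (tidy K) \<in> extensional (Ob K)" "Id2 (tidy K) \<in> extensional (Mor K)"
  "\<not> composable K g f \<Longrightarrow> g \<odot>\<^bsub>tidy K\<^esub> f = undefined"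
  "\<not> vcomposable K \<beta> \<alpha> \<Longrightarrow> \<beta> \<cdot>\<^bsub>tidy K\<^esub> \<alpha> = undefined"
  "\<not> hcomposable K \<beta> \<alpha> \<Longrightarrow> \<beta> \<star>\<^bsub>tidy K\<^esub> \<alpha> = undefined"
  by (simp_all add: tidy_def)

lemma tidy_rel [simp]:
  "in_hom (tidy K) f a b \<longleftrightarrow> in_hom K f a b"
  "in_cell (tidy K) \<alpha> f g \<longleftrightarrow> in_cell K \<alpha> f g"
  "composable (tidy K) g f \<longleftrightarrow> composable K g f"
  "vcomposable (tidy K) \<beta> \<alpha> \<longleftrightarrow> vcomposable K \<beta> \<alpha>"
  "locally_thin (tidy K) \<longleftrightarrow> locally_thin K"
  by (auto simp: in_hom_def in_cell_def composable_def vcomposable_def locally_thin_def)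

lemma tidy_hcomposable:
  "(\<And>\<alpha>. \<alpha> \<in> Cel K \<Longrightarrow> Dom K \<alpha> \<in> Mor K) \<Longrightarrow>
    hcomposable (tidy K) \<beta> \<alpha> \<longleftrightarrow> hcomposable K \<beta> \<alpha>"
  by (auto simp: hcomposable_def)

text \<open>
  In the horizontal composites, \<^const>\<open>tidy\<close> also evaluates the source and target of the domain of a
  2-cell, which is why that domain has to be a 1-cell.
\<close>

lemma tidy_tidy:
  assumes "\<And>\<alpha>. \<alpha> \<in> Cel K \<Longrightarrow> Dom K \<alpha> \<in> Mor K"
  shows "tidy (tidy K) = tidy K"
proof (rule twocat.equality)
  show "Hcmp (tidy (tidy K)) = Hcmp (tidy K)"
    using assms by (auto simp: tidy_def hcomposable_def fun_eq_iff)
qed (auto simp: tidy_def composable_def vcomposable_def fun_eq_iff)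

lemma thin_two_category:
  fixes K :: "('o, 'a, 'c) twocat" (structure)
  assumes thin: "locally_thin K"
    and src_tgt: "\<And>f. f \<in> Mor K \<Longrightarrow> Src K f \<in> Ob K \<and> Tgt K f \<in> Ob K"
    and dom_cod: "\<And>\<alpha>. \<alpha> \<in> Cel K \<Longrightarrow> Dom K \<alpha> \<in> Mor K \<and> Cod K \<alpha> \<in> Mor K \<and>
      Src K (Dom K \<alpha>) = Src K (Cod K \<alpha>) \<and> Tgt K (Dom K \<alpha>) = Tgt K (Cod K \<alpha>)"
    and Id1_type: "\<And>a. a \<in> Ob K \<Longrightarrow> in_hom K (Id1 K a) a a"
    and Id2_type: "\<And>f. f \<in> Mor K \<Longrightarrow> in_cell K (Id2 K f) f f"
    and Cmp_type: "\<And>g f. composable K g f \<Longrightarrow> in_hom K (g \<odot> f) (Src K f) (Tgt K g)"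
    and Vcmp_type: "\<And>\<beta> \<alpha>. vcomposable K \<beta> \<alpha> \<Longrightarrow> in_cell K (\<beta> \<cdot> \<alpha>) (Dom K \<alpha>) (Cod K \<beta>)"
    and Hcmp_type: "\<And>\<beta> \<alpha>. hcomposable K \<beta> \<alpha> \<Longrightarrow>
      in_cell K (\<beta> \<star> \<alpha>) (Dom K \<beta> \<odot> Dom K \<alpha>) (Cod K \<beta> \<odot> Cod K \<alpha>)"
    and Cmp_assoc: "\<And>h g f. composable K h g \<Longrightarrow> composable K g f \<Longrightarrow> h \<odot> g \<odot> f = h \<odot> (g \<odot> f)"
    and Cmp_Id1: "\<And>f. f \<in> Mor K \<Longrightarrow> Id1 K (Tgt K f) \<odot> f = f \<and> f \<odot> Id1 K (Src K f) = f"
  shows "two_category (tidy K)"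
proof -
  have hc: "hcomposable (tidy K) \<beta> \<alpha> \<longleftrightarrow> hcomposable K \<beta> \<alpha>" for \<beta> \<alpha>
    using dom_cod by (intro tidy_hcomposable) blast
  have cD: "composable K (Dom K \<beta>) (Dom K \<alpha>)" "composable K (Cod K \<beta>) (Cod K \<alpha>)"
    if "hcomposable K \<beta> \<alpha>" for \<beta> \<alpha>
    using that dom_cod[of \<beta>] dom_cod[of \<alpha>] by (auto simp: hcomposable_def composable_def)
  interpret T: cell_structure "tidy K"
  proof (rule thin_cell_structure, goal_cases)
    case (8 \<beta> \<alpha>)
    then have h: "hcomposable K \<beta> \<alpha>" by (simp add: hc)
    then have "\<alpha> \<in> Cel K" "\<beta> \<in> Cel K" by (simp_all add: hcomposable_def)
    then show ?case using Hcmp_type[OF h] cD[OF h] h by simp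
  next
    case (3 \<alpha>) then show ?case using dom_cod[of \<alpha>] by simp
  next
    case (6 g f)
    then have c: "composable K g f" by simp
    then have "f \<in> Mor K" "g \<in> Mor K" by (simp_all add: composable_def)
    then show ?case using Cmp_type[OF c] c by simp
  next
    case (7 \<beta> \<alpha>)
    then have c: "vcomposable K \<beta> \<alpha>" by simp
    then have "\<alpha> \<in> Cel K" "\<beta> \<in> Cel K" by (simp_all add: vcomposable_def)
    then show ?case using Vcmp_type[OF c] c by simp
  qed (use assms hc in \<open>auto simp: tidy_ext\<close>)
  have thin': "locally_thin (tidy K)" using thin by simp
  note eq = thin_eqI[OF thin']
  have C: "in_cell (tidy K) \<alpha> (Dom (tidy K) \<alpha>) (Cod (tidy K) \<alpha>)" if "\<alpha> \<in> Cel K" for \<alpha>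
    using that by (simp add: in_cell_def)
  have assoc: "h \<odot>\<^bsub>tidy K\<^esub> g \<odot>\<^bsub>tidy K\<^esub> f = h \<odot>\<^bsub>tidy K\<^esub> (g \<odot>\<^bsub>tidy K\<^esub> f)"
    if "composable K h g" "composable K g f" for h g f
  proof -
    have "composable K (h \<odot> g) f" "composable K h (g \<odot> f)"
      using that Cmp_type[OF that(1)] Cmp_type[OF that(2)] by (auto simp: composable_def in_hom_def)
    then show ?thesis using that Cmp_assoc by simp
  qed
  have unit: "Id1 (tidy K) (Tgt (tidy K) f) \<odot>\<^bsub>tidy K\<^esub> f = f"
    "f \<odot>\<^bsub>tidy K\<^esub> Id1 (tidy K) (Src (tidy K) f) = f" if "f \<in> Mor K" for f
  proof -
    have "composable K (Id1 K (Tgt K f)) f" "composable K f (Id1 K (Src K f))"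
      using that src_tgt[OF that] Id1_type by (auto simp: composable_def in_hom_def)
    then show "Id1 (tidy K) (Tgt (tidy K) f) \<odot>\<^bsub>tidy K\<^esub> f = f"
      "f \<odot>\<^bsub>tidy K\<^esub> Id1 (tidy K) (Src (tidy K) f) = f"
      using that src_tgt[OF that] Cmp_Id1[OF that] by simp_all
  qed
  show ?thesis
  proof (unfold_locales, goal_cases)
    case (1 h g f) then show ?case by (intro assoc) simp_all
  next
    case (2 f) then show ?case using unit by simp
  next
    case (3 \<gamma> \<beta> \<alpha>)
    then have hK: "hcomposable K \<gamma> \<beta>" "hcomposable K \<beta> \<alpha>" by (simp_all add: hc)
    let ?D = "Dom (tidy K)" and ?C = "Cod (tidy K)"
    have s: "Src (tidy K) (?D \<gamma>) = Tgt (tidy K) (?D \<beta>)" "Src (tidy K) (?D \<beta>) = Tgt (tidy K) (?D \<alpha>)"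
      and mem: "\<gamma> \<in> Cel K" "\<beta> \<in> Cel K" "\<alpha> \<in> Cel K"
      using 3 by (auto simp: hcomposable_def)
    have t1: "in_cell (tidy K) (\<gamma> \<star>\<^bsub>tidy K\<^esub> \<beta> \<star>\<^bsub>tidy K\<^esub> \<alpha>)
        (?D \<gamma> \<odot>\<^bsub>tidy K\<^esub> ?D \<beta> \<odot>\<^bsub>tidy K\<^esub> ?D \<alpha>) (?C \<gamma> \<odot>\<^bsub>tidy K\<^esub> ?C \<beta> \<odot>\<^bsub>tidy K\<^esub> ?C \<alpha>)"
      using s T.Cmp_type[of "?D \<gamma>" "?D \<beta>"] cD(1)[OF hK(1)] mem
      by (intro T.in_cell_Hcmp C) (auto simp: in_hom_def)
    have t2: "in_cell (tidy K) (\<gamma> \<star>\<^bsub>tidy K\<^esub> (\<beta> \<star>\<^bsub>tidy K\<^esub> \<alpha>))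
        (?D \<gamma> \<odot>\<^bsub>tidy K\<^esub> (?D \<beta> \<odot>\<^bsub>tidy K\<^esub> ?D \<alpha>)) (?C \<gamma> \<odot>\<^bsub>tidy K\<^esub> (?C \<beta> \<odot>\<^bsub>tidy K\<^esub> ?C \<alpha>))"
      using s T.Cmp_type[of "?D \<beta>" "?D \<alpha>"] cD(1)[OF hK(2)] mem
      by (intro T.in_cell_Hcmp C) (auto simp: in_hom_def)
    show ?case
      using t2 mem assoc[OF cD(1)[OF hK(1)] cD(1)[OF hK(2)]] assoc[OF cD(2)[OF hK(1)] cD(2)[OF hK(2)]]
      by (intro eq[OF t1]) simp
  next
    case (4 \<alpha>)
    then have \<alpha>: "\<alpha> \<in> Cel K" by simp
    let ?T = "tidy K" and ?f = "Dom (tidy K) \<alpha>" and ?g = "Cod (tidy K) \<alpha>"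
    have f: "?f \<in> Mor ?T" "?g \<in> Mor ?T" "Src ?T ?f = Src ?T ?g" "Tgt ?T ?f = Tgt ?T ?g"
      using T.dom_cod[OF 4] by blast+
    have i: "in_hom ?T (Id1 ?T (Tgt ?T ?f)) (Tgt ?T ?f) (Tgt ?T ?f)"
      "in_hom ?T (Id1 ?T (Src ?T ?f)) (Src ?T ?f) (Src ?T ?f)"
      using T.src_tgt[OF f(1)] T.Id1_type by blast+
    have u: "Id1 ?T (Tgt ?T ?f) \<odot>\<^bsub>?T\<^esub> ?f = ?f" "Id1 ?T (Tgt ?T ?f) \<odot>\<^bsub>?T\<^esub> ?g = ?g"
      "?f \<odot>\<^bsub>?T\<^esub> Id1 ?T (Src ?T ?f) = ?f" "?g \<odot>\<^bsub>?T\<^esub> Id1 ?T (Src ?T ?f) = ?g"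
      using unit[of ?f] unit[of ?g] f by simp_all
    have "in_cell ?T (Id2 ?T (Id1 ?T (Tgt ?T ?f)) \<star>\<^bsub>?T\<^esub> \<alpha>) ?f ?g"
      using T.in_cell_Hcmp[OF T.Id2_type C[OF \<alpha>]] in_homD[OF i(1)] u by metis
    moreover have "in_cell ?T (\<alpha> \<star>\<^bsub>?T\<^esub> Id2 ?T (Id1 ?T (Src ?T ?f))) ?f ?g"
      using T.in_cell_Hcmp[OF C[OF \<alpha>] T.Id2_type] in_homD[OF i(2)] u by metis
    ultimately show ?case using eq[OF _ C[OF \<alpha>]] by blast
  qed
qed


section \<open>Transport along injections\<close>

lemma transport_carriers [simp]:
  "Ob (transport eo ea ec K) = eo ` Ob K" "Mor (transport eo ea ec K) = ea ` Mor K"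
  "Cel (transport eo ea ec K) = ec ` Cel K"
  by (simp_all add: transport_def Let_def)

locale transported = two_category K
  for K :: "('o, 'a, 'c) twocat" (structure) +
  fixes eo :: "'o \<Rightarrow> 'p" and ea :: "'a \<Rightarrow> 'b" and ec :: "'c \<Rightarrow> 'd"
  assumes inj_eo: "inj_on eo (Ob K)" and inj_ea: "inj_on ea (Mor K)" and inj_ec: "inj_on ec (Cel K)"
begin

abbreviation T :: "('p, 'b, 'd) twocat"
  where "T \<equiv> transport eo ea ec K"

lemma eo_eq [simp]: "a \<in> Ob K \<Longrightarrow> b \<in> Ob K \<Longrightarrow> eo a = eo b \<longleftrightarrow> a = b"
  using inj_eo by (rule inj_on_eq_iff)

lemma ea_eq [simp]: "f \<in> Mor K \<Longrightarrow> g \<in> Mor K \<Longrightarrow> ea f = ea g \<longleftrightarrow> f = g"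
  using inj_ea by (rule inj_on_eq_iff)

lemma ec_eq [simp]: "\<alpha> \<in> Cel K \<Longrightarrow> \<beta> \<in> Cel K \<Longrightarrow> ec \<alpha> = ec \<beta> \<longleftrightarrow> \<alpha> = \<beta>"
  using inj_ec by (rule inj_on_eq_iff)

lemma dec_simps [simp]:
  "a \<in> Ob K \<Longrightarrow> inv_into (Ob K) eo (eo a) = a"
  "f \<in> Mor K \<Longrightarrow> inv_into (Mor K) ea (ea f) = f"
  "\<alpha> \<in> Cel K \<Longrightarrow> inv_into (Cel K) ec (ec \<alpha>) = \<alpha>"
  using inj_eo inj_ea inj_ec by simp_all

lemma mem [simp]:
  "f \<in> Mor K \<Longrightarrow> Src K f \<in> Ob K" "f \<in> Mor K \<Longrightarrow> Tgt K f \<in> Ob K"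
  "\<alpha> \<in> Cel K \<Longrightarrow> Dom K \<alpha> \<in> Mor K" "\<alpha> \<in> Cel K \<Longrightarrow> Cod K \<alpha> \<in> Mor K"
  "a \<in> Ob K \<Longrightarrow> Id1 K a \<in> Mor K" "f \<in> Mor K \<Longrightarrow> Id2 K f \<in> Cel K"
  "composable K g f \<Longrightarrow> g \<odot> f \<in> Mor K" "vcomposable K \<beta> \<alpha> \<Longrightarrow> \<beta> \<cdot> \<alpha> \<in> Cel K"
  "hcomposable K \<beta> \<alpha> \<Longrightarrow> \<beta> \<star> \<alpha> \<in> Cel K"
  using src_tgt dom_cod in_homD(1)[OF Id1_type] in_cellD(1)[OF Id2_type] in_homD(1)[OF Cmp_type]
    in_cellD(1)[OF Vcmp_type] in_cellD(1)[OF Hcmp_type] by blast+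

lemma boundaries [simp]:
  "f \<in> Mor K \<Longrightarrow> Src T (ea f) = eo (Src K f)" "f \<in> Mor K \<Longrightarrow> Tgt T (ea f) = eo (Tgt K f)"
  "\<alpha> \<in> Cel K \<Longrightarrow> Dom T (ec \<alpha>) = ea (Dom K \<alpha>)" "\<alpha> \<in> Cel K \<Longrightarrow> Cod T (ec \<alpha>) = ea (Cod K \<alpha>)"
  by (simp_all add: transport_def Let_def)

lemma identities [simp]:
  "a \<in> Ob K \<Longrightarrow> Id1 T (eo a) = ea (Id1 K a)" "f \<in> Mor K \<Longrightarrow> Id2 T (ea f) = ec (Id2 K f)"
  by (simp_all add: transport_def Let_def)

lemma composability [simp]:
  "f \<in> Mor K \<Longrightarrow> g \<in> Mor K \<Longrightarrow> composable T (ea g) (ea f) \<longleftrightarrow> composable K g f"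
  "\<alpha> \<in> Cel K \<Longrightarrow> \<beta> \<in> Cel K \<Longrightarrow> vcomposable T (ec \<beta>) (ec \<alpha>) \<longleftrightarrow> vcomposable K \<beta> \<alpha>"
  "\<alpha> \<in> Cel K \<Longrightarrow> \<beta> \<in> Cel K \<Longrightarrow> hcomposable T (ec \<beta>) (ec \<alpha>) \<longleftrightarrow> hcomposable K \<beta> \<alpha>"
  by (simp_all add: composable_def vcomposable_def hcomposable_def)

lemma in_hom_transport [simp]:
  "f \<in> Mor K \<Longrightarrow> a \<in> Ob K \<Longrightarrow> b \<in> Ob K \<Longrightarrow> in_hom T (ea f) (eo a) (eo b) \<longleftrightarrow> in_hom K f a b"
  by (simp add: in_hom_def)

lemma in_cell_transport [simp]:
  "\<alpha> \<in> Cel K \<Longrightarrow> f \<in> Mor K \<Longrightarrow> g \<in> Mor K \<Longrightarrow>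
    in_cell T (ec \<alpha>) (ea f) (ea g) \<longleftrightarrow> in_cell K \<alpha> f g"
  by (simp add: in_cell_def)

lemma composites [simp]:
  "composable K g f \<Longrightarrow> ea g \<odot>\<^bsub>T\<^esub> ea f = ea (g \<odot> f)"
  "vcomposable K \<beta> \<alpha> \<Longrightarrow> ec \<beta> \<cdot>\<^bsub>T\<^esub> ec \<alpha> = ec (\<beta> \<cdot> \<alpha>)"
  "hcomposable K \<beta> \<alpha> \<Longrightarrow> ec \<beta> \<star>\<^bsub>T\<^esub> ec \<alpha> = ec (\<beta> \<star> \<alpha>)"
proof -
  show "ea g \<odot>\<^bsub>T\<^esub> ea f = ea (g \<odot> f)" if "composable K g f"
    using that by (simp add: transport_def Let_def tidy_def composable_def)
  show "ec \<beta> \<cdot>\<^bsub>T\<^esub> ec \<alpha> = ec (\<beta> \<cdot> \<alpha>)" if "vcomposable K \<beta> \<alpha>"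
    using that by (simp add: transport_def Let_def tidy_def vcomposable_def)
  show "ec \<beta> \<star>\<^bsub>T\<^esub> ec \<alpha> = ec (\<beta> \<star> \<alpha>)" if "hcomposable K \<beta> \<alpha>"
    using that by (simp add: transport_def Let_def tidy_def hcomposable_def)
qed

lemma composableE:
  assumes "composable T y x"
  obtains f g where "x = ea f" "y = ea g" "f \<in> Mor K" "g \<in> Mor K" "composable K g f"
  using assms that by (auto simp: composable_def)

lemma vcomposableE:
  assumes "vcomposable T y x"
  obtains f g where "x = ec f" "y = ec g" "f \<in> Cel K" "g \<in> Cel K" "vcomposable K g f"
  using assms that by (auto simp: vcomposable_def)

lemma hcomposableE:
  assumes "hcomposable T y x"
  obtains f g where "x = ec f" "y = ec g" "f \<in> Cel K" "g \<in> Cel K" "hcomposable K g f"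
  using assms that by (auto simp: hcomposable_def)

lemma composable_Dom_Cod: 
  "hcomposable K \<beta> \<alpha> \<Longrightarrow> composable K (Dom K \<beta>) (Dom K \<alpha>)"
  "hcomposable K \<beta> \<alpha> \<Longrightarrow> composable K (Cod K \<beta>) (Cod K \<alpha>)"
  using dom_cod[of \<alpha>] dom_cod[of \<beta>] by (auto simp: hcomposable_def composable_def)

lemma thin_transport: "locally_thin K \<Longrightarrow> locally_thin T"
  unfolding locally_thin_def by auto

lemma two_category_transport:
  assumes "locally_thin K" shows "two_category T"
proof -
  have "two_category (tidy T)"
  proof (rule thin_two_category, goal_cases)
    case 1 show ?case using assms by (rule thin_transport)
  next
    case (3 \<alpha>) then show ?case using dom_cod by auto
  next
    case (4 a) then show ?case using Id1_type by auto
  next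
    case (5 f) then show ?case using Id2_type by auto
  next
    case (6 g f) then show ?case using Cmp_type by (auto elim!: composableE)
  next
    case (7 \<beta> \<alpha>) then show ?case using Vcmp_type by (auto elim!: vcomposableE)
  next
    case (8 \<beta> \<alpha>) then show ?case using Hcmp_type composable_Dom_Cod by (auto elim!: hcomposableE)
  next
    case (9 h g f)
    from 9(1) obtain h' g' where *: "h = ea h'" "g = ea g'" "composable K h' g'" "g' \<in> Mor K"
      by (rule composableE)
    from 9(2) obtain f' where f: "f = ea f'" "composable K g' f'"
      using * by (auto elim!: composableE)
    have "composable K (h' \<odot> g') f'" "composable K h' (g' \<odot> f')"
      using Cmp_type[OF *(3)] Cmp_type[OF f(2)] *(3) f(2) by (auto simp: composable_def in_hom_def)
    then show ?case using * f Cmp_assoc by simp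
  next
    case (10 f)
    then obtain f' where f: "f = ea f'" "f' \<in> Mor K" by auto
    have "composable K (Id1 K (Tgt K f')) f'" "composable K f' (Id1 K (Src K f'))"
      using f Id1_type[of "Tgt K f'"] Id1_type[of "Src K f'"] by (auto simp: composable_def in_hom_def)
    then show ?case using f Cmp_Id1 by simp
  qed auto
  moreover have "tidy T = T"
    unfolding transport_def Let_def by (rule tidy_tidy) auto
  ultimately show ?thesis by simp
qed

end

text \<open>
  Preservation of composites of 2-cells is an equation between 2-cells of the target and hence
  automatic; only the boundaries and the behaviour on 1-cells matter.
\<close>

lemma thin_transport_functor:
  assumes K: "transported K eo ea ec" and L: "transported L po pa pc" and thin: "locally_thin L"
    and H0: "\<And>a. a \<in> Ob K \<Longrightarrow> H0 a \<in> Ob L"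
    and H1: "\<And>f. f \<in> Mor K \<Longrightarrow> in_hom L (H1 f) (H0 (Src K f)) (H0 (Tgt K f))"
    and H2: "\<And>\<alpha>. \<alpha> \<in> Cel K \<Longrightarrow> in_cell L (H2 \<alpha>) (H1 (Dom K \<alpha>)) (H1 (Cod K \<alpha>))"
    and Id: "\<And>a. a \<in> Ob K \<Longrightarrow> H1 (Id1 K a) = Id1 L (H0 a)"
    and Cmp: "\<And>g f. composable K g f \<Longrightarrow> H1 (g \<odot>\<^bsub>K\<^esub> f) = H1 g \<odot>\<^bsub>L\<^esub> H1 f"
  shows "two_functor (transport eo ea ec K) (transport po pa pc L)
    \<lparr>F0 = (\<lambda>x\<in>eo ` Ob K. po (H0 (inv_into (Ob K) eo x))),
     F1 = (\<lambda>x\<in>ea ` Mor K. pa (H1 (inv_into (Mor K) ea x))),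
     F2 = (\<lambda>x\<in>ec ` Cel K. pc (H2 (inv_into (Cel K) ec x)))\<rparr>"
proof -
  interpret K: transported K eo ea ec by fact
  interpret L: transported L po pa pc by fact
  have m1: "H1 f \<in> Mor L" if "f \<in> Mor K" for f using H1[OF that] by (rule in_homD)
  have m2: "H2 \<alpha> \<in> Cel L" if "\<alpha> \<in> Cel K" for \<alpha> using H2[OF that] by (rule in_cellD)
  have c: "composable L (H1 g) (H1 f)" if "composable K g f" for g f
    using that H1[of g] H1[of f] by (auto simp: composable_def in_hom_def)
  have v: "vcomposable L (H2 \<beta>) (H2 \<alpha>)" if "vcomposable K \<beta> \<alpha>" for \<alpha> \<beta>
    using that H2[of \<alpha>] H2[of \<beta>] by (auto simp: vcomposable_def in_cell_def)
  have h: "hcomposable L (H2 \<beta>) (H2 \<alpha>)" if "hcomposable K \<beta> \<alpha>" for \<alpha> \<beta>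
  proof -
    have "\<alpha> \<in> Cel K" "\<beta> \<in> Cel K" using that by (auto simp: hcomposable_def)
    then show ?thesis
      using that H2[of \<alpha>] H2[of \<beta>] H1[of "Dom K \<alpha>"] H1[of "Dom K \<beta>"]
      by (auto simp: hcomposable_def in_cell_def in_hom_def)
  qed
  have Id2: "H2 (Id2 K f) = Id2 L (H1 f)" if "f \<in> Mor K" for f
    using H2[of "Id2 K f"] that K.Id2_type[OF that]
    by (intro thin_eqI[OF thin _ L.Id2_type[OF m1[OF that]]]) (simp add: in_cell_def)
  have V: "H2 (\<beta> \<cdot>\<^bsub>K\<^esub> \<alpha>) = H2 \<beta> \<cdot>\<^bsub>L\<^esub> H2 \<alpha>" if vc: "vcomposable K \<beta> \<alpha>" for \<alpha> \<beta>
  proof -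
    have "\<alpha> \<in> Cel K" "\<beta> \<in> Cel K" using vc by (auto simp: vcomposable_def)
    then show ?thesis
      using H2[of "\<beta> \<cdot>\<^bsub>K\<^esub> \<alpha>"] vc K.Vcmp_type[OF vc] H2[of \<alpha>] H2[of \<beta>]
      by (intro thin_eqI[OF thin _ L.Vcmp_type[OF v[OF vc]]]) (simp add: in_cell_def)
  qed
  have H: "H2 (\<beta> \<star>\<^bsub>K\<^esub> \<alpha>) = H2 \<beta> \<star>\<^bsub>L\<^esub> H2 \<alpha>" if hc: "hcomposable K \<beta> \<alpha>" for \<alpha> \<beta>
  proof -
    have "\<alpha> \<in> Cel K" "\<beta> \<in> Cel K" using hc by (auto simp: hcomposable_def)
    then show ?thesis
      using H2[of "\<beta> \<star>\<^bsub>K\<^esub> \<alpha>"] hc K.Hcmp_type[OF hc] H2[of \<alpha>] H2[of \<beta>]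
        Cmp[OF K.composable_Dom_Cod(1)[OF hc]] Cmp[OF K.composable_Dom_Cod(2)[OF hc]]
      by (intro thin_eqI[OF thin _ L.Hcmp_type[OF h[OF hc]]]) (simp add: in_cell_def)
  qed
  have hom: "Src L (H1 f) = H0 (Src K f)" "Tgt L (H1 f) = H0 (Tgt K f)" if "f \<in> Mor K" for f
    using H1[OF that] by (auto simp: in_hom_def)
  have cell: "Dom L (H2 \<alpha>) = H1 (Dom K \<alpha>)" "Cod L (H2 \<alpha>) = H1 (Cod K \<alpha>)" if "\<alpha> \<in> Cel K" for \<alpha>
    using H2[OF that] by (auto simp: in_cell_def)
  show ?thesis
  proof (unfold_locales, goal_cases)
    case 1 then show ?case using H0 by auto
  next
    case (3 f) then show ?case using H1 H0 m1 hom by (auto simp: in_hom_def)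
  next
    case (5 \<alpha>) then show ?case using H2 m1 m2 cell by (auto simp: in_cell_def)
  next
    case (6 a) then show ?case using Id H0 by auto
  next
    case (7 g f) then show ?case using Cmp c by (auto elim!: K.composableE)
  next
    case (8 f) then show ?case using Id2 m1 by auto
  next
    case (9 \<beta> \<alpha>) then show ?case using V v by (auto elim!: K.vcomposableE)
  next
    case (10 \<beta> \<alpha>) then show ?case using H h by (auto elim!: K.hcomposableE)
  qed auto
qed

lemma comp_two_functor:
  assumes F: "two_functor K L F" and G: "two_functor L M G"
    and K: "two_category K"
  shows "two_functor K M (comp_twofun K G F)"
proof -
  interpret F: two_functor K L F by fact
  interpret G: two_functor L M G by fact
  interpret K: two_category K by fact
  have f0: "a \<in> Ob K \<Longrightarrow> F0 F a \<in> Ob L" for a using F.F0_type by auto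
  have f1: "f \<in> Mor K \<Longrightarrow> F1 F f \<in> Mor L" for f using F.F1_type by (auto simp: in_hom_def)
  have f2: "\<alpha> \<in> Cel K \<Longrightarrow> F2 F \<alpha> \<in> Cel L" for \<alpha> using F.F2_type by (auto simp: in_cell_def)
  have c: "composable L (F1 F g) (F1 F f)" if "composable K g f" for g f
    using that F.F1_type[of g] F.F1_type[of f] by (auto simp: composable_def in_hom_def)
  have v: "vcomposable L (F2 F \<beta>) (F2 F \<alpha>)" if "vcomposable K \<beta> \<alpha>" for \<alpha> \<beta>
    using that F.F2_type[of \<alpha>] F.F2_type[of \<beta>] by (auto simp: vcomposable_def in_cell_def)
  have h: "hcomposable L (F2 F \<beta>) (F2 F \<alpha>)" if "hcomposable K \<beta> \<alpha>" for \<alpha> \<beta>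
    using that F.F2_type[of \<alpha>] F.F2_type[of \<beta>] F.F1_type[of "Dom K \<alpha>"] F.F1_type[of "Dom K \<beta>"]
      K.dom_cod[of \<alpha>] K.dom_cod[of \<beta>]
    by (auto simp: hcomposable_def in_cell_def in_hom_def)
  note cmp = comp_twofun_def compose_def
  show ?thesis
  proof (unfold_locales, goal_cases)
    case 1 then show ?case using F.F0_type G.F0_type by (auto simp: cmp)
  next
    case (3 f) then show ?case
      using F.F1_type[of f] G.F1_type[OF f1[of f]] K.src_tgt[of f] by (simp add: cmp in_hom_def)
  next
    case (5 \<alpha>) then show ?case
      using F.F2_type[of \<alpha>] G.F2_type[OF f2[of \<alpha>]] K.dom_cod[of \<alpha>] by (simp add: cmp in_cell_def)
  next
    case (6 a) then show ?case
      using F.F1_Id1[of a] G.F1_Id1[OF f0[of a]] K.Id1_type[of a] by (simp add: cmp in_hom_def)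
  next
    case (7 g f) then show ?case
      using F.F1_Cmp[of g f] G.F1_Cmp[OF c[of g f]] K.Cmp_type[of g f]
      by (simp add: cmp in_hom_def) (simp add: composable_def)
  next
    case (8 f) then show ?case
      using F.F2_Id2[of f] G.F2_Id2[OF f1[of f]] K.Id2_type[of f] by (simp add: cmp in_cell_def)
  next
    case (9 \<beta> \<alpha>) then show ?case
      using F.F2_Vcmp[of \<beta> \<alpha>] G.F2_Vcmp[OF v[of \<beta> \<alpha>]] K.Vcmp_type[of \<beta> \<alpha>]
      by (simp add: cmp in_cell_def) (simp add: vcomposable_def)
  next
    case (10 \<beta> \<alpha>) then show ?case
      using F.F2_Hcmp[of \<beta> \<alpha>] G.F2_Hcmp[OF h[of \<beta> \<alpha>]] K.Hcmp_type[of \<beta> \<alpha>]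
      by (simp add: cmp in_cell_def) (simp add: hcomposable_def)
  qed (auto simp: cmp)
qed


section \<open>Codes of enriched categories\<close>

lemma Enrcat_sel [simp]:
  "Ob (Enrcat B) = {C. enriched_category B C}" "Mor (Enrcat B) = Enrcat_Mor B"
  "Cel (Enrcat B) = {Arrow f \<alpha> f' | f \<alpha> f'. f \<in> Enrcat_Mor B \<and> f' \<in> Enrcat_Mor B \<and>
      source f = source f' \<and> target f = target f' \<and>
      enriched_natural B (source f) (target f) (via f) (via f') \<alpha>}"
  by (simp_all add: Enrcat_def)

lemma Enrcat_MorD:
  assumes "f \<in> Enrcat_Mor B"
  shows "enriched_category B (source f)" "enriched_category B (target f)"
    "enriched_functor B (source f) (target f) (via f)"
  using assms by (auto simp: Enrcat_Mor_def)

lemma Enrcat_MorI: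
  "enriched_category B C \<Longrightarrow> enriched_category B D \<Longrightarrow> enriched_functor B C D f \<Longrightarrow>
    Arrow C f D \<in> Enrcat_Mor B"
  by (auto simp: Enrcat_Mor_def)

lemma enriched_category_ob:
  assumes "enriched_category B C" shows "ob C \<subseteq> U1" "large (ob C)" "small (ob C)"
  using enriched_category.small_ob[OF assms] by (auto simp: small_large dest: small_subset_U1)

lemma code_cat_eqD:
  assumes C: "enriched_category B C" and D: "enriched_category B' D" and eq: "code_cat C = code_cat D"
  shows "C = D"
proof -
  interpret C: enriched_category B C by fact
  interpret D: enriched_category B' D by fact
  note l = enriched_category_ob(2)[OF C]
  have ob: "ob D = ob C"
    using eq l enriched_category_ob(2)[OF D] by (simp add: code_cat_def vset_eq_iff)
  have e: "ext C c = ext D c" "unt C c = unt D c" if "c \<in> ob C" for c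
    using eq graph_eqD[OF _ l that] by (simp_all add: code_cat_def ob)
  have h: "hom C c c' = hom D c c'" if "c \<in> ob C" "c' \<in> ob C" for c c'
    using eq graph2_eqD[OF _ l that] by (simp add: code_cat_def ob)
  have m: "mul C c c' c'' = mul D c c' c''" if "c \<in> ob C" "c' \<in> ob C" "c'' \<in> ob C" for c c' c''
    using eq graph3_eqD[OF _ l that] by (simp add: code_cat_def ob)
  show ?thesis
  proof (rule enrcat.equality)
    show "ob C = ob D" by (simp add: ob)
    show "ext C = ext D"
      using C.ext_type D.ext_type e by (intro extensionalityI[of _ "ob C"]) (auto simp: ob PiE_def)
    show "unt C = unt D"
      using C.unt_extensional D.unt_extensional e
      by (intro extensionalityI[of _ "ob C"]) (auto simp: ob)
    show "hom C = hom D"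
    proof (intro ext)
      fix c c' show "hom C c c' = hom D c c'"
        using C.hom_extensional[of c c'] D.hom_extensional[of c c'] h[of c c'] ob by metis
    qed
    show "mul C = mul D"
    proof (intro ext)
      fix c c' c'' show "mul C c c' c'' = mul D c c' c''"
        using C.mul_extensional[of c c' c''] D.mul_extensional[of c c' c''] m[of c c' c''] ob by metis
    qed
  qed simp
qed

lemma code_fun_eqD:
  assumes f: "f \<in> Enrcat_Mor B" and g: "g \<in> Enrcat_Mor B" and eq: "code_fun f = code_fun g"
  shows "f = g"
proof -
  interpret f: enriched_functor B "source f" "target f" "via f" by (rule Enrcat_MorD(3)[OF f])
  interpret g: enriched_functor B "source g" "target g" "via g" by (rule Enrcat_MorD(3)[OF g])
  have s: "source f = source g" "target f = target g"
    using eq code_cat_eqD Enrcat_MorD[OF f] Enrcat_MorD[OF g] by (auto simp: code_fun_def)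
  note l = enriched_category_ob(2)[OF Enrcat_MorD(1)[OF f]]
  have o: "fob (via f) c = fob (via g) c" if "c \<in> ob (source f)" for c
    using eq graph_eqD[OF _ l that] by (simp add: code_fun_def s)
  have h: "fhom (via f) c c' = fhom (via g) c c'" if "c \<in> ob (source f)" "c' \<in> ob (source f)" for c c'
    using eq graph2_eqD[OF _ l that] by (simp add: code_fun_def s)
  have "via f = via g"
  proof (rule enrfun.equality)
    show "fob (via f) = fob (via g)"
      using f.fob_type g.fob_type o by (intro extensionalityI[of _ "ob (source f)"]) (auto simp: s PiE_def)
    show "fhom (via f) = fhom (via g)"
    proof (intro ext)
      fix c c' show "fhom (via f) c c' = fhom (via g) c c'"
        using f.fhom_extensional[of c c'] g.fhom_extensional[of c c'] h[of c c'] s by metis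
    qed
  qed simp
  then show ?thesis using s by (simp add: arrow.expand)
qed

lemma code_nat_eqD:
  assumes \<alpha>: "\<alpha> \<in> Cel (Enrcat B)" and \<beta>: "\<beta> \<in> Cel (Enrcat B)" and eq: "code_nat \<alpha> = code_nat \<beta>"
  shows "\<alpha> = \<beta>"
proof -
  have n: "enriched_natural B (source (source \<alpha>)) (target (source \<alpha>)) (via (source \<alpha>)) (via (target \<alpha>)) (via \<alpha>)"
    "enriched_natural B (source (source \<beta>)) (target (source \<beta>)) (via (source \<beta>)) (via (target \<beta>)) (via \<beta>)"
    and m: "source \<alpha> \<in> Enrcat_Mor B" "source \<beta> \<in> Enrcat_Mor B" "target \<alpha> \<in> Enrcat_Mor B" "target \<beta> \<in> Enrcat_Mor B"
    using \<alpha> \<beta> by auto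
  have s: "source \<alpha> = source \<beta>" "target \<alpha> = target \<beta>"
    using eq code_fun_eqD m by (auto simp: code_nat_def)
  note l = enriched_category_ob(2)[OF Enrcat_MorD(1)[OF m(1)]]
  have c: "via \<alpha> c = via \<beta> c" if "c \<in> ob (source (source \<alpha>))" for c
    using eq graph_eqD[OF _ l that] by (simp add: code_nat_def s)
  have "via \<alpha> = via \<beta>"
    using n[THEN enriched_natural.component_extensional] c
    by (intro extensionalityI[of _ "ob (source (source \<alpha>))"]) (auto simp: s)
  then show ?thesis using s by (simp add: arrow.expand)
qed

lemma inj_codes:
  "inj_on code_cat (Ob (Enrcat B))" "inj_on code_fun (Mor (Enrcat B))" "inj_on code_nat (Cel (Enrcat B))"
  using code_cat_eqD code_fun_eqD code_nat_eqD by (auto intro!: inj_onI simp del: Enrcat_sel(3)) 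

lemma Enr_ob_carriers:
  "Ob (Enr_ob B) = code_cat ` {C. enriched_category B C}" "Mor (Enr_ob B) = code_fun ` Enrcat_Mor B"
  "Cel (Enr_ob B) = code_nat ` Cel (Enrcat B)"
  by (simp_all add: Enr_ob_def)

lemma large_U1 [simp]: "large U1"
  by simp

text \<open>
  The objects of small enriched categories lie in the smaller universe, which is itself a large
  set, and all other data are functions from objects to the carriers of the base.
\<close>

lemma large_Enr_ob:
  assumes B: "large (Ob B)" "large (Mor B)" "large (Cel B)"
  shows "large (Ob (Enr_ob B))" "large (Mor (Enr_ob B))" "large (Cel (Enr_ob B))"
proof -
  define X where "X = Times (Powerset U1) (Times (Powerset (Times U1 (Ob B)))
    (Times (Powerset (Times (Times U1 U1) (Mor B)))
    (Times (Powerset (Times U1 (Cel B))) (Powerset (Times (Times U1 (Times U1 U1)) (Cel B))))))"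
  define Y where "Y = Times X (Times (Times (Powerset (Times U1 U1))
    (Powerset (Times (Times U1 U1) (Cel B)))) X)"
  define Z where "Z = Times Y (Times (Powerset (Times U1 (Cel B))) Y)"
  note L = large_Times large_Powerset
  have X: "large X" unfolding X_def by (intro L B large_U1)
  have Y: "large Y" unfolding Y_def by (intro L B large_U1 X)
  have Z: "large Z" unfolding Z_def by (intro L B large_U1 Y)
  have cat: "code_cat C \<in> X" if C: "enriched_category B C" for C
  proof -
    interpret C: enriched_category B C by fact
    note o = enriched_category_ob[OF C]
    show ?thesis unfolding code_cat_def X_def vpair_in_Times
    proof (intro conjI vset_in_Powerset graph_in_Powerset graph2_in_Powerset graph3_in_Powerset o B large_U1)
      show "ext C x \<in> Ob B" if "x \<in> ob C" for x using C.ext_type that by auto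
      show "hom C x y \<in> Mor B" if "x \<in> ob C" "y \<in> ob C" for x y
        using C.hom_type[OF that] by (rule in_homD)
      show "unt C x \<in> Cel B" if "x \<in> ob C" for x
        using C.unt_type[OF that] by (rule in_cellD)
      show "mul C x y z \<in> Cel B" if "x \<in> ob C" "y \<in> ob C" "z \<in> ob C" for x y z
        using C.mul_type[OF that] by (rule in_cellD)
    qed
  qed
  have "fun": "code_fun f \<in> Y" if f: "f \<in> Enrcat_Mor B" for f
  proof -
    interpret f: enriched_functor B "source f" "target f" "via f" by (rule Enrcat_MorD(3)[OF f])
    note o = enriched_category_ob[OF Enrcat_MorD(1)[OF f]]
    show ?thesis unfolding code_fun_def Y_def vpair_in_Times
    proof (intro conjI vset_in_Powerset graph_in_Powerset graph2_in_Powerset o B large_U1 cat Enrcat_MorD[OF f])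
      show "fob (via f) x \<in> U1" if "x \<in> ob (source f)" for x
        using f.fob_type that enriched_category_ob(1)[OF Enrcat_MorD(2)[OF f]] by auto
      show "fhom (via f) x y \<in> Cel B" if "x \<in> ob (source f)" "y \<in> ob (source f)" for x y
        using f.fhom_type[OF that] by (rule in_cellD)
    qed
  qed
  have nat: "code_nat \<alpha> \<in> Z" if \<alpha>: "\<alpha> \<in> Cel (Enrcat B)" for \<alpha>
  proof -
    have n: "enriched_natural B (source (source \<alpha>)) (target (source \<alpha>)) (via (source \<alpha>)) (via (target \<alpha>)) (via \<alpha>)"
      and m: "source \<alpha> \<in> Enrcat_Mor B" "target \<alpha> \<in> Enrcat_Mor B"
      using \<alpha> by auto
    note o = enriched_category_ob[OF Enrcat_MorD(1)[OF m(1)]]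
    show ?thesis unfolding code_nat_def Z_def vpair_in_Times
    proof (intro conjI graph_in_Powerset o B large_U1 "fun" m)
      show "via \<alpha> x \<in> Cel B" if "x \<in> ob (source (source \<alpha>))" for x
        using enriched_natural.component_type[OF n that] by (rule in_cellD)
    qed
  qed
  show "large (Ob (Enr_ob B))"
    unfolding Enr_ob_carriers by (rule large_mono[OF X]) (use cat in blast)
  show "large (Mor (Enr_ob B))"
    unfolding Enr_ob_carriers by (rule large_mono[OF Y]) (use "fun" in blast)
  show "large (Cel (Enr_ob B))"
    unfolding Enr_ob_carriers by (rule large_mono[OF Z]) (use nat in blast)
qed

section \<open>Enrichment over a locally thin bicategory\<close>

locale thin_bicategory = bicategory B
  for B :: "'v::universe_pair bcy" (structure) +
  assumes thin: "locally_thin B"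

lemma (in bicategory) Id1_simps [simp]:
  assumes "a \<in> Ob B" shows "Id1 B a \<in> Mor B" "Src B (Id1 B a) = a" "Tgt B (Id1 B a) = a"
  using Id1_type[OF assms] by (auto simp: in_hom_def)

context thin_bicategory
begin

lemmas eqI = thin_eqI[OF thin]

lemma in_cell_Run: "f \<in> Mor B \<Longrightarrow> Src B f = a \<Longrightarrow> in_cell B (Run B f) (f \<odot> Id1 B a) f"
  using Run_type by blast

lemma in_cell_Lun: "f \<in> Mor B \<Longrightarrow> Tgt B f = a \<Longrightarrow> in_cell B (Lun B f) (Id1 B a \<odot> f) f"
  using Lun_type by blast

lemma in_cell_inv:
  assumes "in_cell B \<alpha> f g" "\<exists>\<beta>. inverse_cell B \<alpha> \<beta>" shows "in_cell B (inv_cell B \<alpha>) g f"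
proof -
  have "\<exists>!\<beta>. inverse_cell B \<alpha> \<beta>"
    using assms(2) eqI by (auto simp: inverse_cell_def)
  then have "inverse_cell B \<alpha> (inv_cell B \<alpha>)" unfolding inv_cell_def by (rule theI')
  then show ?thesis using assms(1) by (auto simp: inverse_cell_def in_cell_def)
qed

lemma in_cell_inv_Run: "f \<in> Mor B \<Longrightarrow> Src B f = a \<Longrightarrow> in_cell B (inv_cell B (Run B f)) f (f \<odot> Id1 B a)"
  using in_cell_inv[OF in_cell_Run] Run_invertible by blast

lemma in_cell_inv_Lun: "f \<in> Mor B \<Longrightarrow> Tgt B f = a \<Longrightarrow> in_cell B (inv_cell B (Lun B f)) f (Id1 B a \<odot> f)"
  using in_cell_inv[OF in_cell_Lun] Lun_invertible by blast

text \<open>The unit, associativity and naturality laws are equations between parallel 2-cells of the base.\<close>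

lemma enriched_categoryI:
  assumes small_ob: "small (ob C)"
    and ext_type: "ext C \<in> ob C \<rightarrow>\<^sub>E Ob B"
    and hom_type: "\<And>c c'. c \<in> ob C \<Longrightarrow> c' \<in> ob C \<Longrightarrow> in_hom B (hom C c c') (ext C c) (ext C c')"
    and unt_type: "\<And>c. c \<in> ob C \<Longrightarrow> in_cell B (unt C c) (Id1 B (ext C c)) (hom C c c)"
    and mul_type: "\<And>c0 c1 c2. c0 \<in> ob C \<Longrightarrow> c1 \<in> ob C \<Longrightarrow> c2 \<in> ob C \<Longrightarrow>
      in_cell B (mul C c0 c1 c2) (hom C c1 c2 \<odot> hom C c0 c1) (hom C c0 c2)"
    and "\<And>c c'. \<not> (c \<in> ob C \<and> c' \<in> ob C) \<Longrightarrow> hom C c c' = undefined"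
    and "unt C \<in> extensional (ob C)"
    and "\<And>c0 c1 c2. \<not> (c0 \<in> ob C \<and> c1 \<in> ob C \<and> c2 \<in> ob C) \<Longrightarrow> mul C c0 c1 c2 = undefined"
  shows "enriched_category B C"
proof -
  have h [simp]: "hom C c c' \<in> Mor B" "Src B (hom C c c') = ext C c" "Tgt B (hom C c c') = ext C c'"
    if "c \<in> ob C" "c' \<in> ob C" for c c'
    using hom_type[OF that] by (auto simp: in_hom_def)
  have e [simp]: "ext C c \<in> Ob B" if "c \<in> ob C" for c using ext_type that by auto
  show ?thesis
  proof (unfold_locales, goal_cases)
    case (6 c c')
    then show ?case
      by (intro eqI[OF in_cell_Vcmp[OF mul_type in_cell_Hcmp[OF unt_type Id2_type]] in_cell_Lun]) simp_all
  next
    case (7 c c')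
    then show ?case
      by (intro eqI[OF in_cell_Vcmp[OF mul_type in_cell_Hcmp[OF Id2_type unt_type]] in_cell_Run]) simp_all
  next
    case (8 c0 c1 c2 c3)
    then have m: "in_hom B (hom C c1 c2 \<odot> hom C c0 c1) (ext C c0) (ext C c2)"
      "in_hom B (hom C c2 c3 \<odot> hom C c1 c2) (ext C c1) (ext C c3)"
      by (auto intro!: in_hom_Cmp hom_type)
    have "in_cell B (Asc B (hom C c2 c3) (hom C c1 c2) (hom C c0 c1))
        (hom C c2 c3 \<odot> hom C c1 c2 \<odot> hom C c0 c1) (hom C c2 c3 \<odot> (hom C c1 c2 \<odot> hom C c0 c1))"
      using 8 by (intro Asc_type) (auto simp: composable_def)
    then show ?case using 8 m
      by (intro eqI[OF in_cell_Vcmp[OF mul_type in_cell_Hcmp[OF mul_type Id2_type]]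
            in_cell_Vcmp[OF mul_type in_cell_Vcmp[OF in_cell_Hcmp[OF Id2_type mul_type]]]])
        (simp_all add: in_hom_def)
  qed (use assms in auto)
qed

lemma enriched_functorI:
  assumes C: "enriched_category B C" and D: "enriched_category B D"
    and fob_type: "fob f \<in> ob C \<rightarrow>\<^sub>E ob D"
    and fob_ext: "\<And>c. c \<in> ob C \<Longrightarrow> ext D (fob f c) = ext C c"
    and fhom_type: "\<And>c c'. c \<in> ob C \<Longrightarrow> c' \<in> ob C \<Longrightarrow>
      in_cell B (fhom f c c') (hom C c c') (hom D (fob f c) (fob f c'))"
    and "\<And>c c'. \<not> (c \<in> ob C \<and> c' \<in> ob C) \<Longrightarrow> fhom f c c' = undefined"
  shows "enriched_functor B C D f"
proof -
  interpret C: enriched_category B C by fact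
  interpret D: enriched_category B D by fact
  have f [simp]: "fob f c \<in> ob D" if "c \<in> ob C" for c using fob_type that by auto
  show ?thesis
  proof (unfold_locales, goal_cases)
    case (4 c)
    then show ?case
      using D.unt_type[of "fob f c"] fob_ext[of c]
      by (intro eqI[OF in_cell_Vcmp[OF fhom_type C.unt_type]]) simp_all
  next
    case (5 c0 c1 c2)
    then show ?case
      using C.hom_type[of c1 c2] C.hom_type[of c0 c1]
      by (intro eqI[OF in_cell_Vcmp[OF fhom_type C.mul_type]
            in_cell_Vcmp[OF D.mul_type in_cell_Hcmp[OF fhom_type fhom_type]]]) (simp_all add: in_hom_def)
  qed (use assms in auto)
qed

lemma enriched_naturalI:
  assumes C: "enriched_category B C" and D: "enriched_category B D"
    and f: "enriched_functor B C D f" and f': "enriched_functor B C D f'"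
    and "\<alpha> \<in> extensional (ob C)"
    and \<alpha>: "\<And>c. c \<in> ob C \<Longrightarrow> in_cell B (\<alpha> c) (Id1 B (ext C c)) (hom D (fob f c) (fob f' c))"
  shows "enriched_natural B C D f f' \<alpha>"
proof -
  interpret C: enriched_category B C by fact
  interpret D: enriched_category B D by fact
  interpret f: enriched_functor B C D f by fact
  interpret f': enriched_functor B C D f' by fact
  have fo [simp]: "fob f c \<in> ob D" "fob f' c \<in> ob D" if "c \<in> ob C" for c
    using f.fob_type f'.fob_type that by auto
  have e [simp]: "ext C c \<in> Ob B" if "c \<in> ob C" for c using C.ext_type that by auto
  have h [simp]: "hom C c c' \<in> Mor B" "Src B (hom C c c') = ext C c" "Tgt B (hom C c c') = ext C c'"
    if "c \<in> ob C" "c' \<in> ob C" for c c'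
    using C.hom_type[OF that] by (auto simp: in_hom_def)
  show ?thesis
  proof (unfold_locales, goal_cases)
    case (3 c c')
    then show ?case
      by (intro eqI[OF
            in_cell_Vcmp[OF in_cell_Vcmp[OF D.mul_type in_cell_Hcmp[OF f'.fhom_type \<alpha>]] in_cell_inv_Run]
            in_cell_Vcmp[OF in_cell_Vcmp[OF D.mul_type in_cell_Hcmp[OF \<alpha> f.fhom_type]] in_cell_inv_Lun]])
        simp_all
  qed (use assms in auto)
qed

end


lemma Enrcat_Cmp_ends [simp]: "source (Enrcat_Cmp B g f) = source f" "target (Enrcat_Cmp B g f) = target g"
  by (simp_all add: Enrcat_Cmp_def Let_def)

lemma locally_thin_Enrcat:
  assumes "locally_thin B" shows "locally_thin (Enrcat B)"
proof -
  have "\<alpha> = \<beta>" if "enriched_natural B C D f f' \<alpha>" "enriched_natural B C D f f' \<beta>" for C D f f' \<alpha> \<beta>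
  proof -
    interpret a: enriched_natural B C D f f' \<alpha> by fact
    interpret b: enriched_natural B C D f f' \<beta> by fact
    show ?thesis
      using a.component_extensional b.component_extensional
        thin_eqI[OF assms a.component_type b.component_type]
      by (rule extensionalityI)
  qed
  then show ?thesis unfolding Enrcat_def tidy_rel unfolding locally_thin_def by auto
qed

context thin_bicategory
begin

lemma Enrcat_Id1_Mor:
  assumes C: "enriched_category B C"
  shows "Arrow C \<lparr>fob = restrict id (ob C),
    fhom = (\<lambda>c c'. if c \<in> ob C \<and> c' \<in> ob C then Id2 B (hom C c c') else undefined)\<rparr> C \<in> Enrcat_Mor B"
proof -
  interpret C: enriched_category B C by fact
  show ?thesis
    using C.hom_type by (intro Enrcat_MorI enriched_functorI C) (auto simp: in_hom_def intro!: Id2_type)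
qed

lemma Enrcat_Cmp_Mor:
  assumes g: "g \<in> Enrcat_Mor B" and f: "f \<in> Enrcat_Mor B" and gf: "source g = target f"
  shows "Enrcat_Cmp B g f \<in> Enrcat_Mor B"
proof -
  note C = Enrcat_MorD(1)[OF f] and E = Enrcat_MorD(2)[OF g]
  interpret f: enriched_functor B "source f" "target f" "via f" by (rule Enrcat_MorD(3)[OF f])
  interpret g: enriched_functor B "target f" "target g" "via g" using Enrcat_MorD(3)[OF g] gf by simp
  have fo [simp]: "fob (via f) c \<in> ob (target f)" if "c \<in> ob (source f)" for c
    using f.fob_type that by auto
  have go [simp]: "fob (via g) c \<in> ob (target g)" if "c \<in> ob (target f)" for c
    using g.fob_type that by auto
  show ?thesis unfolding Enrcat_Cmp_def Let_def
    by (intro Enrcat_MorI enriched_functorI C E)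
      (auto simp: compose_def g.fob_ext f.fob_ext intro!: in_cell_Vcmp[OF g.fhom_type f.fhom_type])
qed

lemma enriched_natural_unit:
  assumes f: "f \<in> Enrcat_Mor B"
  shows "enriched_natural B (source f) (target f) (via f) (via f)
    (\<lambda>c\<in>ob (source f). unt (target f) (fob (via f) c))"
proof -
  interpret f: enriched_functor B "source f" "target f" "via f" by (rule Enrcat_MorD(3)[OF f])
  interpret D: enriched_category B "target f" by (rule Enrcat_MorD(2)[OF f])
  have fo [simp]: "fob (via f) c \<in> ob (target f)" if "c \<in> ob (source f)" for c
    using f.fob_type that by auto
  show ?thesis
  proof (intro enriched_naturalI Enrcat_MorD[OF f])
    fix c assume "c \<in> ob (source f)"
    then show "in_cell B ((\<lambda>c\<in>ob (source f). unt (target f) (fob (via f) c)) c) (Id1 B (ext (source f) c))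
        (hom (target f) (fob (via f) c) (fob (via f) c))"
      using D.unt_type[of "fob (via f) c"] f.fob_ext[of c] by simp
  qed auto
qed

text \<open>The common shape of the components of vertical and horizontal composites.\<close>

lemma in_cell_paste:
  assumes D: "enriched_category B D" and d: "d0 \<in> ob D" "d1 \<in> ob D" "d2 \<in> ob D"
    and a: "a \<in> Ob B" "ext D d0 = a" "ext D d1 = a" "ext D d2 = a"
    and \<alpha>: "in_cell B \<alpha> (Id1 B a) (hom D d0 d1)" and \<beta>: "in_cell B \<beta> (Id1 B a) (hom D d1 d2)"
  shows "in_cell B (mul D d0 d1 d2 \<cdot> (\<beta> \<star> \<alpha>) \<cdot> inv_cell B (Lun B (Id1 B a))) (Id1 B a) (hom D d0 d2)"
proof -
  interpret D: enriched_category B D by fact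
  show ?thesis
    by (intro in_cell_Vcmp[OF in_cell_Vcmp[OF D.mul_type in_cell_Hcmp[OF \<beta> \<alpha>]] in_cell_inv_Lun])
      (use d a in simp_all)
qed

lemma two_category_Enrcat: "two_category (Enrcat B)"
  unfolding Enrcat_def
proof (rule thin_two_category, goal_cases)
  case 1 then show ?case using locally_thin_Enrcat[OF thin] by (simp add: Enrcat_def)
next
  case (2 f) then show ?case by (auto dest: Enrcat_MorD)
next
  case (3 \<alpha>) then show ?case by auto
next
  case (4 C) then show ?case using Enrcat_Id1_Mor by (simp add: in_hom_def)
next
  case (5 f) then show ?case using enriched_natural_unit by (simp add: in_cell_def)
next
  case (6 g f) then show ?case using Enrcat_Cmp_Mor by (auto simp: in_hom_def composable_def)
next
  case (7 \<beta> \<alpha>)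
  then obtain f a f' b f'' where *: "\<alpha> = Arrow f a f'" "\<beta> = Arrow f' b f''"
    "f \<in> Enrcat_Mor B" "f' \<in> Enrcat_Mor B" "f'' \<in> Enrcat_Mor B"
    "source f' = source f" "source f'' = source f" "target f' = target f" "target f'' = target f"
    "enriched_natural B (source f) (target f) (via f) (via f') a"
    "enriched_natural B (source f) (target f) (via f') (via f'') b"
    by (auto simp: vcomposable_def)
  interpret a: enriched_natural B "source f" "target f" "via f" "via f'" a by fact
  interpret b: enriched_natural B "source f" "target f" "via f'" "via f''" b by fact
  interpret C: enriched_category B "source f" by (rule Enrcat_MorD(1)[OF *(3)])
  interpret f: enriched_functor B "source f" "target f" "via f" by (rule Enrcat_MorD(3)[OF *(3)])
  interpret f': enriched_functor B "source f" "target f" "via f'" using Enrcat_MorD(3)[OF *(4)] * by simp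
  interpret f'': enriched_functor B "source f" "target f" "via f''" using Enrcat_MorD(3)[OF *(5)] * by simp
  have "enriched_natural B (source f) (target f) (via f) (via f'')
    (\<lambda>c\<in>ob (source f). mul (target f) (fob (via f) c) (fob (via f') c) (fob (via f'') c) \<cdot> (b c \<star> a c) \<cdot>
          inv_cell B (Lun B (Id1 B (ext (source f) c))))"
  proof (intro enriched_naturalI Enrcat_MorD[OF *(3)] f''.enriched_functor_axioms, goal_cases)
    case (2 c)
    have "in_cell B (mul (target f) (fob (via f) c) (fob (via f') c) (fob (via f'') c) \<cdot> (b c \<star> a c) \<cdot>
          inv_cell B (Lun B (Id1 B (ext (source f) c)))) (Id1 B (ext (source f) c))
          (hom (target f) (fob (via f) c) (fob (via f'') c))"
      using 2 f.fob_type f'.fob_type f''.fob_type C.ext_type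
      by (intro in_cell_paste Enrcat_MorD(2)[OF *(3)] a.component_type b.component_type
          f.fob_ext f'.fob_ext f''.fob_ext) auto
    then show ?case using 2 by simp
  qed simp
  then show ?case using * by (auto simp: in_cell_def Let_def)
next
  case (8 \<beta> \<alpha>)
  then obtain f a f' g b g' where *: "\<alpha> = Arrow f a f'" "\<beta> = Arrow g b g'"
    "f \<in> Enrcat_Mor B" "f' \<in> Enrcat_Mor B" "g \<in> Enrcat_Mor B" "g' \<in> Enrcat_Mor B"
    "source f' = source f" "target f' = target f" "source g = target f"
    "source g' = target f" "target g' = target g"
    "enriched_natural B (source f) (target f) (via f) (via f') a"
    "enriched_natural B (target f) (target g) (via g) (via g') b"
    by (auto simp: hcomposable_def)
  interpret a: enriched_natural B "source f" "target f" "via f" "via f'" a by fact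
  interpret b: enriched_natural B "target f" "target g" "via g" "via g'" b by fact
  interpret C: enriched_category B "source f" by (rule Enrcat_MorD(1)[OF *(3)])
  interpret f: enriched_functor B "source f" "target f" "via f" by (rule Enrcat_MorD(3)[OF *(3)])
  interpret f': enriched_functor B "source f" "target f" "via f'" using Enrcat_MorD(3)[OF *(4)] * by simp
  interpret g: enriched_functor B "target f" "target g" "via g" using Enrcat_MorD(3)[OF *(5)] * by simp
  interpret g': enriched_functor B "target f" "target g" "via g'" using Enrcat_MorD(3)[OF *(6)] * by simp
  have fo [simp]: "fob (via f) c \<in> ob (target f)" "fob (via f') c \<in> ob (target f)"
    if "c \<in> ob (source f)" for c using f.fob_type f'.fob_type that by auto
  have go [simp]: "fob (via g) c \<in> ob (target g)" "fob (via g') c \<in> ob (target g)"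
    if "c \<in> ob (target f)" for c using g.fob_type g'.fob_type that by auto
  have m: "Enrcat_Cmp B g f \<in> Enrcat_Mor B" "Enrcat_Cmp B g' f' \<in> Enrcat_Mor B"
    using * by (auto intro: Enrcat_Cmp_Mor)
  let ?h = "\<lambda>c\<in>ob (source f). mul (target g) (fob (via g) (fob (via f) c)) (fob (via g) (fob (via f') c))
          (fob (via g') (fob (via f') c)) \<cdot>
          (b (fob (via f') c) \<star> (fhom (via g) (fob (via f) c) (fob (via f') c) \<cdot> a c)) \<cdot>
          inv_cell B (Lun B (Id1 B (ext (source f) c)))"
  have "enriched_natural B (source f) (target g) (via (Enrcat_Cmp B g f)) (via (Enrcat_Cmp B g' f')) ?h"
  proof (intro enriched_naturalI, goal_cases)
    case 1 then show ?case by (rule Enrcat_MorD(1)[OF *(3)])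
  next
    case 2 then show ?case by (rule Enrcat_MorD(2)[OF *(5)])
  next
    case 3 then show ?case using Enrcat_MorD(3)[OF m(1)] by simp
  next
    case 4 then show ?case using Enrcat_MorD(3)[OF m(2)] * by simp
  next
    case (6 c)
    have "in_cell B (b (fob (via f') c)) (Id1 B (ext (source f) c))
        (hom (target g) (fob (via g) (fob (via f') c)) (fob (via g') (fob (via f') c)))"
      using b.component_type[of "fob (via f') c"] f'.fob_ext[of c] 6 by simp
    then have "in_cell B (mul (target g) (fob (via g) (fob (via f) c)) (fob (via g) (fob (via f') c))
          (fob (via g') (fob (via f') c)) \<cdot>
          (b (fob (via f') c) \<star> (fhom (via g) (fob (via f) c) (fob (via f') c) \<cdot> a c)) \<cdot>
          inv_cell B (Lun B (Id1 B (ext (source f) c)))) (Id1 B (ext (source f) c))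
          (hom (target g) (fob (via g) (fob (via f) c)) (fob (via g') (fob (via f') c)))"
      using 6 C.ext_type f.fob_ext[of c] f'.fob_ext[of c] g.fob_ext g'.fob_ext
      by (intro in_cell_paste Enrcat_MorD(2)[OF *(5)] in_cell_Vcmp[OF g.fhom_type a.component_type]) auto
    then show ?case using 6 * by (simp add: Enrcat_Cmp_def Let_def compose_def)
  qed simp
  then show ?case using m * by (auto simp: in_cell_def Let_def)
next
  case (9 h g f)
  then have m: "f \<in> Enrcat_Mor B" "g \<in> Enrcat_Mor B" "h \<in> Enrcat_Mor B" "source g = target f" "source h = target g"
    by (auto simp: composable_def)
  interpret f: enriched_functor B "source f" "target f" "via f" by (rule Enrcat_MorD(3)[OF m(1)])
  interpret g: enriched_functor B "target f" "target g" "via g" using Enrcat_MorD(3)[OF m(2)] m by simp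
  interpret h: enriched_functor B "target g" "target h" "via h" using Enrcat_MorD(3)[OF m(3)] m by simp
  have fo [simp]: "fob (via f) c \<in> ob (target f)" if "c \<in> ob (source f)" for c
    using f.fob_type that by auto
  have go [simp]: "fob (via g) c \<in> ob (target g)" if "c \<in> ob (target f)" for c
    using g.fob_type that by auto
  have "fhom (via h) (fob (via g) (fob (via f) c)) (fob (via g) (fob (via f) c')) \<cdot>
      fhom (via g) (fob (via f) c) (fob (via f) c') \<cdot> fhom (via f) c c' =
      fhom (via h) (fob (via g) (fob (via f) c)) (fob (via g) (fob (via f) c')) \<cdot>
      (fhom (via g) (fob (via f) c) (fob (via f) c') \<cdot> fhom (via f) c c')"
    if "c \<in> ob (source f)" "c' \<in> ob (source f)" for c c'
    using that
    by (intro eqI[OF in_cell_Vcmp[OF in_cell_Vcmp[OF h.fhom_type g.fhom_type] f.fhom_type]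
      in_cell_Vcmp[OF h.fhom_type in_cell_Vcmp[OF g.fhom_type f.fhom_type]]]) simp_all
  then show ?case using m by (auto simp: Enrcat_Cmp_def Let_def compose_def fun_eq_iff)
next
  case (10 f)
  then have m: "f \<in> Enrcat_Mor B" by simp
  interpret f: enriched_functor B "source f" "target f" "via f" by (rule Enrcat_MorD(3)[OF m])
  have fo [simp]: "fob (via f) c \<in> ob (target f)" if "c \<in> ob (source f)" for c
    using f.fob_type that by auto
  have e: "fob (via f) c = undefined" if "c \<notin> ob (source f)" for c
    using f.fob_type that by (auto simp: PiE_def extensional_def)
  have u: "Id2 B (hom (target f) (fob (via f) c) (fob (via f) c')) \<cdot> fhom (via f) c c' = fhom (via f) c c'"
    "fhom (via f) c c' \<cdot> Id2 B (hom (source f) c c') = fhom (via f) c c'"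
    if "c \<in> ob (source f)" "c' \<in> ob (source f)" for c c'
    using Vcmp_Id2[OF in_cellD(1)[OF f.fhom_type[OF that]]] in_cellD[OF f.fhom_type[OF that]] by auto
  show ?case
    by (auto simp: Enrcat_Cmp_def Let_def compose_def fun_eq_iff e u f.fhom_extensional
      intro!: arrow.expand enrfun.equality)
qed

lemma transported_Enrcat: "transported (Enrcat B) code_cat code_fun code_nat"
  using two_category_Enrcat inj_codes[of B] by (simp add: transported_def transported_axioms_def del: Enrcat_sel)

lemma two_category_Enr_ob: "two_category (Enr_ob B)"
  unfolding Enr_ob_def
  by (rule transported.two_category_transport[OF transported_Enrcat locally_thin_Enrcat[OF thin]])

end


section \<open>Change of base\<close>

lemma Enrcat_operations [simp]:
  "f \<in> Enrcat_Mor B \<Longrightarrow> Src (Enrcat B) f = source f" "f \<in> Enrcat_Mor B \<Longrightarrow> Tgt (Enrcat B) f = target f"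
  "\<alpha> \<in> Cel (Enrcat B) \<Longrightarrow> Dom (Enrcat B) \<alpha> = source \<alpha>"
  "\<alpha> \<in> Cel (Enrcat B) \<Longrightarrow> Cod (Enrcat B) \<alpha> = target \<alpha>"
  by (auto simp: Enrcat_def tidy_def)

lemma Enrcat_Id1:
  "enriched_category B C \<Longrightarrow> Id1 (Enrcat B) C = Arrow C \<lparr>fob = restrict id (ob C),
    fhom = (\<lambda>c c'. if c \<in> ob C \<and> c' \<in> ob C then Id2 B (hom C c c') else undefined)\<rparr> C"
  by (simp add: Enrcat_def)

lemma Enrcat_Cmp_eq:
  assumes "composable (Enrcat B) g f"
  shows "g \<odot>\<^bsub>Enrcat B\<^esub> f = Enrcat_Cmp B g f" "g \<in> Enrcat_Mor B" "f \<in> Enrcat_Mor B" "source g = target f"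
  using assms by (auto simp: Enrcat_def composable_def tidy_def)

text \<open>
  Thinness is assumed of the target only, because the change of base along the counit has an
  unknown bicategory as its source.
\<close>

locale thin_change_of_base = lax_functor B D F + B: bicategory B + D: thin_bicategory D
  for B D :: "'v::universe_pair bcy" and F :: "'v lfun"
begin

lemma F0_mem [simp]: "a \<in> Ob B \<Longrightarrow> F0 F a \<in> Ob D"
  using F0_type by auto

lemma F1_simps [simp]:
  "f \<in> Mor B \<Longrightarrow> F1 F f \<in> Mor D" "f \<in> Mor B \<Longrightarrow> Src D (F1 F f) = F0 F (Src B f)"
  "f \<in> Mor B \<Longrightarrow> Tgt D (F1 F f) = F0 F (Tgt B f)"
  using F1_type[of f] by (auto simp: in_hom_def)

lemma F2_in_cell: "in_cell B \<alpha> f g \<Longrightarrow> in_cell D (F2 F \<alpha>) (F1 F f) (F1 F g)"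
  using F2_type[of \<alpha>] by (auto simp: in_cell_def)

lemma push_cat_ob [simp]: "ob (push_cat D F C) = ob C"
  by (simp add: push_cat_def)

lemma push_cat_enriched:
  assumes C: "enriched_category B C" shows "enriched_category D (push_cat D F C)"
proof -
  interpret C: enriched_category B C by fact
  have e [simp]: "ext C c \<in> Ob B" if "c \<in> ob C" for c using C.ext_type that by auto
  have h [simp]: "hom C c c' \<in> Mor B" "Src B (hom C c c') = ext C c" "Tgt B (hom C c c') = ext C c'"
    if "c \<in> ob C" "c' \<in> ob C" for c c'
    using C.hom_type[OF that] by (auto simp: in_hom_def)
  show ?thesis
  proof (intro D.enriched_categoryI, goal_cases)
    case 1 then show ?case by (simp add: C.small_ob)
  next
    case (4 c)
    then show ?case
      by (auto simp: push_cat_def compose_def intro!: D.in_cell_Vcmp[OF F2_in_cell[OF C.unt_type] FId_type])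
  next
    case (5 c0 c1 c2)
    then show ?case
      by (auto simp: push_cat_def composable_def
        intro!: D.in_cell_Vcmp[OF F2_in_cell[OF C.mul_type] FCmp_type])
  qed (auto simp: push_cat_def compose_def in_hom_def)
qed

lemma push_fun_ends [simp]:
  "source (push_fun D F f) = push_cat D F (source f)" "target (push_fun D F f) = push_cat D F (target f)"
  by (simp_all add: push_fun_def Let_def)

lemma push_fun_Mor:
  assumes f: "f \<in> Enrcat_Mor B" shows "push_fun D F f \<in> Enrcat_Mor D"
proof -
  interpret f: enriched_functor B "source f" "target f" "via f" by (rule Enrcat_MorD(3)[OF f])
  have fo [simp]: "fob (via f) c \<in> ob (target f)" if "c \<in> ob (source f)" for c
    using f.fob_type that by auto
  note C = push_cat_enriched[OF Enrcat_MorD(1)[OF f]] and C' = push_cat_enriched[OF Enrcat_MorD(2)[OF f]]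
  show ?thesis unfolding push_fun_def Let_def
  proof (intro Enrcat_MorI D.enriched_functorI C C')
    show "fob \<lparr>fob = fob (via f), fhom = \<lambda>c c'. if c \<in> ob (source f) \<and> c' \<in> ob (source f)
        then F2 F (fhom (via f) c c') else undefined\<rparr>
      \<in> ob (push_cat D F (source f)) \<rightarrow>\<^sub>E ob (push_cat D F (target f))"
      using f.fob_type by simp
  qed (auto simp: push_cat_def compose_def f.fob_ext intro!: F2_in_cell f.fhom_type)
qed

lemma push_nat_Cel:
  assumes \<alpha>: "\<alpha> \<in> Cel (Enrcat B)"
  shows "in_cell (Enrcat D) (push_nat D F \<alpha>) (push_fun D F (source \<alpha>)) (push_fun D F (target \<alpha>))"
proof -
  obtain f a f' where *: "\<alpha> = Arrow f a f'" "f \<in> Enrcat_Mor B" "f' \<in> Enrcat_Mor B"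
    "source f' = source f" "target f' = target f"
    "enriched_natural B (source f) (target f) (via f) (via f') a"
    using \<alpha> by auto
  interpret a: enriched_natural B "source f" "target f" "via f" "via f'" a by fact
  interpret C: enriched_category B "source f" by (rule Enrcat_MorD(1)[OF *(2)])
  interpret f: enriched_functor B "source f" "target f" "via f" by (rule Enrcat_MorD(3)[OF *(2)])
  interpret f': enriched_functor B "source f" "target f" "via f'" using Enrcat_MorD(3)[OF *(3)] * by simp
  have fo [simp]: "fob (via f) c \<in> ob (target f)" "fob (via f') c \<in> ob (target f)"
    if "c \<in> ob (source f)" for c using f.fob_type f'.fob_type that by auto
  have e: "ext (source f) c \<in> Ob B" if "c \<in> ob (source f)" for c using C.ext_type that by auto
  have m: "push_fun D F f \<in> Enrcat_Mor D" "push_fun D F f' \<in> Enrcat_Mor D" using * push_fun_Mor by auto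
  have "enriched_natural D (push_cat D F (source f)) (push_cat D F (target f))
    (via (push_fun D F f)) (via (push_fun D F f')) (\<lambda>c\<in>ob (source f). F2 F (a c) \<cdot>\<^bsub>D\<^esub> FId F (ext (source f) c))"
  proof (intro D.enriched_naturalI, goal_cases)
    case 1 then show ?case using Enrcat_MorD(1)[OF m(1)] by simp
  next
    case 2 then show ?case using Enrcat_MorD(2)[OF m(1)] by simp
  next
    case 3 then show ?case using Enrcat_MorD(3)[OF m(1)] by simp
  next
    case 4 then show ?case using Enrcat_MorD(3)[OF m(2)] * by simp
  next
    case (6 c)
    then show ?case
      by (auto simp: push_cat_def push_fun_def Let_def compose_def
        intro!: D.in_cell_Vcmp[OF F2_in_cell[OF a.component_type] FId_type] e)
  qed simp
  then have "push_nat D F \<alpha> \<in> Cel (Enrcat D)" using m * by (auto simp: push_nat_def Let_def)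
  then show ?thesis by (simp add: in_cell_def del: Enrcat_sel) (simp add: push_nat_def Let_def)
qed

lemma push_fun_Id1:
  assumes C: "enriched_category B C"
  shows "push_fun D F (Id1 (Enrcat B) C) = Id1 (Enrcat D) (push_cat D F C)"
proof -
  interpret C: enriched_category B C by fact
  show ?thesis
    using C.hom_type unfolding Enrcat_Id1[OF C] Enrcat_Id1[OF push_cat_enriched[OF C]]
    by (auto simp: push_fun_def Let_def push_cat_def fun_eq_iff in_hom_def intro!: F2_Id2)
qed

lemma push_fun_Cmp:
  assumes "composable (Enrcat B) g f"
  shows "push_fun D F (g \<odot>\<^bsub>Enrcat B\<^esub> f) = push_fun D F g \<odot>\<^bsub>Enrcat D\<^esub> push_fun D F f"
proof -
  note * = Enrcat_Cmp_eq[OF assms]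
  interpret f: enriched_functor B "source f" "target f" "via f" by (rule Enrcat_MorD(3)[OF *(3)])
  interpret g: enriched_functor B "target f" "target g" "via g" using Enrcat_MorD(3)[OF *(2)] * by simp
  have fo [simp]: "fob (via f) c \<in> ob (target f)" if "c \<in> ob (source f)" for c
    using f.fob_type that by auto
  have c: "composable (Enrcat D) (push_fun D F g) (push_fun D F f)"
    using * by (simp add: composable_def push_fun_Mor)
  have "F2 F (fhom (via g) (fob (via f) c) (fob (via f) c') \<cdot>\<^bsub>B\<^esub> fhom (via f) c c') =
      F2 F (fhom (via g) (fob (via f) c) (fob (via f) c')) \<cdot>\<^bsub>D\<^esub> F2 F (fhom (via f) c c')"
    if "c \<in> ob (source f)" "c' \<in> ob (source f)" for c c'
    using that f.fhom_type[OF that] g.fhom_type[of "fob (via f) c" "fob (via f) c'"]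
    by (intro F2_Vcmp) (auto simp: vcomposable_def in_cell_def)
  then show ?thesis
    unfolding Enrcat_Cmp_eq(1)[OF c] *(1)
    using *(4) by (auto simp: Enrcat_Cmp_def push_fun_def Let_def fun_eq_iff)
qed

lemma two_functor_Enr_mor:
  assumes "locally_thin B"
  shows "two_functor (Enr_ob B) (Enr_ob D) (via (Enr_mor (Arrow B F D)))"
proof -
  interpret B: thin_bicategory B using assms by unfold_locales
  show ?thesis
    unfolding Enr_mor_def Let_def arrow.sel Enr_ob_carriers decode_cat_def decode_fun_def decode_nat_def
    unfolding Enr_ob_def Enrcat_sel(1,2)[symmetric]
    by (rule thin_transport_functor[OF B.transported_Enrcat D.transported_Enrcat
          locally_thin_Enrcat[OF D.thin]])
      (auto simp: push_cat_enriched push_fun_Mor push_nat_Cel push_fun_Id1 push_fun_Cmp in_hom_def Enrcat_MorD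
       simp del: Enrcat_sel(3))
qed

end

section \<open>The ambient 2-categories\<close>

lemma BICAT_sel [simp]:
  "Ob BICAT = {B. bicategory B \<and> large (Ob B) \<and> large (Mor B) \<and> large (Cel B)}"
  "Mor BICAT = BICAT_Mor"
  "F \<in> BICAT_Mor \<Longrightarrow> Src BICAT F = source F" "F \<in> BICAT_Mor \<Longrightarrow> Tgt BICAT F = target F"
  by (simp_all add: BICAT_def)

lemma BICAT_Cmp_eq:
  assumes "G \<in> BICAT_Mor" "F \<in> BICAT_Mor" "source G = target F"
  shows "G \<odot>\<^bsub>BICAT\<^esub> F = BICAT_Cmp G F"
  using assms by (simp add: BICAT_def composable_def)

lemma CAT2_sel [simp]:
  "Ob CAT2 = {K. two_category K \<and> large (Ob K) \<and> large (Mor K) \<and> large (Cel K)}"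
  "Mor CAT2 = CAT2_Mor"
  "F \<in> CAT2_Mor \<Longrightarrow> Src CAT2 F = source F" "F \<in> CAT2_Mor \<Longrightarrow> Tgt CAT2 F = target F"
  by (simp_all add: CAT2_def)

lemma CAT2_Id1: "K \<in> Ob CAT2 \<Longrightarrow> Id1 CAT2 K = Arrow K (id_twofun K) K"
  by (simp add: CAT2_def)

lemma CAT2_Cmp_eq:
  assumes "G \<in> CAT2_Mor" "F \<in> CAT2_Mor" "source G = target F"
  shows "G \<odot>\<^bsub>CAT2\<^esub> F = CAT2_Cmp G F"
  using assms by (simp add: CAT2_def composable_def)

lemma CAT2_MorI:
  "K \<in> Ob CAT2 \<Longrightarrow> L \<in> Ob CAT2 \<Longrightarrow> two_functor K L F \<Longrightarrow> Arrow K F L \<in> CAT2_Mor"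
  by (simp add: CAT2_Mor_def)

lemma CAT2_Cmp_Mor:
  assumes "G \<in> CAT2_Mor" "F \<in> CAT2_Mor" "source G = target F"
  shows "CAT2_Cmp G F \<in> CAT2_Mor"
proof -
  obtain K F' L G' M where *: "F = Arrow K F' L" "G = Arrow L G' M"
    "K \<in> Ob CAT2" "L \<in> Ob CAT2" "M \<in> Ob CAT2" "two_functor K L F'" "two_functor L M G'"
    using assms by (auto simp: CAT2_Mor_def)
  then show ?thesis
    using comp_two_functor[OF *(6,7)] by (auto simp: CAT2_Cmp_def intro!: CAT2_MorI)
qed

lemma slice_sel [simp]:
  "Ob (slice L Z) = {p \<in> Mor L. Tgt L p = Z}" "Mor (slice L Z) = slice_Mor L Z"
  "u \<in> slice_Mor L Z \<Longrightarrow> Src (slice L Z) u = source u"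
  "u \<in> slice_Mor L Z \<Longrightarrow> Tgt (slice L Z) u = target u"
  "p \<in> Mor L \<Longrightarrow> Tgt L p = Z \<Longrightarrow> Id1 (slice L Z) p = Arrow p (Id1 L (Src L p)) p"
  by (simp_all add: slice_def)

lemma slice_Cmp:
  "composable (slice L Z) v u \<Longrightarrow>
    v \<odot>\<^bsub>slice L Z\<^esub> u = Arrow (source u) (via v \<odot>\<^bsub>L\<^esub> via u) (target v)"
  by (simp add: slice_def)

lemma slice_Cmp_undefined: "\<not> composable (slice L Z) v u \<Longrightarrow> v \<odot>\<^bsub>slice L Z\<^esub> u = undefined"
  unfolding slice_def by (simp add: tidy_ext)

lemma (in thin_bicategory) Enr_ob_CAT2:
  "large (Ob B) \<Longrightarrow> large (Mor B) \<Longrightarrow> large (Cel B) \<Longrightarrow> Enr_ob B \<in> Ob CAT2"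
  using two_category_Enr_ob large_Enr_ob[of B] by simp

section \<open>The terminal bicategory\<close>

abbreviation pt :: "'v::universe_pair" where "pt \<equiv> vset {}"

lemma one_sel [simp]:
  "Ob one_bicat = {pt}" "Mor one_bicat = {pt}" "Cel one_bicat = {pt}"
  "Src one_bicat pt = pt" "Tgt one_bicat pt = pt" "Dom one_bicat pt = pt" "Cod one_bicat pt = pt"
  "Id1 one_bicat pt = pt" "Id2 one_bicat pt = pt"
  "pt \<odot>\<^bsub>one_bicat\<^esub> pt = pt" "pt \<cdot>\<^bsub>one_bicat\<^esub> pt = pt" "pt \<star>\<^bsub>one_bicat\<^esub> pt = pt"
  "Asc one_bicat pt pt pt = pt" "Lun one_bicat pt = pt" "Run one_bicat pt = pt"
  by (simp_all add: one_bicat_def Let_def)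

lemma one_rel [simp]:
  "in_hom one_bicat f a b \<longleftrightarrow> f = pt \<and> a = pt \<and> b = pt"
  "in_cell one_bicat \<alpha> f g \<longleftrightarrow> \<alpha> = pt \<and> f = pt \<and> g = pt"
  "composable one_bicat g f \<longleftrightarrow> g = pt \<and> f = pt"
  "vcomposable one_bicat \<beta> \<alpha> \<longleftrightarrow> \<beta> = pt \<and> \<alpha> = pt"
  "hcomposable one_bicat \<beta> \<alpha> \<longleftrightarrow> \<beta> = pt \<and> \<alpha> = pt"
  by (auto simp: in_hom_def in_cell_def composable_def vcomposable_def hcomposable_def)

lemma thin_bicategory_one: "thin_bicategory one_bicat"
  by unfold_locales
    (auto simp: locally_thin_def inverse_cell_def, auto simp: one_bicat_def Let_def)

lemma one_Ob_BICAT: "one_bicat \<in> Ob BICAT"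
  by (simp add: large_singleton thin_bicategory.axioms(1)[OF thin_bicategory_one])

lemma bang_one:
  fixes B :: "'v::universe_pair bcy"
  assumes B: "B \<in> Ob BICAT"
  obtains F where "bang BICAT one_bicat B = Arrow B F one_bicat" "lax_functor B one_bicat F"
    "Arrow B F one_bicat \<in> BICAT_Mor"
proof -
  interpret B: bicategory B using B by simp
  define F :: "'v lfun" where "F = \<lparr>F0 = (\<lambda>a\<in>Ob B. pt), F1 = (\<lambda>f\<in>Mor B. pt), F2 = (\<lambda>\<alpha>\<in>Cel B. pt),
    FCmp = (\<lambda>g f. if composable B g f then pt else undefined), FId = (\<lambda>a\<in>Ob B. pt)\<rparr>"
  have *: "composable B (Dom B \<beta>) (Dom B \<alpha>)" "composable B (Cod B \<beta>) (Cod B \<alpha>)"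
    if "hcomposable B \<beta> \<alpha>" for \<beta> \<alpha>
    using that B.dom_cod[of \<alpha>] B.dom_cod[of \<beta>] by (auto simp: hcomposable_def composable_def)
  have t: "f \<in> Mor B \<Longrightarrow> composable B (Id1 B (Tgt B f)) f" "f \<in> Mor B \<Longrightarrow> composable B f (Id1 B (Src B f))"
    "composable B h g \<Longrightarrow> composable B g f \<Longrightarrow> composable B (h \<odot>\<^bsub>B\<^esub> g) f"
    "composable B h g \<Longrightarrow> composable B g f \<Longrightarrow> composable B h (g \<odot>\<^bsub>B\<^esub> f)" for f g h
    using B.Cmp_type[of h g] B.Cmp_type[of g f] B.src_tgt[of f]
    by (auto simp: composable_def in_hom_def)
  have m: "composable B g f \<Longrightarrow> f \<in> Mor B" "composable B g f \<Longrightarrow> g \<in> Mor B"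
    "composable B g f \<Longrightarrow> g \<odot>\<^bsub>B\<^esub> f \<in> Mor B"
    "vcomposable B \<beta> \<alpha> \<Longrightarrow> \<alpha> \<in> Cel B" "vcomposable B \<beta> \<alpha> \<Longrightarrow> \<beta> \<in> Cel B"
    "vcomposable B \<beta> \<alpha> \<Longrightarrow> \<beta> \<cdot>\<^bsub>B\<^esub> \<alpha> \<in> Cel B"
    "hcomposable B \<beta> \<alpha> \<Longrightarrow> \<alpha> \<in> Cel B" "hcomposable B \<beta> \<alpha> \<Longrightarrow> \<beta> \<in> Cel B"
    "hcomposable B \<beta> \<alpha> \<Longrightarrow> \<beta> \<star>\<^bsub>B\<^esub> \<alpha> \<in> Cel B" 
    "composable B h g \<Longrightarrow> composable B g f \<Longrightarrow> Asc B h g f \<in> Cel B"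
    "f \<in> Mor B \<Longrightarrow> Lun B f \<in> Cel B" "f \<in> Mor B \<Longrightarrow> Run B f \<in> Cel B"
    "f \<in> Mor B \<Longrightarrow> Id2 B f \<in> Cel B" for f g h \<alpha> \<beta>
    using in_homD(1)[OF B.Cmp_type] in_cellD(1)[OF B.Vcmp_type] in_cellD(1)[OF B.Hcmp_type]
      in_cellD(1)[OF B.Asc_type] in_cellD(1)[OF B.Lun_type] in_cellD(1)[OF B.Run_type]
      in_cellD(1)[OF B.Id2_type]
    by (auto simp: composable_def vcomposable_def hcomposable_def)
  have F: "lax_functor B one_bicat F"
    by unfold_locales (use * t m B.dom_cod B.src_tgt in \<open>simp_all add: F_def\<close>)
  have u: "G = F" if "lax_functor B one_bicat G" for G
  proof -
    interpret G: lax_functor B one_bicat G by fact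
    have "F0 G = F0 F" using G.F0_type by (auto simp: F_def fun_eq_iff PiE_def extensional_def)
    moreover have "F1 G = F1 F"
      using G.F1_extensional G.F1_type by (intro extensionalityI[of _ "Mor B"]) (auto simp: F_def)
    moreover have "F2 G = F2 F"
      using G.F2_extensional G.F2_type by (intro extensionalityI[of _ "Cel B"]) (auto simp: F_def)
    moreover have "FCmp G = FCmp F"
      using G.FCmp_extensional G.FCmp_type by (auto simp: F_def fun_eq_iff)
    moreover have "FId G = FId F"
      using G.FId_extensional G.FId_type by (intro extensionalityI[of _ "Ob B"]) (auto simp: F_def)
    ultimately show ?thesis by (intro laxfun.equality) simp_all
  qed
  have M: "Arrow B F one_bicat \<in> BICAT_Mor"
    using B one_Ob_BICAT F by (simp add: BICAT_Mor_def)
  have "bang BICAT one_bicat B = Arrow B F one_bicat"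
    unfolding bang_def
  proof (rule the_equality)
    show "in_hom BICAT (Arrow B F one_bicat) B one_bicat" using M by (simp add: in_hom_def)
    fix G assume "in_hom BICAT G B one_bicat"
    then have "G \<in> BICAT_Mor" "source G = B" "target G = one_bicat" by (auto simp: in_hom_def)
    then show "G = Arrow B F one_bicat" using u by (auto simp: BICAT_Mor_def)
  qed
  then show thesis using F M that by blast
qed

lemma Enr_mor_ends [simp]: "source (Enr_mor F) = Enr_ob (source F)" "target (Enr_mor F) = Enr_ob (target F)"
  by (simp_all add: Enr_mor_def Let_def)

lemma Enr_mor_CAT2:
  assumes "B \<in> Ob BICAT" "locally_thin B" "D \<in> Ob BICAT" "locally_thin D" "lax_functor B D F"
  shows "Enr_mor (Arrow B F D) \<in> CAT2_Mor"
proof -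
  interpret F: lax_functor B D F by fact
  interpret B: thin_bicategory B using assms by (simp add: thin_bicategory_def thin_bicategory_axioms_def)
  interpret D: thin_bicategory D using assms by (simp add: thin_bicategory_def thin_bicategory_axioms_def)
  interpret thin_change_of_base B D F ..
  have "Arrow (Enr_ob B) (via (Enr_mor (Arrow B F D))) (Enr_ob D) \<in> CAT2_Mor"
    using assms B.Enr_ob_CAT2 D.Enr_ob_CAT2 by (intro CAT2_MorI two_functor_Enr_mor) simp_all
  then show ?thesis by (simp add: Enr_mor_def Let_def)
qed

section \<open>The 2-category of sets\<close>

abbreviation Set_raw :: "('v::universe_pair, 'v set_mor, 'v set_cel) twocat"
  where "Set_raw \<equiv> \<lparr>
    Ob = elts small_universe,
    Mor = Set_Mor,
    Cel = {Arrow f () g | f g. f \<in> Set_Mor \<and> g \<in> Set_Mor \<and>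
      source f = source g \<and> target f = target g},
    Src = source, Tgt = target, Dom = source, Cod = target,
    Id1 = (\<lambda>X. Arrow X (restrict id (elts X)) X),
    Id2 = (\<lambda>f. Arrow f () f),
    Cmp = Set_Cmp,
    Vcmp = (\<lambda>\<beta> \<alpha>. Arrow (source \<alpha>) () (target \<beta>)),
    Hcmp = (\<lambda>\<beta> \<alpha>. Arrow (Set_Cmp (source \<beta>) (source \<alpha>)) () (Set_Cmp (target \<beta>) (target \<alpha>)))\<rparr>"

lemma Set_MorD:
  assumes "f \<in> Set_Mor"
  shows "source f \<in> U1" "target f \<in> U1" "via f \<in> elts (source f) \<rightarrow>\<^sub>E elts (target f)"
  using assms by (auto simp: Set_Mor_def)

lemma Set_Cmp_Mor:
  "g \<in> Set_Mor \<Longrightarrow> f \<in> Set_Mor \<Longrightarrow> source g = target f \<Longrightarrow> Set_Cmp g f \<in> Set_Mor"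
  by (auto simp: Set_Mor_def Set_Cmp_def compose_def PiE_def Pi_def)

lemma Set_Cmp_ends [simp]: "source (Set_Cmp g f) = source f" "target (Set_Cmp g f) = target g"
  by (simp_all add: Set_Cmp_def)

lemma locally_thin_Set: "locally_thin (tidy Set_raw)"
  unfolding tidy_rel by (auto simp: locally_thin_def)

lemma two_category_Set: "two_category (tidy Set_raw)"
proof (rule thin_two_category, goal_cases)
  case 1 then show ?case using locally_thin_Set unfolding tidy_rel .
next
  case (2 f) then show ?case by (auto simp: Set_MorD)
next
  case (4 X) then show ?case by (auto simp: in_hom_def Set_Mor_def)
next
  case (6 g f) then show ?case by (auto simp: in_hom_def composable_def intro: Set_Cmp_Mor)
next
  case (8 \<beta> \<alpha>) then show ?case by (auto simp: in_cell_def hcomposable_def intro!: Set_Cmp_Mor)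
next
  case (9 h g f)
  then show ?case
    using Set_MorD(3)[of f] Set_MorD(3)[of g]
    by (auto simp: composable_def Set_Cmp_def compose_def fun_eq_iff PiE_def Pi_def)
next
  case (10 f)
  then show ?case
    using Set_MorD(3)[of f]
    by (auto simp: Set_Cmp_def compose_def fun_eq_iff PiE_def extensional_def intro!: arrow.expand)
qed (auto simp: in_cell_def vcomposable_def)

lemma code_map_eqD:
  assumes "f \<in> Set_Mor" "g \<in> Set_Mor" "code_map f = code_map g" shows "f = g"
proof -
  have s: "source f = source g" "target f = target g" using assms by (auto simp: code_map_def)
  have "via f x = via g x" if "x \<in> elts (source f)" for x
    using assms(3) graph_eqD[OF _ large_elts that] by (simp add: code_map_def s)
  then have "via f = via g"
    using Set_MorD(3)[OF assms(1)] Set_MorD(3)[OF assms(2)]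
    by (intro extensionalityI[of _ "elts (source f)"]) (auto simp: s PiE_def)
  then show ?thesis using s by (simp add: arrow.expand)
qed

lemma transported_Set: "transported (tidy Set_raw) id code_map code_parallel"
proof -
  have "inj_on code_parallel (Cel Set_raw)"
    using code_map_eqD by (auto simp: inj_on_def code_parallel_def)
  moreover have "inj_on code_map Set_Mor" using code_map_eqD by (rule inj_onI)
  ultimately show ?thesis
    using two_category_Set by (simp add: transported_def transported_axioms_def)
qed

lemma Set_lc_CAT2: "(Set_lc :: 'v::universe_pair tcat) \<in> Ob CAT2"
proof -
  define Y :: "'v set" where "Y = Times U1 (Times (Powerset (Times U1 U1)) U1)"
  have Y: "large Y" unfolding Y_def by (intro large_Times large_Powerset large_U1)
  have m: "code_map f \<in> Y" if f: "f \<in> Set_Mor" for f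
    unfolding code_map_def Y_def vpair_in_Times
    using Set_MorD[OF f] small_transitive[OF Set_MorD(1)[OF f]] small_transitive[OF Set_MorD(2)[OF f]]
    by (intro conjI graph_in_Powerset large_U1) auto
  have c: "code_parallel \<alpha> \<in> Times Y Y" if "\<alpha> \<in> Cel Set_raw" for \<alpha>
    using that m by (auto simp: code_parallel_def)
  have "two_category (Set_lc :: 'v tcat)"
    unfolding Set_lc_def by (rule transported.two_category_transport[OF transported_Set locally_thin_Set])
  moreover have "large (Ob (Set_lc :: 'v tcat))" by (simp add: Set_lc_def)
  moreover have "large (Mor (Set_lc :: 'v tcat))"
    by (rule large_mono[OF Y]) (use m in \<open>auto simp: Set_lc_def\<close>)
  moreover have "large (Cel (Set_lc :: 'v tcat))"
    by (rule large_mono[OF large_Times[OF Y Y]]) (use c in \<open>auto simp: Set_lc_def\<close>)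
  ultimately show ?thesis by simp
qed

lemma Enr_one_to_Set_ends [simp]:
  "source Enr_one_to_Set = Enr_ob one_bicat" "target Enr_one_to_Set = Set_lc"
  by (simp_all add: Enr_one_to_Set_def)

lemma underlying_map_Mor:
  assumes f: "f \<in> Enrcat_Mor B" shows "underlying_map f \<in> Set_Mor"
proof -
  interpret f: enriched_functor B "source f" "target f" "via f" by (rule Enrcat_MorD(3)[OF f])
  show ?thesis
    using f.fob_type enriched_category_ob[OF Enrcat_MorD(1)[OF f]] enriched_category_ob[OF Enrcat_MorD(2)[OF f]]
    by (auto simp: underlying_map_def Set_Mor_def vset_small elts_vset)
qed

lemma underlying_map_ends [simp]:
  "source (underlying_map f) = vset (ob (source f))" "target (underlying_map f) = vset (ob (target f))"
  by (simp_all add: underlying_map_def)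

lemma Enr_one_CAT2: "Enr_ob one_bicat \<in> Ob CAT2"
  by (intro thin_bicategory.Enr_ob_CAT2 thin_bicategory_one) (simp_all add: large_singleton)

lemma Enr_one_to_Set_CAT2: "(Enr_one_to_Set :: 'v::universe_pair CAT2_mor) \<in> CAT2_Mor"
proof -
  interpret one: thin_bicategory "one_bicat :: 'v bcy" by (rule thin_bicategory_one)
  let ?E = "Enrcat (one_bicat :: 'v bcy)"
  let ?F = "\<lparr>F0 = (\<lambda>x\<in>code_cat ` Ob ?E. id (vset (ob (inv_into (Ob ?E) code_cat x)))),
     F1 = (\<lambda>x\<in>code_fun ` Mor ?E. code_map (underlying_map (inv_into (Mor ?E) code_fun x))),
     F2 = (\<lambda>x\<in>code_nat ` Cel ?E. code_parallel (Arrow (underlying_map (source (inv_into (Cel ?E) code_nat x)))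
       () (underlying_map (target (inv_into (Cel ?E) code_nat x)))))\<rparr>"
  have "two_functor (transport code_cat code_fun code_nat ?E)
      (transport id code_map code_parallel (tidy Set_raw)) ?F"
  proof (rule thin_transport_functor[OF one.transported_Enrcat transported_Set locally_thin_Set,
      where ?H0.0 = "\<lambda>C. vset (ob C)" and ?H1.0 = underlying_map
        and ?H2.0 = "\<lambda>\<alpha>. Arrow (underlying_map (source \<alpha>)) () (underlying_map (target \<alpha>))"], goal_cases)
    case (1 C) then show ?case by (simp add: enriched_category_ob vset_small)
  next
    case (2 f) then show ?case by (simp add: in_hom_def underlying_map_Mor)
  next
    case (3 \<alpha>) 
    then have "\<alpha> \<in> Cel ?E" "source \<alpha> \<in> Enrcat_Mor one_bicat" "target \<alpha> \<in> Enrcat_Mor one_bicat"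
      "source (source \<alpha>) = source (target \<alpha>)" "target (source \<alpha>) = target (target \<alpha>)" by auto
    then show ?case by (simp add: in_cell_def underlying_map_Mor del: Enrcat_sel)
  next
    case (4 C) then show ?case
      by (simp add: Enrcat_Id1 underlying_map_def enriched_category_ob vset_small elts_vset)
  next
    case (5 g f)
    note * = Enrcat_Cmp_eq[OF 5]
    have "composable (tidy Set_raw) (underlying_map g) (underlying_map f)"
      using * by (simp add: composable_def underlying_map_Mor)
    then show ?case
      unfolding *(1) using enriched_category_ob[OF Enrcat_MorD(1)[OF *(3)]]
      by (simp add: underlying_map_def Set_Cmp_def Enrcat_Cmp_def Let_def elts_vset)
  qed
  moreover have "?F = via (Enr_one_to_Set :: 'v CAT2_mor)"
    unfolding Enr_one_to_Set_def Let_def arrow.sel Enr_ob_carriers decode_cat_def decode_fun_def decode_nat_def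
      Enrcat_sel(1,2)[symmetric] id_apply ..
  ultimately have "two_functor (Enr_ob one_bicat) Set_lc (via (Enr_one_to_Set :: 'v CAT2_mor))"
    unfolding Enr_ob_def Set_lc_def by metis
  then have "Arrow (Enr_ob one_bicat) (via (Enr_one_to_Set :: 'v CAT2_mor)) Set_lc \<in> CAT2_Mor"
    by (intro CAT2_MorI Enr_one_CAT2 Set_lc_CAT2)
  then show ?thesis by (simp add: Enr_one_to_Set_def)
qed


section \<open>Changes of base that agree on homs\<close>

text \<open>
  All remaining data of a category, functor or transformation obtained by change of base are
  2-cells of a locally thin bicategory, with boundaries made from extents and homs.
\<close>

lemma Enr_mor_eqI:
  assumes F: "thin_change_of_base B D F" and G: "thin_change_of_base B D G"
    and F0: "F0 F = F0 G"
    and hom: "\<And>C c c'. enriched_category B C \<Longrightarrow> c \<in> ob C \<Longrightarrow> c' \<in> ob C \<Longrightarrow>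
      F1 F (hom C c c') = F1 G (hom C c c')"
  shows "Enr_mor (Arrow B F D) = Enr_mor (Arrow B G D)"
proof -
  interpret F: thin_change_of_base B D F by fact
  interpret G: thin_change_of_base B D G by fact
  note eqI = F.D.eqI
  have cat: "push_cat D F C = push_cat D G C" if C: "enriched_category B C" for C
  proof -
    interpret FC: enriched_category D "push_cat D F C" by (rule F.push_cat_enriched[OF C])
    interpret GC: enriched_category D "push_cat D G C" by (rule G.push_cat_enriched[OF C])
    have e: "ext (push_cat D F C) = ext (push_cat D G C)" by (simp add: push_cat_def F0)
    have h: "Defs.hom (push_cat D F C) = Defs.hom (push_cat D G C)"
      using hom[OF C] by (auto simp: push_cat_def fun_eq_iff)
    have u: "unt (push_cat D F C) = unt (push_cat D G C)"
      using FC.unt_extensional GC.unt_extensional FC.unt_type GC.unt_type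
      by (intro extensionalityI[of _ "ob C"]) (auto simp: e h intro: eqI)
    have "mul (push_cat D F C) c0 c1 c2 = mul (push_cat D G C) c0 c1 c2" for c0 c1 c2
      using FC.mul_extensional[of c0 c1 c2] GC.mul_extensional[of c0 c1 c2]
        eqI[OF FC.mul_type[of c0 c1 c2] GC.mul_type[of c0 c1 c2, folded h]]
      by (cases "c0 \<in> ob C \<and> c1 \<in> ob C \<and> c2 \<in> ob C") auto
    then have m: "mul (push_cat D F C) = mul (push_cat D G C)" by blast
    show ?thesis by (rule enrcat.equality) (simp_all add: e h u m)
  qed
  have "fun": "push_fun D F f = push_fun D G f" if f: "f \<in> Enrcat_Mor B" for f
  proof -
    note C = Enrcat_MorD(1)[OF f] and C' = Enrcat_MorD(2)[OF f]
    interpret f: enriched_functor B "source f" "target f" "via f" by (rule Enrcat_MorD(3)[OF f])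
    have "F2 F (fhom (via f) c c') = F2 G (fhom (via f) c c')"
      if "c \<in> ob (source f)" "c' \<in> ob (source f)" for c c'
    proof -
      have "fob (via f) c \<in> ob (target f)" "fob (via f) c' \<in> ob (target f)"
        using f.fob_type that by auto
      then show ?thesis
        using F.F2_in_cell[OF f.fhom_type[OF that]] G.F2_in_cell[OF f.fhom_type[OF that]]
          hom[OF C that] hom[OF C'] by (auto intro: eqI)
    qed
    then show ?thesis by (auto simp: push_fun_def Let_def cat[OF C] cat[OF C'] fun_eq_iff)
  qed
  have nat: "push_nat D F \<alpha> = push_nat D G \<alpha>" if \<alpha>: "\<alpha> \<in> Cel (Enrcat B)" for \<alpha>
  proof -
    have "source \<alpha> \<in> Enrcat_Mor B" "target \<alpha> \<in> Enrcat_Mor B" using \<alpha> by auto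
    then show ?thesis
      using F.push_nat_Cel[OF \<alpha>] G.push_nat_Cel[OF \<alpha>] thin_eqI[OF locally_thin_Enrcat[OF F.D.thin]]
      by (simp add: "fun")
  qed
  have d: "decode_cat B x \<in> Ob (Enrcat B)" if "x \<in> Ob (Enr_ob B)" for x
    using that by (auto simp: decode_cat_def Enr_ob_def simp del: Enrcat_sel intro: inv_into_into)
  have d': "decode_fun B x \<in> Mor (Enrcat B)" if "x \<in> Mor (Enr_ob B)" for x
    using that by (auto simp: decode_fun_def Enr_ob_def simp del: Enrcat_sel intro: inv_into_into)
  have d'': "decode_nat B x \<in> Cel (Enrcat B)" if "x \<in> Cel (Enr_ob B)" for x
    using that by (auto simp: decode_nat_def Enr_ob_def simp del: Enrcat_sel intro: inv_into_into)
  show ?thesis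
    unfolding Enr_mor_def Let_def
    using d d' d'' by (auto simp: cat "fun" nat fun_eq_iff simp del: Enrcat_sel(3))
qed

section \<open>Bicategories of words\<close>

definition word :: "bool list \<Rightarrow> 'v::universe_pair" where "word = enc"
definition unword :: "'v::universe_pair \<Rightarrow> bool list" where "unword = dec"
definition cell :: "bool list \<Rightarrow> bool list \<Rightarrow> 'v::universe_pair" where "cell u v = enc (u, v)"
definition cdom :: "'v::universe_pair \<Rightarrow> bool list" where "cdom \<alpha> = fst (dec \<alpha> :: bool list \<times> bool list)"
definition ccod :: "'v::universe_pair \<Rightarrow> bool list" where "ccod \<alpha> = snd (dec \<alpha> :: bool list \<times> bool list)"

lemma word_simps [simp]:
  "word u = word v \<longleftrightarrow> u = v" "unword (word u) = u"
  "cell u v = cell u' v' \<longleftrightarrow> u = u' \<and> v = v'" "cdom (cell u v) = u" "ccod (cell u v) = v"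
  by (simp_all add: word_def unword_def cell_def cdom_def ccod_def)

definition word_bicat ::
  "'v::universe_pair \<Rightarrow> (bool list \<Rightarrow> bool list \<Rightarrow> bool) \<Rightarrow> 'v bcy"
  where "word_bicat x le = (let M = range word; C = {cell u v | u v. le u v} in
    \<lparr>Ob = {x}, Mor = M, Cel = C, Src = (\<lambda>f\<in>M. x), Tgt = (\<lambda>f\<in>M. x),
     Dom = (\<lambda>\<alpha>\<in>C. word (cdom \<alpha>)), Cod = (\<lambda>\<alpha>\<in>C. word (ccod \<alpha>)),
     Id1 = (\<lambda>a\<in>{x}. word []), Id2 = (\<lambda>f\<in>M. cell (unword f) (unword f)),
     Cmp = (\<lambda>g f. if g \<in> M \<and> f \<in> M then word (unword g @ unword f) else undefined),
     Vcmp = (\<lambda>\<beta> \<alpha>. if \<beta> \<in> C \<and> \<alpha> \<in> C \<and> cdom \<beta> = ccod \<alpha> then cell (cdom \<alpha>) (ccod \<beta>) else undefined),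
     Hcmp = (\<lambda>\<beta> \<alpha>. if \<beta> \<in> C \<and> \<alpha> \<in> C
       then cell (cdom \<beta> @ cdom \<alpha>) (ccod \<beta> @ ccod \<alpha>) else undefined),
     Asc = (\<lambda>h g f. if h \<in> M \<and> g \<in> M \<and> f \<in> M
       then let w = unword h @ unword g @ unword f in cell w w else undefined),
     Lun = (\<lambda>f\<in>M. cell (unword f) (unword f)), Run = (\<lambda>f\<in>M. cell (unword f) (unword f))\<rparr>)"

lemma word_bicat_sel [simp]:
  "Ob (word_bicat x le) = {x}" "Mor (word_bicat x le) = range word"
  "Cel (word_bicat x le) = {cell u v | u v. le u v}"
  "Src (word_bicat x le) (word u) = x" "Tgt (word_bicat x le) (word u) = x"
  "le u v \<Longrightarrow> Dom (word_bicat x le) (cell u v) = word u"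
  "le u v \<Longrightarrow> Cod (word_bicat x le) (cell u v) = word v"
  "Id1 (word_bicat x le) x = word []" "Id2 (word_bicat x le) (word u) = cell u u"
  "word v \<odot>\<^bsub>word_bicat x le\<^esub> word u = word (v @ u)"
  "le u v \<Longrightarrow> le v w \<Longrightarrow> cell v w \<cdot>\<^bsub>word_bicat x le\<^esub> cell u v = cell u w"
  "le u u' \<Longrightarrow> le v v' \<Longrightarrow> cell v v' \<star>\<^bsub>word_bicat x le\<^esub> cell u u' = cell (v @ u) (v' @ u')"
  "Asc (word_bicat x le) (word w) (word v) (word u) = cell (w @ v @ u) (w @ v @ u)"
  "Lun (word_bicat x le) (word u) = cell u u" "Run (word_bicat x le) (word u) = cell u u"
  by (auto simp: word_bicat_def Let_def)

lemma word_in_hom [simp]: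
  "in_hom (word_bicat x le) f a b \<longleftrightarrow> (\<exists>u. f = word u) \<and> a = x \<and> b = x"
  by (auto simp: in_hom_def)

lemma word_in_cell [simp]:
  "in_cell (word_bicat x le) \<alpha> f g \<longleftrightarrow> (\<exists>u v. \<alpha> = cell u v \<and> f = word u \<and> g = word v \<and> le u v)"
  by (auto simp: in_cell_def)

lemma word_composable:
  "composable (word_bicat x le) g f \<longleftrightarrow> (\<exists>u v. g = word v \<and> f = word u)"
  "vcomposable (word_bicat x le) \<beta> \<alpha> \<longleftrightarrow> (\<exists>u v w. \<beta> = cell v w \<and> \<alpha> = cell u v \<and> le u v \<and> le v w)"
  "hcomposable (word_bicat x le) \<beta> \<alpha> \<longleftrightarrow>
    (\<exists>u u' v v'. \<beta> = cell v v' \<and> \<alpha> = cell u u' \<and> le u u' \<and> le v v')"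
  by (auto simp: composable_def vcomposable_def hcomposable_def)

text \<open>A monoidal preorder on words is all that is needed, since concatenation is strictly associative.\<close>

locale word_preorder =
  fixes le :: "bool list \<Rightarrow> bool list \<Rightarrow> bool"
  assumes le_refl [simp]: "le u u"
    and le_trans: "le u v \<Longrightarrow> le v w \<Longrightarrow> le u w"
    and le_append: "le u u' \<Longrightarrow> le v v' \<Longrightarrow> le (u @ v) (u' @ v')"
begin

lemma thin_bicategory_word: "thin_bicategory (word_bicat x le)"
proof -
  have cs: "cell_structure (word_bicat x le)"
  proof (rule thin_cell_structure, goal_cases)
    case 1 then show ?case by (auto simp: locally_thin_def)
  next
    case (7 \<beta> \<alpha>) then show ?case by (auto simp: word_composable intro: le_trans)
  next
    case (8 \<beta> \<alpha>) then show ?case by (auto simp: word_composable intro: le_append)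
  next
    case (15 g f) then show ?case unfolding word_composable by (auto simp: word_bicat_def Let_def)
  next
    case (16 \<beta> \<alpha>) then show ?case unfolding word_composable by (auto simp: word_bicat_def Let_def)
  next
    case (17 \<beta> \<alpha>) then show ?case unfolding word_composable by (auto simp: word_bicat_def Let_def)
  qed (auto simp: word_composable, auto simp: word_bicat_def Let_def)
  have inv: "\<exists>\<beta>. inverse_cell (word_bicat x le) (cell u u) \<beta>" for u
    by (rule exI[of _ "cell u u"]) (simp add: inverse_cell_def)
  show ?thesis
  proof (intro thin_bicategory.intro bicategory.intro cs bicategory_axioms.intro thin_bicategory_axioms.intro, goal_cases)
    case (3 \<gamma> \<beta> \<alpha>)
    then show ?case by (auto simp: word_composable le_append)
  next
    case (6 \<alpha>) then show ?case by auto
  next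
    case (9 \<alpha>) then show ?case by auto
  next
    case (12 h g f) then show ?case unfolding word_composable by (auto simp: word_bicat_def Let_def)
  next
    case 13 show ?case by (auto simp: word_bicat_def Let_def)
  next
    case 14 show ?case by (auto simp: word_bicat_def Let_def)
  next
    case 15 show ?case by (auto simp: locally_thin_def)
  qed (auto simp: word_composable inv)
qed

lemma word_bicat_BICAT: "word_bicat (x :: 'v::universe_pair) le \<in> Ob BICAT"
proof -
  have "large (range (word :: _ \<Rightarrow> 'v))"
    by (rule large_mono[OF large_U1]) (auto simp: word_def)
  moreover have "large {cell u v :: 'v | u v. le u v}"
    by (rule large_mono[OF large_U1]) (auto simp: cell_def)
  ultimately show ?thesis
    by (simp add: large_singleton thin_bicategory.axioms(1)[OF thin_bicategory_word])
qed

end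

abbreviation chaotic :: "bool list \<Rightarrow> bool list \<Rightarrow> bool"
  where "chaotic \<equiv> \<lambda>_ _. True"

interpretation chaotic: word_preorder chaotic
  by unfold_locales simp_all

definition word_lax :: "'v::universe_pair \<Rightarrow> (bool list \<Rightarrow> bool list \<Rightarrow> bool) \<Rightarrow> (bool list \<Rightarrow> bool list) \<Rightarrow> 'v lfun"
  where "word_lax x le h = (let M = range word; C = {cell u v | u v. le u v} in
    \<lparr>F0 = (\<lambda>a\<in>{x}. x), F1 = (\<lambda>f\<in>M. word (h (unword f))),
     F2 = (\<lambda>\<alpha>\<in>C. cell (h (cdom \<alpha>)) (h (ccod \<alpha>))),
     FCmp = (\<lambda>g f. if g \<in> M \<and> f \<in> M
       then cell (h (unword g) @ h (unword f)) (h (unword g @ unword f)) else undefined),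
     FId = (\<lambda>a\<in>{x}. cell [] (h []))\<rparr>)"

lemma word_lax_sel [simp]:
  "F0 (word_lax x le h) = (\<lambda>a\<in>{x}. x)" "F1 (word_lax x le h) (word u) = word (h u)"
  "le u v \<Longrightarrow> F2 (word_lax x le h) (cell u v) = cell (h u) (h v)"
  "FCmp (word_lax x le h) (word v) (word u) = cell (h v @ h u) (h (v @ u))"
  "FId (word_lax x le h) x = cell [] (h [])"
  by (auto simp: word_lax_def Let_def)

text \<open>In the chaotic bicategory the comparison 2-cells exist for every \<open>h\<close>, whether or not \<open>h\<close> is monotone.\<close>

lemma (in word_preorder) lax_functor_word: "lax_functor (word_bicat x le) (word_bicat x chaotic) (word_lax x le h)"
proof (unfold_locales, goal_cases)
  case (7 \<beta> \<alpha>) then show ?case by (auto simp: word_composable le_trans)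
next
  case (12 \<beta> \<alpha>) then show ?case by (auto simp: word_composable le_append)
qed (auto simp: word_composable, auto simp: word_lax_def Let_def)

lemma (in word_preorder) word_lax_Mor:
  "Arrow (word_bicat x le) (word_lax x le h) (word_bicat x chaotic) \<in> BICAT_Mor"
  using word_bicat_BICAT[of x] chaotic.word_bicat_BICAT[of x] lax_functor_word[of x h]
  by (simp add: BICAT_Mor_def)

section \<open>Words acting on the natural numbers\<close>

text \<open>The letter \<^term>\<open>True\<close> rounds up to an even number, \<^term>\<open>False\<close> to an odd one; the last letter acts first.\<close>

primrec act :: "bool list \<Rightarrow> nat \<Rightarrow> nat" where
  "act [] n = n"
| "act (b # w) n = (if even (act w n) = b then act w n else Suc (act w n))"

lemma act_append: "act (u @ v) n = act u (act v n)"
  by (induction u) simp_all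

lemma act_increasing: "n \<le> act w n"
  by (induction w) auto

lemma act_mono: "m \<le> n \<Longrightarrow> act w m \<le> act w n"
proof (induction w)
  case (Cons b w)
  then show ?case by (cases "act w m = act w n") auto
qed simp

definition act_le :: "bool list \<Rightarrow> bool list \<Rightarrow> bool"
  where "act_le u v \<longleftrightarrow> (\<forall>n. act u n \<le> act v n)"

interpretation act_le: word_preorder act_le
proof
  show "act_le (u @ v) (u' @ v')" if "act_le u u'" "act_le v v'" for u u' v v'
    using that act_mono[of "act v n" "act v' n" u for n] order_trans
    unfolding act_le_def act_append by blast
qed (auto simp: act_le_def intro: order_trans)

definition expanding :: "bool list \<Rightarrow> bool"
  where "expanding w \<longleftrightarrow> (\<forall>n. n < act w n)"

lemma expanding_up: "expanding u \<Longrightarrow> act_le u v \<Longrightarrow> expanding v"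
  unfolding expanding_def act_le_def using less_le_trans by blast

lemma expanding_two_letters: "expanding [True, False]"
  by (auto simp: expanding_def)

text \<open>
  With \<open>w\<close> the hom from \<open>c'\<close> to \<open>c\<close>, composing twice gives a 2-cell from \<open>u w u\<close> to \<open>u\<close>. Since every word is
  increasing, \<open>w u 0\<close> is at least \<open>u 0\<close>, and an expanding \<open>u\<close> would move it strictly above \<open>u 0\<close>.
\<close>

lemma hom_not_expanding:
  assumes C: "enriched_category (word_bicat x act_le) C" and c: "c \<in> ob C" "c' \<in> ob C"
    and u: "hom C c c' = word u"
  shows "\<not> expanding u"
proof
  assume e: "expanding u"
  interpret C: enriched_category "word_bicat x act_le" C by fact
  obtain w s where w: "hom C c' c = word w" "hom C c c = word s"
    using C.hom_type[OF c(2,1)] C.hom_type[OF c(1,1)] by auto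
  have "act_le (w @ u) s" using C.mul_type[OF c(1,2,1)] u w by auto
  moreover have "act_le (u @ s) u" using C.mul_type[OF c(1,1,2)] u w by auto
  ultimately have "act u (act (w @ u) 0) \<le> act u 0"
    unfolding act_le_def act_append[of u s] by (meson act_mono order_trans)
  moreover have "act u 0 \<le> act (w @ u) 0" by (simp add: act_append act_increasing)
  moreover have "act (w @ u) 0 < act u (act (w @ u) 0)" using e by (simp add: expanding_def)
  ultimately show False by simp
qed

text \<open>An idempotent word is a monad, here regarded as an enriched category with one object.\<close>

definition monad_cat :: "'v::universe_pair \<Rightarrow> bool list \<Rightarrow> 'v enrcat"
  where "monad_cat x w = (let S = {enc ()} in
    \<lparr>ob = S, ext = (\<lambda>c\<in>S. x), hom = (\<lambda>c c'. if c \<in> S \<and> c' \<in> S then word w else undefined),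
     unt = (\<lambda>c\<in>S. cell [] w),
     mul = (\<lambda>c0 c1 c2. if c0 \<in> S \<and> c1 \<in> S \<and> c2 \<in> S then cell (w @ w) w else undefined)\<rparr>)"

lemma monad_cat_sel [simp]:
  "ob (monad_cat x w) = {enc ()}" "ext (monad_cat x w) (enc ()) = x"
  "hom (monad_cat x w) (enc ()) (enc ()) = word w"
  "unt (monad_cat x w) (enc ()) = cell [] w"
  "mul (monad_cat x w) (enc ()) (enc ()) (enc ()) = cell (w @ w) w"
  by (simp_all add: monad_cat_def Let_def)

lemma act_le_Nil: "act_le [] w"
  by (simp add: act_le_def act_increasing)

lemma monad_cat_enriched:
  assumes "act_le (w @ w) w"
  shows "enriched_category (word_bicat x act_le) (monad_cat x w)"
proof (intro thin_bicategory.enriched_categoryI act_le.thin_bicategory_word, goal_cases)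
  case 1 then show ?case by (simp add: small_singleton)
qed (auto simp: assms act_le_Nil, auto simp: monad_cat_def Let_def)

lemma monad_unit_map:
  assumes w: "act_le (w @ w) w"
  shows "Arrow (monad_cat x []) \<lparr>fob = restrict id {enc ()},
    fhom = (\<lambda>c c'. if c \<in> {enc ()} \<and> c' \<in> {enc ()} then cell [] w else undefined)\<rparr> (monad_cat x w)
    \<in> Enrcat_Mor (word_bicat x act_le)"
  by (intro Enrcat_MorI thin_bicategory.enriched_functorI act_le.thin_bicategory_word monad_cat_enriched w)
    (auto simp: act_le_Nil)

lemma act_le_letter: "act_le ([b] @ [b]) [b]"
  by (auto simp: act_le_def)

section \<open>Sections of a change of base to the bicategory of words\<close>

text \<open>
  Only the action of the section on the one-object categories of the empty word and of the two letters is used,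
  together with the maps from the first to the other two: these maps force the two endomorphisms
  over the letters to have the same source, so that they can be composed.
\<close>

lemma section_expanding:
  fixes D :: "'v::universe_pair bcy" and x :: 'v
  defines "N \<equiv> word_bicat x act_le"
  assumes D: "bicategory D" and E: "lax_functor D N E"
    and H: "two_functor (Enr_ob N) (Enr_ob D) H"
    and sec: "\<And>y. y \<in> Ob (Enr_ob N) \<Longrightarrow> F0 (via (Enr_mor (Arrow D E N))) (F0 H y) = y"
  shows "\<exists>m\<in>Mor D. \<exists>w. F1 E m = word w \<and> expanding w"
proof -
  interpret D: bicategory D by fact
  interpret E: lax_functor D N E by fact
  interpret N: thin_bicategory N unfolding N_def by (rule act_le.thin_bicategory_word)
  interpret thin_change_of_base D N E ..
  interpret H: two_functor "Enr_ob N" "Enr_ob D" H by fact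
  have lift: "\<exists>C. enriched_category D C \<and> code_cat C = F0 H (code_cat (monad_cat x w)) \<and>
      push_cat N E C = monad_cat x w" if w: "act_le (w @ w) w" for w
  proof -
    have m: "enriched_category N (monad_cat x w)" unfolding N_def by (rule monad_cat_enriched[OF w])
    then have y: "code_cat (monad_cat x w) \<in> Ob (Enr_ob N)" by (simp add: Enr_ob_carriers)
    then have z: "F0 H (code_cat (monad_cat x w)) \<in> Ob (Enr_ob D)" using H.F0_type by auto
    define C where "C = decode_cat D (F0 H (code_cat (monad_cat x w)))"
    have C: "enriched_category D C" "code_cat C = F0 H (code_cat (monad_cat x w))"
      using inv_into_into[of _ code_cat "Ob (Enrcat D)"] f_inv_into_f[of _ code_cat "Ob (Enrcat D)"] z
      by (auto simp: C_def decode_cat_def Enr_ob_carriers)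
    have "code_cat (push_cat N E C) = code_cat (monad_cat x w)"
      using sec[OF y] z by (simp add: Enr_mor_def Let_def C_def)
    then show ?thesis using C code_cat_eqD[OF push_cat_enriched[OF C(1)] m] by blast
  qed
  have "\<exists>C0 C. enriched_category D C0 \<and> enriched_category D C \<and> code_cat C0 = F0 H (code_cat (monad_cat x [])) \<and>
     push_cat N E C = monad_cat x w \<and> ob C = {enc ()} \<and>
     ext C (enc ()) = ext C0 (enc ())" if w: "act_le (w @ w) w" for w
  proof -
    obtain C0 C where C0: "enriched_category D C0" "code_cat C0 = F0 H (code_cat (monad_cat x []))"
        "push_cat N E C0 = monad_cat x []"
      and C: "enriched_category D C" "code_cat C = F0 H (code_cat (monad_cat x w))"
        "push_cat N E C = monad_cat x w"
      using lift[of "[]"] lift[OF w] by auto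
    have o: "ob C0 = {enc ()}" "ob C = {enc ()}"
      using arg_cong[OF C0(3), of ob] arg_cong[OF C(3), of ob] by simp_all
    define i :: "'v enr_mor" where "i = Arrow (monad_cat x []) \<lparr>fob = restrict id {enc ()},
      fhom = (\<lambda>c c'. if c \<in> {enc ()} \<and> c' \<in> {enc ()} then cell [] w else undefined)\<rparr> (monad_cat x w)"
    have i: "i \<in> Enrcat_Mor N" unfolding i_def N_def by (rule monad_unit_map[OF w])
    have iE: "code_fun i \<in> Mor (Enr_ob N)" using i by (simp add: Enr_ob_carriers)
    have "Src (Enr_ob N) (code_fun i) = code_cat (monad_cat x [])"
      "Tgt (Enr_ob N) (code_fun i) = code_cat (monad_cat x w)"
      using transported.boundaries(1,2)[OF N.transported_Enrcat, of i] i
      by (simp_all add: Enr_ob_def i_def)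
    then have ih: "in_hom (Enr_ob D) (F1 H (code_fun i)) (code_cat C0) (code_cat C)"
      using H.F1_type[OF iE] C0(2) C(2) by simp
    define f where "f = decode_fun D (F1 H (code_fun i))"
    have f: "f \<in> Enrcat_Mor D" and s: "code_cat (source f) = code_cat C0" "code_cat (target f) = code_cat C"
      using ih inv_into_into[of "F1 H (code_fun i)" code_fun "Enrcat_Mor D"]
      by (auto simp: in_hom_def f_def decode_fun_def Enr_ob_def transport_def Let_def)
    have st: "source f = C0" "target f = C"
      using code_cat_eqD[OF Enrcat_MorD(1)[OF f] C0(1) s(1)] code_cat_eqD[OF Enrcat_MorD(2)[OF f] C(1) s(2)]
      by simp_all
    interpret f: enriched_functor D C0 C "via f" using Enrcat_MorD(3)[OF f] st by simp
    have "fob (via f) (enc ()) = enc ()" using f.fob_type o by auto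
    then have "ext C (enc ()) = ext C0 (enc ())" using f.fob_ext[of "enc ()"] o by simp
    then show ?thesis using C0 C o by blast
  qed
  note mon = this
  obtain A0 A where A: "enriched_category D A0" "enriched_category D A" "code_cat A0 = F0 H (code_cat (monad_cat x []))"
     "push_cat N E A = monad_cat x [True]" "ob A = {enc ()}" "ext A (enc ()) = ext A0 (enc ())"
    using mon[OF act_le_letter[of True]] by blast
  obtain B0 B where B: "enriched_category D B0" "enriched_category D B" "code_cat B0 = F0 H (code_cat (monad_cat x []))"
     "push_cat N E B = monad_cat x [False]" "ob B = {enc ()}" "ext B (enc ()) = ext B0 (enc ())"
    using mon[OF act_le_letter[of False]] by blast
  have "A0 = B0" using code_cat_eqD[OF A(1) B(1)] A(3) B(3) by simp
  then have "ext A (enc ()) = ext B (enc ())" using A(6) B(6) by simp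
  moreover define a where "a = hom A (enc ()) (enc ())"
  moreover define b where "b = hom B (enc ()) (enc ())"
  ultimately have c: "composable D a b"
    using enriched_category.hom_type[OF A(2), of "enc ()" "enc ()"] A(5)
      enriched_category.hom_type[OF B(2), of "enc ()" "enc ()"] B(5)
    by (simp add: composable_def in_hom_def)
  have "F1 E a = word [True]" "F1 E b = word [False]"
    using arg_cong[OF A(4), of "\<lambda>C. hom C (enc ()) (enc ())"] A(5)
      arg_cong[OF B(4), of "\<lambda>C. hom C (enc ()) (enc ())"] B(5)
    by (simp_all add: a_def b_def push_cat_def)
  then obtain w where "F1 E (a \<odot>\<^bsub>D\<^esub> b) = word w" "act_le [True, False] w"
    using E.FCmp_type[OF c] by (auto simp: N_def)
  then show ?thesis
    using expanding_up[OF expanding_two_letters] in_homD(1)[OF D.Cmp_type[OF c]] by blast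
qed

section \<open>Non-existence of the adjoint\<close>

lemma Enr_mor_word_lax:
  assumes "\<And>w. \<not> expanding w \<Longrightarrow> h w = h' w"
  shows "Enr_mor (Arrow (word_bicat x act_le) (word_lax x act_le h) (word_bicat x chaotic)) =
    Enr_mor (Arrow (word_bicat x act_le) (word_lax x act_le h') (word_bicat x chaotic))"
proof -
  have t: "thin_change_of_base (word_bicat x act_le) (word_bicat x chaotic) (word_lax x act_le k)" for k
    by (intro thin_change_of_base.intro act_le.lax_functor_word chaotic.thin_bicategory_word
        thin_bicategory.axioms(1)[OF act_le.thin_bicategory_word])
  show ?thesis
  proof (rule Enr_mor_eqI[OF t t])
    fix C c c' assume C: "enriched_category (word_bicat x act_le) C" "c \<in> ob C" "c' \<in> ob C"
    then obtain u where u: "hom C c c' = word u"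
      using enriched_category.hom_type[OF C] by auto
    then show "F1 (word_lax x act_le h) (hom C c c') = F1 (word_lax x act_le h') (hom C c c')"
      using assms[OF hom_not_expanding[OF C u]] by simp
  qed simp
qed

lemma slice_MorD:
  assumes "u \<in> slice_Mor L Z"
  shows "in_hom L (via u) (Src L (source u)) (Src L (target u))"
  using assms by (auto simp: slice_Mor_def)

lemma CAT2_in_hom: "in_hom CAT2 H K L \<longleftrightarrow> H \<in> CAT2_Mor \<and> source H = K \<and> target H = L"
  by (auto simp: in_hom_def)

text \<open>
  The hypotheses on \<open>R\<close> are shared by the two 2-functors of the theorem. Outside its domain an
  operation has an unspecified value, so \<open>R\<close> might a priori send the counit at \<open>W\<close> to such a value,
  or this image might fail to be composable with the unit. In either case the triangle
  identity at \<open>W\<close>, whose right-hand side is the identity of \<open>R W\<close>, makes \<open>R W\<close> the target of the unspecified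
  arrow. As bicategories of words with distinct objects have distinct images, this can happen for
  at most one choice of the object.
\<close>

lemma no_left_adjoint:
  fixes R :: "('v::universe_pair bcy, 'v BICAT_mor, 'v BICAT_cel, 'v CAT2_mor,
    ('v CAT2_mor, 'v CAT2_mor) arrow, ('v CAT2_mor, 'v CAT2_mor, 'v CAT2_cel) arrow2) twofun"
  assumes R0: "\<And>B. B \<in> Ob BICAT \<Longrightarrow> locally_thin B \<Longrightarrow>
      F0 R B \<in> CAT2_Mor \<and> target (F0 R B) = Z \<and> source (F0 R B) = Enr_ob B"
    and R1: "\<And>F. F \<in> BICAT_Mor \<Longrightarrow> F1 R F = undefined \<or> via (F1 R F) = Enr_mor F"
    and R1_cong: "\<And>F G. F \<in> BICAT_Mor \<Longrightarrow> G \<in> BICAT_Mor \<Longrightarrow> source F = source G \<Longrightarrow>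
      target F = target G \<Longrightarrow> Enr_mor F = Enr_mor G \<Longrightarrow> F1 R F = F1 R G"
  shows "\<not> has_left_two_adjoint BICAT (slice CAT2 Z) R"
proof
  assume "has_left_two_adjoint BICAT (slice CAT2 Z) R"
  then obtain G \<eta> \<epsilon> where
    nat\<eta>: "two_natural (slice CAT2 Z) (slice CAT2 Z) (id_twofun (slice CAT2 Z)) (comp_twofun (slice CAT2 Z) R G) \<eta>"
    and nat\<epsilon>: "two_natural BICAT BICAT (comp_twofun BICAT G R) (id_twofun BICAT) \<epsilon>"
    and tri: "\<And>k. k \<in> Ob BICAT \<Longrightarrow>
      F1 R (\<epsilon> k) \<odot>\<^bsub>slice CAT2 Z\<^esub> \<eta> (F0 R k) = Id1 (slice CAT2 Z) (F0 R k)"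
    unfolding has_left_two_adjoint_def by blast
  interpret \<eta>: two_natural "slice CAT2 Z" "slice CAT2 Z" "id_twofun (slice CAT2 Z)"
    "comp_twofun (slice CAT2 Z) R G" \<eta> by fact
  interpret \<epsilon>: two_natural BICAT BICAT "comp_twofun BICAT G R" "id_twofun BICAT" \<epsilon> by fact
  let ?W = "\<lambda>x :: 'v. word_bicat x act_le"
  have W: "?W x \<in> Ob BICAT" "locally_thin (?W x)" for x
    using act_le.word_bicat_BICAT thin_bicategory.thin[OF act_le.thin_bicategory_word] by blast+
  have inj: "x = y" if "F0 R (?W x) = F0 R (?W y)" for x y
  proof -
    have m: "enriched_category (?W z) (monad_cat z [])" for z
      by (rule monad_cat_enriched) (simp add: act_le_Nil)
    have "Enr_ob (?W x) = Enr_ob (?W y)" using R0[OF W, of x] R0[OF W, of y] that by simp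
    then have "code_cat (monad_cat x []) \<in> Ob (Enr_ob (?W y))"
      using m[of x] by (metis (mono_tags) Enr_ob_carriers(1) imageI mem_Collect_eq)
    then obtain C where C: "enriched_category (?W y) C" "code_cat (monad_cat x []) = code_cat C"
      by (auto simp: Enr_ob_carriers)
    then have "enriched_category (?W y) (monad_cat x [])" using code_cat_eqD[OF m C(1) C(2)] by simp
    from enriched_category.ext_type[OF this]
    have "ext (monad_cat x []) (enc ()) \<in> Ob (?W y)" by (rule PiE_mem) simp
    then show ?thesis by simp
  qed
  \<comment> \<open>this choice rules out that the triangle identity holds only by virtue of unspecified values\<close>
  obtain x where x: "F0 R (?W x) \<noteq> target (undefined :: ('v CAT2_mor, 'v CAT2_mor) arrow)"
    using inj[of "enc True" "enc False"] by (metis enc_eq_iff)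
  define N where "N = ?W x"
  define p where "p = F0 R N"
  define D where "D = F0 G p"
  have N: "N \<in> Ob BICAT" "locally_thin N" using W by (simp_all add: N_def)
  have p: "p \<in> CAT2_Mor" "target p = Z" "source p = Enr_ob N" using R0[OF N] by (simp_all add: p_def)
  have p_Ob: "p \<in> Ob (slice CAT2 Z)" using p by simp
  have "in_hom BICAT (\<epsilon> N) D N"
    using \<epsilon>.component_type[OF N(1)] N(1) by (simp add: comp_twofun_def compose_def id_twofun_def D_def p_def)
  then have \<epsilon>N: "\<epsilon> N \<in> BICAT_Mor" "source (\<epsilon> N) = D" "target (\<epsilon> N) = N" by (auto simp: in_hom_def)
  define E where "E = via (\<epsilon> N)"
  have \<epsilon>E: "\<epsilon> N = Arrow D E N" using \<epsilon>N by (metis E_def arrow.collapse)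
  have D: "bicategory D" "lax_functor D N E" using \<epsilon>N(1) unfolding \<epsilon>E by (auto simp: BICAT_Mor_def)

  \<comment> \<open>the triangle identity, read in the 2-category of 2-categories: the unit is a section of the
    change of base along the counit\<close>
  have \<eta>p: "\<eta> p \<in> slice_Mor CAT2 Z" "source (\<eta> p) = p"
    using \<eta>.component_type[OF p_Ob] p_Ob by (auto simp: in_hom_def id_twofun_def)
  have tri_p: "F1 R (\<epsilon> N) \<odot>\<^bsub>slice CAT2 Z\<^esub> \<eta> p = Arrow p (Id1 CAT2 (Enr_ob N)) p"
    using tri[OF N(1)] p by (simp add: p_def[symmetric])
  have cmp: "composable (slice CAT2 Z) (F1 R (\<epsilon> N)) (\<eta> p)"
  proof (rule ccontr)
    assume "\<not> ?thesis"
    then have "undefined = Arrow p (Id1 CAT2 (Enr_ob N)) p"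
      using slice_Cmp_undefined tri_p by metis
    from arg_cong[OF this, of target] show False using x by (simp add: p_def N_def)
  qed
  have cmp': "target (F1 R (\<epsilon> N)) = p" "via (F1 R (\<epsilon> N)) \<odot>\<^bsub>CAT2\<^esub> via (\<eta> p) = Id1 CAT2 (Enr_ob N)"
    using tri_p unfolding slice_Cmp[OF cmp] by simp_all
  have vE: "via (F1 R (\<epsilon> N)) = Enr_mor (\<epsilon> N)"
    using R1[OF \<epsilon>N(1)] cmp'(1) x by (auto simp: p_def N_def)
  define H where "H = via (\<eta> p)"
  have R\<epsilon>: "F1 R (\<epsilon> N) \<in> slice_Mor CAT2 Z" "source (F1 R (\<epsilon> N)) = target (\<eta> p)"
    using cmp \<eta>p by (auto simp: composable_def)
  have eH: "Enr_mor (\<epsilon> N) \<in> CAT2_Mor" "H \<in> CAT2_Mor" "source (Enr_mor (\<epsilon> N)) = target H"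
    and sH: "source H = Enr_ob N"
    using slice_MorD[OF R\<epsilon>(1)] slice_MorD[OF \<eta>p(1)]
    unfolding CAT2_in_hom vE H_def[symmetric] R\<epsilon>(2) \<eta>p(2) by (simp_all add: p)
  have tH: "target H = Enr_ob D" using eH(3) \<epsilon>N by simp
  have EN: "Enr_ob N \<in> Ob CAT2" using eH(2) sH by (auto simp: CAT2_Mor_def)
  have "CAT2_Cmp (Enr_mor (\<epsilon> N)) H = Arrow (Enr_ob N) (id_twofun (Enr_ob N)) (Enr_ob N)"
    using cmp'(2) CAT2_Cmp_eq[OF eH] CAT2_Id1[OF EN] unfolding vE H_def[symmetric] by simp
  then have "comp_twofun (Enr_ob N) (via (Enr_mor (\<epsilon> N))) (via H) = id_twofun (Enr_ob N)"
    by (simp add: CAT2_Cmp_def sH)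
  then have "F0 (comp_twofun (Enr_ob N) (via (Enr_mor (\<epsilon> N))) (via H)) y = F0 (id_twofun (Enr_ob N)) y" for y
    by simp
  then have sec: "F0 (via (Enr_mor (Arrow D E N))) (F0 (via H) y) = y" if "y \<in> Ob (Enr_ob N)" for y
    using that by (metis (no_types, lifting) \<epsilon>E comp_twofun_def compose_eq id_apply id_twofun_def
      restrict_apply' twofun.select_convs(1))
  have "two_functor (Enr_ob N) (Enr_ob D) (via H)"
    using eH(2) sH tH by (auto simp: CAT2_Mor_def)
  then obtain m w where m: "m \<in> Mor D" "F1 E m = word w" "expanding w"
    using section_expanding[of D x E "via H"] D sec unfolding N_def by blast

  \<comment> \<open>prefixing a letter is one of many ways to change precisely the expanding words\<close>
  define h where "h = (\<lambda>w. if expanding w then True # w else w)"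
  define P where "P = word_bicat x chaotic"
  define F where "F = (\<lambda>k. Arrow N (word_lax x act_le k) P)"
  have F: "F k \<in> BICAT_Mor" for k unfolding F_def N_def P_def by (rule act_le.word_lax_Mor)
  have EF: "Enr_mor (F id) = Enr_mor (F h)"
    unfolding F_def N_def P_def by (rule Enr_mor_word_lax) (simp add: h_def)
  have RF: "F1 R (F id) = F1 R (F h)"
    by (rule R1_cong[OF F F _ _ EF]) (simp_all add: F_def)
  have "F k \<odot>\<^bsub>BICAT\<^esub> \<epsilon> N = \<epsilon> P \<odot>\<^bsub>BICAT\<^esub> F1 G (F1 R (F k))" for k
    using \<epsilon>.natural1[of "F k"] F[of k]
    by (simp add: comp_twofun_def compose_def id_twofun_def) (simp add: F_def)
  then have "F id \<odot>\<^bsub>BICAT\<^esub> \<epsilon> N = F h \<odot>\<^bsub>BICAT\<^esub> \<epsilon> N" using RF by simp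
  then have "BICAT_Cmp (F id) (\<epsilon> N) = BICAT_Cmp (F h) (\<epsilon> N)"
    using BICAT_Cmp_eq[OF F \<epsilon>N(1)] \<epsilon>N by (simp add: F_def)
  then have "compose (Mor D) (F1 (word_lax x act_le id)) (F1 E) = compose (Mor D) (F1 (word_lax x act_le h)) (F1 E)"
    by (simp add: BICAT_Cmp_def comp_lax_def F_def \<epsilon>E)
  then have "compose (Mor D) (F1 (word_lax x act_le id)) (F1 E) m = compose (Mor D) (F1 (word_lax x act_le h)) (F1 E) m"
    by simp
  then show False using m by (simp add: compose_def h_def)
qed

lemma Enr_over_terminal:
  assumes B: "B \<in> Ob BICAT" and thin: "locally_thin B"
  shows "F0 (slice_lift BICAT one_bicat Enr) B \<in> CAT2_Mor"
    "target (F0 (slice_lift BICAT one_bicat Enr) B) = Enr_ob one_bicat"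
    "source (F0 (slice_lift BICAT one_bicat Enr) B) = Enr_ob B"
proof -
  obtain F where F: "bang BICAT one_bicat B = Arrow B F one_bicat" "lax_functor B one_bicat F"
    "Arrow B F one_bicat \<in> BICAT_Mor"
    using bang_one[OF B] by blast
  have "F0 (slice_lift BICAT one_bicat Enr) B = Enr_mor (Arrow B F one_bicat)"
    using B F by (simp add: slice_lift_def Let_def Enr_def)
  then show "F0 (slice_lift BICAT one_bicat Enr) B \<in> CAT2_Mor"
    "target (F0 (slice_lift BICAT one_bicat Enr) B) = Enr_ob one_bicat"
    "source (F0 (slice_lift BICAT one_bicat Enr) B) = Enr_ob B"
    using Enr_mor_CAT2[OF B thin one_Ob_BICAT thin_bicategory.thin[OF thin_bicategory_one] F(2)] by simp_all
qed

lemma F1_Enr_over_terminal: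
  "F \<in> BICAT_Mor \<Longrightarrow> F1 (slice_lift BICAT one_bicat Enr) F =
    Arrow (F1 Enr (bang BICAT one_bicat (source F))) (Enr_mor F) (F1 Enr (bang BICAT one_bicat (target F)))"
  by (simp add: slice_lift_def Let_def Enr_def)

theorem mainTheorem4:
  shows "\<not> parametric_right_two_adjoint
        (BICAT :: ('v::universe_pair bcy, 'v BICAT_mor, 'v BICAT_cel) twocat) one_bicat CAT2 Enr
    \<and> \<not> has_left_two_adjoint
        (BICAT :: ('v bcy, 'v BICAT_mor, 'v BICAT_cel) twocat) (slice CAT2 Set_lc) Enr_over_Set"
proof
  have "F0 Enr one_bicat = (Enr_ob one_bicat :: 'v tcat)"
    by (simp add: Enr_def one_Ob_BICAT del: BICAT_sel)
  then show "\<not> parametric_right_two_adjoint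
        (BICAT :: ('v::universe_pair bcy, 'v BICAT_mor, 'v BICAT_cel) twocat) one_bicat CAT2 Enr"
    unfolding parametric_right_two_adjoint_def
    by (simp only:) (rule no_left_adjoint, simp_all only: Enr_over_terminal F1_Enr_over_terminal arrow.sel simp_thms)
  let ?S = "slice CAT2 (Enr_ob one_bicat :: 'v tcat)"
  have S: "Src CAT2 Enr_one_to_Set = (Enr_ob one_bicat :: 'v tcat)"
    by (simp add: Enr_one_to_Set_CAT2)
  show "\<not> has_left_two_adjoint
        (BICAT :: ('v bcy, 'v BICAT_mor, 'v BICAT_cel) twocat) (slice CAT2 Set_lc) Enr_over_Set"
  proof (rule no_left_adjoint)
    fix B :: "'v bcy" assume B: "B \<in> Ob BICAT" "locally_thin B"
    note * = Enr_over_terminal[OF B]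
    have "F0 Enr_over_Set B = CAT2_Cmp Enr_one_to_Set (F0 (slice_lift BICAT one_bicat Enr) B)"
      using B(1) * CAT2_Cmp_eq[OF Enr_one_to_Set_CAT2 *(1)]
      by (simp add: Enr_over_Set_def comp_twofun_def compose_def slice_push_def Let_def S)
    then show "F0 Enr_over_Set B \<in> CAT2_Mor \<and> target (F0 Enr_over_Set B) = Set_lc \<and>
        source (F0 Enr_over_Set B) = Enr_ob B"
      using CAT2_Cmp_Mor[OF Enr_one_to_Set_CAT2 *(1)] * by (simp add: CAT2_Cmp_def)
  next
    fix F :: "'v BICAT_mor" assume F: "F \<in> BICAT_Mor"
    show "F1 Enr_over_Set F = undefined \<or> via (F1 Enr_over_Set F) = Enr_mor F"
      using F by (auto simp: Enr_over_Set_def comp_twofun_def compose_def slice_push_def Let_def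
          F1_Enr_over_terminal restrict_def)
  next
    fix F G :: "'v BICAT_mor"
    assume "F \<in> BICAT_Mor" "G \<in> BICAT_Mor" "source F = source G" "target F = target G" "Enr_mor F = Enr_mor G"
    then show "F1 Enr_over_Set F = F1 Enr_over_Set G"
      by (simp add: Enr_over_Set_def comp_twofun_def compose_def F1_Enr_over_terminal)
  qed
qed

end
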